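(* For every prime power $q$ there exists a constant $N(q)$ such that for all integers $n,k$ with $n \ge N(q)$ and $\min(k,n-k) \ge 2$, the Grassmann scheme $J_q(n,k)$ is degree-one trivial (DOT), i.e. every Boolean degree one function on $J_q(n,k)$ is trivial.
   Context: $J_q(n,k)$ is the set of all $k$-dimensional subspaces of $\mathbb{F}_q^n$. A point is a one-dimensional subspace of $\mathbb{F}_q^n$. A function $f\colon J_q(n,k)\to\mathbb{R}$ is Boolean if $f(V)\in\{0,1\}$ for all $V$, and has degree one if $f=\sum_p c_p x_p$ for some real coefficients $c_p$, where the sum is over all points $p$ and $x_p(V)=1$ if $p\subseteq V$, $x_p(V)=0$ otherwise. For a point $r$, $y_r(V)=1$ if $V$ is orthogonal to $r$ (i.e. $V\subseteq r^\perp$), and $y_r(V)=0$ otherwise; orthogonality is with respect to the standard bilinear form $\langle u,v\rangle=\sum_i u_iv_i$ on $\mathbb{F}_q^n$. A Boolean degree one function on $J_q(n,k)$ is trivial if it is one of $0,\ 1,\ x_p,\ 1-x_p,\ y_r,\ 1-y_r,\ x_p+y_r,\ 1-x_p-y_r$ for some points $p,r$, where in the last two cases $p\not\perp r$. $J_q(n,k)$ is degree-one trivial (DOT) if all Boolean degree one functions on $J_q(n,k)$ are trivial. *)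

theory Defs
  imports
    "HOL-Library.Function_Algebras"
    "HOL-Library.Cardinality"
    "HOL-Number_Theory.Prime_Powers"
begin

text \<open>
  The dimension \<open>n\<close> varies inside one statement, so \<open>F\<^sup>n\<close> cannot be indexed by a type. Vectors are
  functions on \<open>nat\<close> with pointwise operations, and \<open>F\<^sup>n\<close> consists of those vanishing outside
  \<open>{..<n}\<close>. Subspaces and dimension are those of the library's vector space theory.
\<close>

definition vec_scale :: "'a::field \<Rightarrow> (nat \<Rightarrow> 'a) \<Rightarrow> (nat \<Rightarrow> 'a)" where
  "vec_scale c v = (\<lambda>i. c * v i)"

global_interpretation fvec: vector_space "vec_scale :: 'a::field \<Rightarrow> (nat \<Rightarrow> 'a) \<Rightarrow> (nat \<Rightarrow> 'a)"
  by standard (auto simp: vec_scale_def fun_eq_iff algebra_simps)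

definition coord_space :: "nat \<Rightarrow> (nat \<Rightarrow> 'a::field) set" where
  "coord_space n = {v. \<forall>i\<ge>n. v i = 0}"

definition Grassmann :: "nat \<Rightarrow> nat \<Rightarrow> (nat \<Rightarrow> 'a::field) set set" where
  "Grassmann n k = {V. fvec.subspace V \<and> V \<subseteq> coord_space n \<and> fvec.dim V = k}"

abbreviation points :: "nat \<Rightarrow> (nat \<Rightarrow> 'a::field) set set" where
  "points n \<equiv> Grassmann n 1"

definition bilin :: "nat \<Rightarrow> (nat \<Rightarrow> 'a::field) \<Rightarrow> (nat \<Rightarrow> 'a) \<Rightarrow> 'a" where
  "bilin n u v = (\<Sum>i<n. u i * v i)"

definition orthogonal_spaces :: "nat \<Rightarrow> (nat \<Rightarrow> 'a::field) set \<Rightarrow> (nat \<Rightarrow> 'a) set \<Rightarrow> bool" where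
  "orthogonal_spaces n U V \<longleftrightarrow> (\<forall>u\<in>U. \<forall>v\<in>V. bilin n u v = 0)"

definition x_fun :: "(nat \<Rightarrow> 'a::field) set \<Rightarrow> (nat \<Rightarrow> 'a) set \<Rightarrow> real" where
  "x_fun p V = (if p \<subseteq> V then 1 else 0)"

definition y_fun :: "nat \<Rightarrow> (nat \<Rightarrow> 'a::field) set \<Rightarrow> (nat \<Rightarrow> 'a) set \<Rightarrow> real" where
  "y_fun n r V = (if orthogonal_spaces n r V then 1 else 0)"

text \<open>
  A function on the Grassmann scheme is represented by a total function, of which only the values on
  \<open>Grassmann n k\<close> matter: all predicates below, including equality of functions, are relative to
  this set.
\<close>

definition boolean_fun :: "nat \<Rightarrow> nat \<Rightarrow> ((nat \<Rightarrow> 'a::field) set \<Rightarrow> real) \<Rightarrow> bool" where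
  "boolean_fun n k f \<longleftrightarrow> (\<forall>V\<in>Grassmann n k. f V \<in> {0, 1})"

definition degree_one :: "nat \<Rightarrow> nat \<Rightarrow> ((nat \<Rightarrow> 'a::{field,finite}) set \<Rightarrow> real) \<Rightarrow> bool" where
  "degree_one n k f \<longleftrightarrow>
     (\<exists>c. \<forall>V\<in>Grassmann n k. f V = (\<Sum>p\<in>points n. c p * x_fun p V))"

definition eq_on_Grassmann ::
    "nat \<Rightarrow> nat \<Rightarrow> ((nat \<Rightarrow> 'a::field) set \<Rightarrow> real) \<Rightarrow> ((nat \<Rightarrow> 'a) set \<Rightarrow> real) \<Rightarrow> bool" where
  "eq_on_Grassmann n k f g \<longleftrightarrow> (\<forall>V\<in>Grassmann n k. f V = g V)"

definition trivial_fun :: "nat \<Rightarrow> nat \<Rightarrow> ((nat \<Rightarrow> 'a::field) set \<Rightarrow> real) \<Rightarrow> bool" where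
  "trivial_fun n k f \<longleftrightarrow>
     eq_on_Grassmann n k f (\<lambda>V. 0) \<or>
     eq_on_Grassmann n k f (\<lambda>V. 1) \<or>
     (\<exists>p\<in>points n. eq_on_Grassmann n k f (\<lambda>V. x_fun p V)) \<or>
     (\<exists>p\<in>points n. eq_on_Grassmann n k f (\<lambda>V. 1 - x_fun p V)) \<or>
     (\<exists>r\<in>points n. eq_on_Grassmann n k f (\<lambda>V. y_fun n r V)) \<or>
     (\<exists>r\<in>points n. eq_on_Grassmann n k f (\<lambda>V. 1 - y_fun n r V)) \<or>
     (\<exists>p\<in>points n. \<exists>r\<in>points n. \<not> orthogonal_spaces n p r \<and>
        eq_on_Grassmann n k f (\<lambda>V. x_fun p V + y_fun n r V)) \<or>
     (\<exists>p\<in>points n. \<exists>r\<in>points n. \<not> orthogonal_spaces n p r \<and>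
        eq_on_Grassmann n k f (\<lambda>V. 1 - x_fun p V - y_fun n r V))"

definition degree_one_trivial :: "'a::{field,finite} itself \<Rightarrow> nat \<Rightarrow> nat \<Rightarrow> bool" where
  "degree_one_trivial T n k \<longleftrightarrow>
     (\<forall>f :: (nat \<Rightarrow> 'a) set \<Rightarrow> real. boolean_fun n k f \<and> degree_one n k f \<longrightarrow> trivial_fun n k f)"

text \<open>
  Since \<^const>\<open>sum\<close> is \<open>0\<close> on infinite sets, the sum in \<^const>\<open>degree_one\<close> is meaningful only because
  there are finitely many points.
\<close>

lemma finite_coord_space: "finite (coord_space n :: (nat \<Rightarrow> 'a::{field,finite}) set)"
proof -
  have "coord_space n = {v :: nat \<Rightarrow> 'a. \<forall>i. (i \<in> {..<n} \<longrightarrow> v i \<in> UNIV) \<and> (i \<notin> {..<n} \<longrightarrow> v i = 0)}"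
    by (auto simp: coord_space_def)
  then show ?thesis
    using finite_set_of_finite_funs[of "{..<n}" "UNIV :: 'a set" 0] by simp
qed

lemma finite_Grassmann: "finite (Grassmann n k :: (nat \<Rightarrow> 'a::{field,finite}) set set)"
  by (rule finite_subset[of _ "Pow (coord_space n)"])
    (auto simp: Grassmann_def finite_coord_space)

end

theory Submission
  imports Defs
begin

text \<open>
  Let \<open>q\<close> be the number of field elements. A degree one function on \<open>k\<close>-spaces is given by a weight
  \<open>c\<close>, a real function on vectors that is constant on the nonzero vectors of each point: its
  value at \<open>K\<close> is the sum of \<open>c\<close> over the points of \<open>K\<close>. Up to passing from \<open>f\<close> to \<open>1 - f\<close>, the trivial
  functions are those whose weight is standard: the indicator of at most one point \<open>a\<close>, or
  \<open>1/q\<^sup>k\<^sup>-\<^sup>1\<close> outside a hyperplane \<open>H\<close> and \<open>0\<close> on it, minus the indicator of at most one point off \<open>H\<close>.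

  For \<open>k = 2\<close> and large \<open>n\<close> the argument is Ramsey theoretic. The sums of \<open>c\<close> over lines lie in
  \<open>{0, 1}\<close>, and the relations in a three-dimensional subspace leave only boundedly many values for \<open>c\<close>
  (\<open>boolean_weight_values\<close>). Every colouring of a large affine space with boundedly many colours
  is constant on a flat of prescribed dimension (\<open>mono_flat_exists\<close>, by colour focusing). Applied
  twice to \<open>c\<close>, this gives a large subspace \<open>U\<close> on which \<open>c\<close> or its complement vanishes
  (\<open>zero_subspace_exists\<close>). On a coset of such a \<open>U\<close>, all affine line sums of \<open>c\<close> lie in \<open>{0, 1}\<close>.
  Ramsey again shows that on each large flat where such a function is constant the constant is the
  same, \<open>0\<close> or \<open>1/q\<close>, and comparison of a single vector with a nearby constant flat shows that the
  function equals this constant except at one vector at most (\<open>affine_classification\<close>). Finally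
  \<open>weight_gluing\<close> combines the cosets: modulo \<open>U\<close> the vectors of base value \<open>0\<close> form the whole space or a
  hyperplane, and two exceptional points would give some \<open>k\<close>-space a sum other than \<open>0\<close> or \<open>1\<close>.

  The gluing works for every \<open>k \<ge> 2\<close>, so that a classification in dimension \<open>n\<close> gives one in dimension
  \<open>n + 1\<close> for the same \<open>k\<close> (\<open>weight_trivial_Suc\<close>). Taking orthogonal complements exchanges \<open>k\<close> and \<open>n - k\<close>
  (\<open>degree_one_trivial_dual\<close>). Starting from \<open>(j + 2, 2)\<close>, duality gives \<open>(j + 2, j)\<close> and the first step
  gives \<open>(n, j)\<close> for all \<open>n \<ge> j + 2\<close>, provided \<open>j\<close> is large. If \<open>n\<close> is large, then \<open>k\<close> or \<open>n - k\<close> is large,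
  and a last use of duality covers both cases; in particular the bound on \<open>n\<close> does not depend on \<open>k\<close>.
\<close>

section \<open>Subspaces of a finite vector space\<close>

type_synonym 'a vec = "nat \<Rightarrow> 'a"

notation vec_scale (infixr "\<odot>" 75)

text \<open>
  The subspace spanned by a subspace \<open>A\<close> and one further vector \<open>x\<close>.
\<close>

definition adjoin :: "'a::field vec set \<Rightarrow> 'a vec \<Rightarrow> 'a vec set" where
  "adjoin A x = {w + t \<odot> x |w t. w \<in> A}"

lemma card_field_ge_2: "CARD('a::{field,finite}) \<ge> 2"
proof -
  have "card {0, 1 :: 'a} \<le> CARD('a)" by (rule card_mono) auto
  then show ?thesis by simp
qed

lemma adjoinI: "w \<in> A \<Longrightarrow> w + t \<odot> x \<in> adjoin A x"
  by (auto simp: adjoin_def)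

lemma subset_adjoin: "A \<subseteq> adjoin A x"
  using adjoinI[of _ A 0 x] by auto

lemma adjoin_self: "0 \<in> A \<Longrightarrow> x \<in> adjoin A x"
  using adjoinI[of 0 A 1 x] by simp

lemma subspace_adjoin:
  assumes "fvec.subspace A"
  shows "fvec.subspace (adjoin A x)"
proof (rule fvec.subspaceI)
  show "0 \<in> adjoin A x" using subset_adjoin[of A x] fvec.subspace_0[OF assms] by blast
next
  fix u v assume "u \<in> adjoin A x" "v \<in> adjoin A x"
  then obtain w t w' t' where "u = w + t \<odot> x" "v = w' + t' \<odot> x" "w \<in> A" "w' \<in> A"
    by (auto simp: adjoin_def)
  then have "u + v = (w + w') + (t + t') \<odot> x" "w + w' \<in> A"
    using fvec.subspace_add[OF assms] by (auto simp: fvec.scale_left_distrib)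
  then show "u + v \<in> adjoin A x" by (metis adjoinI)
next
  fix c u assume "u \<in> adjoin A x"
  then obtain w t where "u = w + t \<odot> x" "w \<in> A" by (auto simp: adjoin_def)
  then have "c \<odot> u = c \<odot> w + (c * t) \<odot> x" "c \<odot> w \<in> A"
    using fvec.subspace_scale[OF assms] by (auto simp: fvec.scale_right_distrib)
  then show "c \<odot> u \<in> adjoin A x" by (metis adjoinI)
qed

lemma adjoin_subset:
  assumes "fvec.subspace V" "A \<subseteq> V" "x \<in> V"
  shows "adjoin A x \<subseteq> V"
  using assms by (auto simp: adjoin_def intro!: fvec.subspace_add fvec.subspace_scale)

lemma inj_on_adjoin:
  assumes "fvec.subspace A" "x \<notin> A"
  shows "inj_on (\<lambda>(t, w). w + t \<odot> x) (UNIV \<times> A)"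
proof (rule inj_onI, clarsimp)
  fix t w t' w' assume w: "w \<in> A" "w' \<in> A" and eq: "w + t \<odot> x = w' + t' \<odot> x"
  have *: "(t - t') \<odot> x = w' - w"
    using eq by (simp add: fvec.scale_left_diff_distrib algebra_simps)
  have "t = t'"
  proof (rule ccontr)
    assume "t \<noteq> t'"
    then have "x = inverse (t - t') \<odot> (w' - w)"
      by (simp add: *[symmetric])
    also have "\<dots> \<in> A" using w assms by (intro fvec.subspace_scale fvec.subspace_diff)
    finally show False using assms by simp
  qed
  then show "t = t' \<and> w = w'" using eq by simp
qed

lemma adjoin_image: "adjoin A x = (\<lambda>(t, w). w + t \<odot> x) ` (UNIV \<times> A)"
  by (auto simp: adjoin_def)

lemma sum_adjoin:
  assumes "fvec.subspace A" "x \<notin> A"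
  shows "sum g (adjoin A (x :: 'a::{field,finite} vec)) = (\<Sum>t\<in>UNIV. \<Sum>w\<in>A. g (w + t \<odot> x))"
  unfolding adjoin_image sum.reindex[OF inj_on_adjoin[OF assms]]
  by (simp add: sum.cartesian_product case_prod_beta)

lemma card_adjoin:
  assumes "fvec.subspace A" "x \<notin> A"
  shows "card (adjoin A (x :: 'a::{field,finite} vec)) = CARD('a) * card A"
  unfolding adjoin_image card_image[OF inj_on_adjoin[OF assms]]
  by (simp add: card_cartesian_product)

lemma finite_adjoin: "finite A \<Longrightarrow> finite (adjoin A (x :: 'a::{field,finite} vec))"
  unfolding adjoin_image by simp

lemma span_insert_adjoin: "fvec.span (insert x B) = adjoin (fvec.span B) x"
  unfolding fvec.span_insert adjoin_def
proof safe
  fix v k assume "v - k \<odot> x \<in> fvec.span B"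
  then show "\<exists>w t. v = w + t \<odot> x \<and> w \<in> fvec.span B"
    by (intro exI[of _ "v - k \<odot> x"] exI[of _ k]) simp
next
  fix w t assume "w \<in> fvec.span B"
  then show "\<exists>k. w + t \<odot> x - k \<odot> x \<in> fvec.span B"
    by (intro exI[of _ t]) simp
qed

lemma card_span_independent:
  fixes B :: "'a::{field,finite} vec set"
  assumes "finite B" "fvec.independent B"
  shows "finite (fvec.span B) \<and> card (fvec.span B) = CARD('a) ^ card B"
  using assms
proof (induction B rule: finite_induct)
  case empty
  then show ?case by simp
next
  case (insert x B)
  then have "x \<notin> fvec.span B" "fvec.independent B"
    by (simp_all add: fvec.independent_insert)
  then show ?case
    using insert by (simp add: span_insert_adjoin card_adjoin finite_adjoin)
qed

text \<open>
  The ambient type of all functions on \<open>nat\<close> is infinite-dimensional, so dimensions are handled through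
  cardinalities: the finite subspaces of dimension \<open>k\<close> are those with \<open>q\<^sup>k\<close> elements.
\<close>

lemma card_subspace:
  fixes V :: "'a::{field,finite} vec set"
  assumes "fvec.subspace V" "finite V"
  shows "card V = CARD('a) ^ fvec.dim V"
proof -
  obtain B where B: "B \<subseteq> V" "fvec.independent B" "V \<subseteq> fvec.span B" "card B = fvec.dim V"
    using fvec.basis_exists by blast
  have "fvec.span B = V" using B assms by (simp add: fvec.span_subspace)
  then show ?thesis
    using card_span_independent[of B] B finite_subset[OF B(1) assms(2)] by simp
qed

lemma subspace_coord_space: "fvec.subspace (coord_space n)"
  by (rule fvec.subspaceI) (auto simp: coord_space_def vec_scale_def)

definition unit_vec :: "nat \<Rightarrow> 'a::field vec" where
  "unit_vec i = (\<lambda>j. if j = i then 1 else 0)"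

lemma coord_space_Suc:
  "coord_space (Suc n) = adjoin (coord_space n) (unit_vec n :: 'a::field vec)"
  (is "?L = ?R")
proof
  show "?R \<subseteq> ?L"
    by (auto simp: adjoin_def coord_space_def unit_vec_def vec_scale_def)
next
  show "?L \<subseteq> ?R"
  proof
    fix v :: "'a vec" assume v: "v \<in> coord_space (Suc n)"
    have "v = v(n := 0) + v n \<odot> unit_vec n"
      by (auto simp: fun_eq_iff unit_vec_def vec_scale_def)
    moreover have "v(n := 0) \<in> coord_space n"
      using v by (auto simp: coord_space_def)
    ultimately show "v \<in> ?R" by (metis adjoinI)
  qed
qed

lemma unit_vec_notin: "unit_vec n \<notin> coord_space n"
  by (auto simp: unit_vec_def coord_space_def)

lemma unit_vec_mem: "i < n \<Longrightarrow> unit_vec i \<in> coord_space n"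
  by (auto simp: unit_vec_def coord_space_def)

lemma coord_space_0: "coord_space 0 = {0}"
  by (auto simp: coord_space_def)

lemma coord_space_mono: "m \<le> n \<Longrightarrow> coord_space m \<subseteq> coord_space n"
  by (auto simp: coord_space_def)

lemma card_coord_space: "card (coord_space n :: 'a::{field,finite} vec set) = CARD('a) ^ n"
  by (induction n)
    (simp_all add: coord_space_0 coord_space_Suc card_adjoin subspace_coord_space unit_vec_notin)

lemma finite_sub_coord: "V \<subseteq> coord_space n \<Longrightarrow> finite (V :: 'a::{field,finite} vec set)"
  using finite_coord_space finite_subset by blast

lemma Grassmann_iff_card:
  fixes V :: "'a::{field,finite} vec set"
  shows "V \<in> Grassmann n k \<longleftrightarrow>
    fvec.subspace V \<and> V \<subseteq> coord_space n \<and> card V = CARD('a) ^ k"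
proof -
  have pow: "CARD('a) ^ fvec.dim V = CARD('a) ^ k \<longleftrightarrow> fvec.dim V = k"
    using card_field_ge_2[where 'a='a] by simp
  show ?thesis
  proof (cases "fvec.subspace V \<and> V \<subseteq> coord_space n")
    case True
    then have "card V = CARD('a) ^ fvec.dim V"
      using card_subspace finite_sub_coord by blast
    with True pow show ?thesis by (simp add: Grassmann_def)
  qed (auto simp: Grassmann_def)
qed

lemma exists_intermediate_subspace:
  fixes V :: "'a::{field,finite} vec set"
  assumes "fvec.subspace A" "fvec.subspace V" "A \<subseteq> V" "finite V"
    and "card A = CARD('a) ^ j" "j \<le> i" "CARD('a) ^ i \<le> card V"
  shows "\<exists>B. fvec.subspace B \<and> A \<subseteq> B \<and> B \<subseteq> V \<and> card B = CARD('a) ^ i"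
  using assms(6,7)
proof (induction i rule: dec_induct)
  case base
  then show ?case using assms by blast
next
  case (step i)
  have lt: "CARD('a) ^ i < CARD('a) ^ Suc i"
    using card_field_ge_2[where 'a='a] by simp
  then have "CARD('a) ^ i \<le> card V" using step.prems by linarith
  then obtain B where B: "fvec.subspace B" "A \<subseteq> B" "B \<subseteq> V" "card B = CARD('a) ^ i"
    using step.IH by blast
  have "B \<noteq> V" using lt step.prems B(4) by auto
  then obtain x where x: "x \<in> V" "x \<notin> B" using B by blast
  show ?case
    using B subset_adjoin[of B x] adjoin_subset[OF assms(2) B(3) x(1)] subspace_adjoin[OF B(1), of x]
      card_adjoin[OF B(1) x(2)]
    by (intro exI[of _ "adjoin B x"]) auto
qed

lemma exists_subspace:
  fixes V :: "'a::{field,finite} vec set"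
  assumes "fvec.subspace V" "finite V" "CARD('a) ^ i \<le> card V"
  shows "\<exists>B. fvec.subspace B \<and> B \<subseteq> V \<and> card B = CARD('a) ^ i"
  using exists_intermediate_subspace[of "{0}" V 0 i] assms fvec.subspace_0[OF assms(1)] by auto

abbreviation lin :: "('a::field vec \<Rightarrow> 'a vec) \<Rightarrow> bool" where
  "lin \<equiv> Vector_Spaces.linear vec_scale vec_scale"

lemma linI:
  assumes "\<And>x y. f (x + y) = f x + f y" "\<And>t x. f (t \<odot> x) = t \<odot> f x"
  shows "lin f"
  using assms
  by (simp add: Vector_Spaces.linear_iff fvec.vector_space_axioms)

lemma lin_add: "lin f \<Longrightarrow> f (x + y) = f x + f y"
  by (simp add: Vector_Spaces.linear_iff)

lemma lin_scale: "lin f \<Longrightarrow> f (t \<odot> x) = t \<odot> f x"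
  by (simp add: Vector_Spaces.linear_iff)

lemma lin_0: "lin f \<Longrightarrow> f 0 = 0"
  using lin_scale[of f 0 0] by simp

lemma lin_diff: "lin f \<Longrightarrow> f (x - y) = f x - f y"
  using lin_add[of f "x - y" y] by (simp add: algebra_simps)

section \<open>Linear embeddings of coordinate spaces\<close>

text \<open>
  \<open>emb d n \<phi>\<close>: the linear map \<open>\<phi>\<close> restricts to an injective map from \<open>F\<^sup>d\<close> to \<open>F\<^sup>n\<close>. The map itself is
  total; only its values on \<open>F\<^sup>d\<close> matter. A \<open>d\<close>-flat in \<open>F\<^sup>n\<close> is \<open>b + \<phi> z\<close>, with \<open>z\<close> ranging over \<open>F\<^sup>d\<close>.
\<close>

definition emb :: "nat \<Rightarrow> nat \<Rightarrow> ('a::field vec \<Rightarrow> 'a vec) \<Rightarrow> bool" where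
  "emb d n \<phi> \<longleftrightarrow> lin \<phi> \<and> (\<forall>z\<in>coord_space d. \<phi> z \<in> coord_space n \<and> (\<phi> z = 0 \<longrightarrow> z = 0))"

lemma emb_lin: "emb d n \<phi> \<Longrightarrow> lin \<phi>"
  and emb_mem: "emb d n \<phi> \<Longrightarrow> z \<in> coord_space d \<Longrightarrow> \<phi> z \<in> coord_space n"
  and emb_ker: "emb d n \<phi> \<Longrightarrow> z \<in> coord_space d \<Longrightarrow> \<phi> z = 0 \<longleftrightarrow> z = 0"
  by (auto simp only: emb_def lin_0)

lemma coord_add: "x \<in> coord_space n \<Longrightarrow> y \<in> coord_space n \<Longrightarrow> x + y \<in> coord_space n"
  and coord_diff: "x \<in> coord_space n \<Longrightarrow> y \<in> coord_space n \<Longrightarrow> x - y \<in> coord_space n"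
  and coord_scale: "x \<in> coord_space n \<Longrightarrow> t \<odot> x \<in> coord_space n"
  and coord_0: "0 \<in> coord_space n"
  using subspace_coord_space
  by (blast intro: fvec.subspace_add fvec.subspace_diff fvec.subspace_scale fvec.subspace_0)+

lemma emb_inj_on:
  assumes "emb d n \<phi>"
  shows "inj_on \<phi> (coord_space d)"
proof (rule inj_onI)
  fix x y assume xy: "x \<in> coord_space d" "y \<in> coord_space d" "\<phi> x = \<phi> y"
  then have "\<phi> (x - y) = 0" using lin_diff[OF emb_lin[OF assms], of x y] by simp
  then show "x = y" using emb_ker[OF assms coord_diff[OF xy(1,2)]] by simp
qed

lemma emb_mono: "emb d n \<phi> \<Longrightarrow> d' \<le> d \<Longrightarrow> n \<le> n' \<Longrightarrow> emb d' n' \<phi>"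
  using coord_space_mono[of d' d] coord_space_mono[of n n'] unfolding emb_def by blast

lemma lin_comp: "lin \<phi> \<Longrightarrow> lin \<psi> \<Longrightarrow> lin (\<lambda>z. \<psi> (\<phi> z))"
  by (intro linI) (simp_all only: lin_add lin_scale)

lemma lin_scaled: "lin \<phi> \<Longrightarrow> lin (\<lambda>z. t \<odot> \<phi> z)"
  by (intro linI)
    (simp_all only: lin_add lin_scale fvec.scale_right_distrib fvec.scale_scale mult.commute)

lemma lin_plus: "lin \<phi> \<Longrightarrow> lin \<psi> \<Longrightarrow> lin (\<lambda>z. \<phi> z + \<psi> z)"
  by (intro linI) (simp_all only: lin_add lin_scale fvec.scale_right_distrib ac_simps)

lemma emb_comp: "emb d m \<phi> \<Longrightarrow> emb m n \<psi> \<Longrightarrow> emb d n (\<lambda>z. \<psi> (\<phi> z))"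
  using lin_comp[of \<phi> \<psi>] unfolding emb_def by blast

lemma emb_scale: "emb d n \<phi> \<Longrightarrow> t \<noteq> 0 \<Longrightarrow> emb d n (\<lambda>z. t \<odot> \<phi> z)"
  using lin_scaled[of \<phi> t] unfolding emb_def by (auto intro: coord_scale)

lemma emb_id: "emb n n (\<lambda>z. z)"
  by (auto simp: emb_def intro!: linI)

text \<open>
  Moves a vector up by \<open>n\<close> coordinates, so that \<open>x + shift n v\<close> with \<open>x\<close> in \<open>F\<^sup>n\<close> and \<open>v\<close> in \<open>F\<^sup>m\<close> represents
  the pair \<open>(x, v)\<close> in \<open>F\<^sup>n\<^sup>+\<^sup>m\<close>.
\<close>

definition shift :: "nat \<Rightarrow> 'a::field vec \<Rightarrow> 'a vec" where
  "shift n v = (\<lambda>i. if i < n then 0 else v (i - n))"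

lemma shift_add: "shift n (u + v) = shift n u + shift n v"
  and shift_scale: "shift n (t \<odot> v) = t \<odot> shift n v"
  by (auto simp: shift_def vec_scale_def)

lemma lin_shift: "lin (shift n)"
  by (intro linI shift_add shift_scale)

lemma shift_mem: "v \<in> coord_space m \<Longrightarrow> shift n v \<in> coord_space (n + m)"
  by (auto simp: shift_def coord_space_def)

lemma add_shift_mem:
  "x \<in> coord_space n \<Longrightarrow> v \<in> coord_space m \<Longrightarrow> x + shift n v \<in> coord_space (n + m)"
  using coord_space_mono[OF le_add1, of n m] by (blast intro: coord_add shift_mem)

lemma add_shift_eq_0:
  assumes "x \<in> coord_space n" "x + shift n v = 0"
  shows "v = 0"
proof
  fix i
  have "(x + shift n v) (n + i) = 0" using assms(2) by simp
  then show "v i = 0 i" using assms(1) by (simp add: shift_def coord_space_def)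
qed

lemma emb_add_shift:
  assumes "lin \<phi>" "\<And>z. z \<in> coord_space d \<Longrightarrow> \<phi> z \<in> coord_space n" "emb d m \<psi>"
  shows "emb d (n + m) (\<lambda>z. \<phi> z + shift n (\<psi> z))"
  unfolding emb_def
proof (intro conjI ballI impI)
  show "lin (\<lambda>z. \<phi> z + shift n (\<psi> z))"
    by (rule lin_plus[OF assms(1) lin_comp[OF emb_lin[OF assms(3)] lin_shift]])
next
  fix z :: "'a vec" assume z: "z \<in> coord_space d"
  show "\<phi> z + shift n (\<psi> z) \<in> coord_space (n + m)"
    using assms z by (intro add_shift_mem) (auto intro: emb_mem)
  assume "\<phi> z + shift n (\<psi> z) = 0"
  then have "\<psi> z = 0" using add_shift_eq_0 assms(2) z by blast
  then show "z = 0" using emb_ker[OF assms(3) z] by simp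
qed

section \<open>Monochromatic flats\<close>

lemma finite_colour_code:
  assumes "finite C"
  shows "\<exists>e. inj_on e C \<and> e ` C \<subseteq> {..<card C}"
proof -
  obtain e and n :: nat where e: "e ` C = {i. i < n}" "inj_on e C"
    using finite_imp_inj_to_nat_seg[OF assms] by blast
  then have "card C = n" using card_image by fastforce
  then show ?thesis using e by (intro exI[of _ e]) auto
qed

text \<open>
  An affine version of Gallai's theorem: under every colouring of a large \<open>F\<^sup>n\<close> some copy \<open>b + \<phi> T\<close> of a
  finite pattern \<open>T\<close> is monochromatic. The proof adds a vector \<open>t0\<close> to \<open>T\<close> by colour focusing. A focus
  \<open>x\<close> of \<open>s\<close> colours is a vector such that, for \<open>s\<close> different colours, some copy of \<open>insert t0 T\<close> has \<open>x\<close> as the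
  image of \<open>t0\<close> and this colour on the image of \<open>T\<close>. With all \<open>r\<close> colours focused, the colour of \<open>x\<close>
  itself completes one of the copies.
\<close>

lemma mono_pattern_exists:
  fixes T :: "'a::{field,finite} vec set"
  assumes "finite T" "T \<subseteq> coord_space d"
  shows "\<exists>n. \<forall>\<chi> :: 'a vec \<Rightarrow> nat. \<chi> ` coord_space n \<subseteq> {..<r} \<longrightarrow>
    (\<exists>b\<in>coord_space n. \<exists>\<phi>. emb d n \<phi> \<and> (\<exists>col. \<forall>t\<in>T. \<chi> (b + \<phi> t) = col))"
  using assms
proof (induction T arbitrary: r rule: finite_induct)
  case empty
  show ?case using emb_id coord_0 by (intro exI[of _ d]) auto
next
  case (insert t0 T)
  define mono where "mono n \<chi> \<longleftrightarrow> (\<exists>b\<in>coord_space n. \<exists>\<phi>. emb d n \<phi> \<and>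
     (\<exists>col. \<forall>t\<in>insert t0 T. \<chi> (b + \<phi> t) = col))" for n and \<chi> :: "'a vec \<Rightarrow> nat"
  define focused where "focused n \<chi> s \<longleftrightarrow> (\<exists>x\<in>coord_space n. \<exists>Cs\<subseteq>{..<r}. card Cs = s \<and> \<chi> x \<notin> Cs \<and>
     (\<forall>col\<in>Cs. \<exists>\<phi>. emb d n \<phi> \<and> (\<forall>t\<in>T. \<chi> (x + \<phi> (t - t0)) = col)))"
     for n and \<chi> :: "'a vec \<Rightarrow> nat" and s
  have t0: "t0 \<in> coord_space d" and T: "T \<subseteq> coord_space d" using insert.prems by auto
  have IH: "\<exists>n. \<forall>\<chi> :: 'a vec \<Rightarrow> nat. \<chi> ` coord_space n \<subseteq> {..<r} \<longrightarrow>
    (\<exists>b\<in>coord_space n. \<exists>\<phi>. emb d n \<phi> \<and> (\<exists>col. \<forall>t\<in>T. \<chi> (b + \<phi> t) = col))" for r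
    using insert.IH T by blast
  show ?case
  proof (cases "T = {}")
    case True
    then show ?thesis using emb_id coord_0 by (intro exI[of _ d]) auto
  next
    case False
    then obtain t1 where t1: "t1 \<in> T" by blast
    have focus: "\<exists>n. \<forall>\<chi>. \<chi> ` coord_space n \<subseteq> {..<r} \<longrightarrow> mono n \<chi> \<or> focused n \<chi> s" for s
    proof (induction s)
      case 0
      show ?case
        by (intro exI[of _ 0]) (auto simp: focused_def coord_0 intro!: bexI[of _ 0])
    next
      case (Suc s)
      then obtain n1 where n1: "\<And>\<chi>. \<chi> ` coord_space n1 \<subseteq> {..<r} \<Longrightarrow> mono n1 \<chi> \<or> focused n1 \<chi> s"
        by blast
      \<comment> \<open>A vector \<open>y\<close> of the upper block is coloured by the whole pattern that \<open>\<chi>\<close> shows on the block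
        below it; the induction hypothesis for \<open>T\<close> makes this pattern the same on a copy of \<open>T\<close>.\<close>
      define P where "P = PiE (coord_space n1 :: 'a vec set) (\<lambda>_. {..<r})"
      have finP: "finite P" by (simp add: P_def finite_PiE finite_coord_space)
      obtain e where e: "inj_on e P" "e ` P \<subseteq> {..<card P}"
        using finite_colour_code[OF finP] by blast
      obtain n2 where n2: "\<And>\<chi> :: 'a vec \<Rightarrow> nat. \<chi> ` coord_space n2 \<subseteq> {..<card P} \<Longrightarrow>
          (\<exists>b\<in>coord_space n2. \<exists>\<phi>. emb d n2 \<phi> \<and> (\<exists>col. \<forall>t\<in>T. \<chi> (b + \<phi> t) = col))"
        using IH[of "card P"] by blast
      show ?case
      proof (intro exI[of _ "n1 + n2"] allI impI)
        fix \<chi> :: "'a vec \<Rightarrow> nat" assume \<chi>: "\<chi> ` coord_space (n1 + n2) \<subseteq> {..<r}"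
        define R where "R y = restrict (\<lambda>z. \<chi> (z + shift n1 y)) (coord_space n1)" for y
        have RP: "R y \<in> P" if "y \<in> coord_space n2" for y
          unfolding R_def P_def using that \<chi> by (auto intro!: add_shift_mem)
        then have "(\<lambda>y. e (R y)) ` coord_space n2 \<subseteq> {..<card P}" using e by blast
        from n2[OF this] obtain b2 \<phi>2 col where b2: "b2 \<in> coord_space n2" and \<phi>2: "emb d n2 \<phi>2"
          and col: "\<And>t. t \<in> T \<Longrightarrow> e (R (b2 + \<phi>2 t)) = col" by blast
        have bt: "b2 + \<phi>2 t \<in> coord_space n2" if "t \<in> coord_space d" for t
          using b2 emb_mem[OF \<phi>2 that] coord_add by blast
        have same: "\<chi> (z + shift n1 (b2 + \<phi>2 t)) = \<chi> (z + shift n1 (b2 + \<phi>2 t1))"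
          if "z \<in> coord_space n1" "t \<in> T" for z t
        proof -
          have "t \<in> coord_space d" "t1 \<in> coord_space d" using T t1 that(2) by auto
          then have "R (b2 + \<phi>2 t) = R (b2 + \<phi>2 t1)"
            using col[OF that(2)] col[OF t1] by (intro inj_onD[OF e(1)] RP bt) auto
          then have "R (b2 + \<phi>2 t) z = R (b2 + \<phi>2 t1) z" by simp
          then show ?thesis using that by (simp add: R_def)
        qed
        define \<chi>1 where "\<chi>1 z = \<chi> (z + shift n1 (b2 + \<phi>2 t1))" for z
        have \<chi>1: "\<chi>1 ` coord_space n1 \<subseteq> {..<r}"
        proof (rule image_subsetI)
          fix z :: "'a vec" assume "z \<in> coord_space n1"
          then have "z + shift n1 (b2 + \<phi>2 t1) \<in> coord_space (n1 + n2)"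
            using bt t1 T by (intro add_shift_mem) auto
          then show "\<chi>1 z \<in> {..<r}" using \<chi> unfolding \<chi>1_def by blast
        qed
        from n1[OF this] show "mono (n1 + n2) \<chi> \<or> focused (n1 + n2) \<chi> (Suc s)"
        proof
          assume "mono n1 \<chi>1"
          then obtain b \<phi> col where b: "b \<in> coord_space n1" and \<phi>: "emb d n1 \<phi>"
            and col: "\<forall>t\<in>insert t0 T. \<chi>1 (b + \<phi> t) = col" unfolding mono_def by blast
          have "mono (n1 + n2) \<chi>" unfolding mono_def
          proof (intro bexI exI conjI)
            show "b + shift n1 (b2 + \<phi>2 t1) \<in> coord_space (n1 + n2)"
              using b bt t1 T by (auto intro!: add_shift_mem)
            show "emb d (n1 + n2) \<phi>" using emb_mono[OF \<phi>] by simp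
            show "\<forall>t\<in>insert t0 T. \<chi> (b + shift n1 (b2 + \<phi>2 t1) + \<phi> t) = col"
              using col by (simp add: \<chi>1_def algebra_simps)
          qed
          then show ?thesis by blast
        next
          assume "focused n1 \<chi>1 s"
          then obtain x Cs where x: "x \<in> coord_space n1" and Cs: "Cs \<subseteq> {..<r}" "card Cs = s" "\<chi>1 x \<notin> Cs"
            and foc: "\<And>col. col \<in> Cs \<Longrightarrow> \<exists>\<phi>. emb d n1 \<phi> \<and> (\<forall>t\<in>T. \<chi>1 (x + \<phi> (t - t0)) = col)"
            unfolding focused_def by blast
          \<comment> \<open>The new focus lies above the old one, at the image of \<open>t0\<close> in the upper block. The old
            copies, moved diagonally, keep their colours, and the copy in the upper block
            alone contributes the colour of the old focus.\<close>
          define x' where "x' = x + shift n1 (b2 + \<phi>2 t0)"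
          have x': "x' \<in> coord_space (n1 + n2)"
            unfolding x'_def using x bt t0 by (auto intro!: add_shift_mem)
          have key: "\<chi> (x' + (\<phi> (t - t0) + shift n1 (\<phi>2 (t - t0)))) = \<chi>1 (x + \<phi> (t - t0))"
            if "\<And>z. z \<in> coord_space d \<Longrightarrow> \<phi> z \<in> coord_space n1" "t \<in> T" for t \<phi>
          proof -
            have "shift n1 (b2 + \<phi>2 t0) + shift n1 (\<phi>2 (t - t0)) = shift n1 (b2 + \<phi>2 t)"
              unfolding shift_add[symmetric] by (simp add: lin_diff[OF emb_lin[OF \<phi>2]])
            then have "x' + (\<phi> (t - t0) + shift n1 (\<phi>2 (t - t0))) = (x + \<phi> (t - t0)) + shift n1 (b2 + \<phi>2 t)"
              by (simp add: x'_def algebra_simps)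
            moreover have "x + \<phi> (t - t0) \<in> coord_space n1"
              using that x T t0 by (auto intro!: coord_add coord_diff)
            ultimately show ?thesis using same that(2) by (simp only: \<chi>1_def)
          qed
          have foc': "\<exists>\<phi>. emb d (n1 + n2) \<phi> \<and> (\<forall>t\<in>T. \<chi> (x' + \<phi> (t - t0)) = col)"
            if col: "col \<in> insert (\<chi>1 x) Cs" for col
          proof (cases "col = \<chi>1 x")
            case True
            have "lin (\<lambda>_::'a vec. 0 :: 'a vec)" by (intro linI) auto
            then have "emb d (n1 + n2) (\<lambda>z. (\<lambda>_. 0) z + shift n1 (\<phi>2 z))"
              by (intro emb_add_shift \<phi>2) (auto simp: coord_0)
            moreover have "\<forall>t\<in>T. \<chi> (x' + (0 + shift n1 (\<phi>2 (t - t0)))) = col"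
              using key[of "\<lambda>_. 0"] True by (simp add: coord_0)
            ultimately show ?thesis by (intro exI[of _ "\<lambda>z. 0 + shift n1 (\<phi>2 z)"]) simp
          next
            case False
            then obtain \<phi> where \<phi>: "emb d n1 \<phi>" "\<forall>t\<in>T. \<chi>1 (x + \<phi> (t - t0)) = col"
              using foc col by blast
            have "emb d (n1 + n2) (\<lambda>z. \<phi> z + shift n1 (\<phi>2 z))"
              using emb_lin[OF \<phi>(1)] emb_mem[OF \<phi>(1)] \<phi>2 by (rule emb_add_shift)
            moreover have "\<forall>t\<in>T. \<chi> (x' + (\<phi> (t - t0) + shift n1 (\<phi>2 (t - t0)))) = col"
              using key[of \<phi>] emb_mem[OF \<phi>(1)] \<phi>(2) by simp
            ultimately show ?thesis by (intro exI[of _ "\<lambda>z. \<phi> z + shift n1 (\<phi>2 z)"]) simp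
          qed
          show ?thesis
          proof (cases "\<chi> x' \<in> insert (\<chi>1 x) Cs")
            case True
            then obtain \<phi> where \<phi>: "emb d (n1 + n2) \<phi>" "\<forall>t\<in>T. \<chi> (x' + \<phi> (t - t0)) = \<chi> x'"
              using foc' by blast
            have "mono (n1 + n2) \<chi>" unfolding mono_def
            proof (intro bexI exI conjI)
              show "x' - \<phi> t0 \<in> coord_space (n1 + n2)"
                using x' emb_mem[OF \<phi>(1) t0] by (rule coord_diff)
              show "emb d (n1 + n2) \<phi>" by fact
              show "\<forall>t\<in>insert t0 T. \<chi> (x' - \<phi> t0 + \<phi> t) = \<chi> x'"
                using \<phi>(2) by (simp add: lin_diff[OF emb_lin[OF \<phi>(1)]] algebra_simps)
            qed
            then show ?thesis by blast
          next
            case False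
            have "insert (\<chi>1 x) Cs \<subseteq> {..<r}" using Cs \<chi>1 x by blast
            moreover have "card (insert (\<chi>1 x) Cs) = Suc s"
              using Cs finite_subset[OF Cs(1)] by simp
            ultimately have "focused (n1 + n2) \<chi> (Suc s)"
              unfolding focused_def using x' False foc' by blast
            then show ?thesis by blast
          qed
        qed
      qed
    qed
    obtain n where n: "\<And>\<chi>. \<chi> ` coord_space n \<subseteq> {..<r} \<Longrightarrow> mono n \<chi> \<or> focused n \<chi> r"
      using focus[of r] by blast
    have "mono n \<chi>" if \<chi>: "\<chi> ` coord_space n \<subseteq> {..<r}" for \<chi>
    proof -
      have "\<not> focused n \<chi> r"
      proof
        assume "focused n \<chi> r"
        then obtain x Cs where "x \<in> coord_space n" "Cs \<subseteq> {..<r}" "card Cs = r" "\<chi> x \<notin> Cs"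
          unfolding focused_def by blast
        moreover from this have "Cs = {..<r}" by (intro card_subset_eq) auto
        ultimately show False using \<chi> by blast
      qed
      then show ?thesis using n[OF \<chi>] by blast
    qed
    then show ?thesis unfolding mono_def by blast
  qed
qed

text \<open>
  The case of the pattern \<open>F\<^sup>d\<close>. The colours may be of any type; the bound \<open>N\<close> depends only on \<open>d\<close>
  and on the number \<open>r\<close> of colours.
\<close>

lemma mono_flat_exists:
  "\<exists>N. \<forall>n\<ge>N. \<forall>\<chi> :: 'a::{field,finite} vec \<Rightarrow> 'c. \<forall>C.
     finite C \<and> card C \<le> r \<and> \<chi> ` coord_space n \<subseteq> C \<longrightarrow>
     (\<exists>b\<in>coord_space n. \<exists>\<phi>. emb d n \<phi> \<and> (\<forall>z\<in>coord_space d. \<chi> (b + \<phi> z) = \<chi> b))"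
proof -
  obtain N where N: "\<And>\<chi> :: 'a vec \<Rightarrow> nat. \<chi> ` coord_space N \<subseteq> {..<r} \<Longrightarrow>
    (\<exists>b\<in>coord_space N. \<exists>\<phi>. emb d N \<phi> \<and> (\<exists>col. \<forall>t\<in>coord_space d. \<chi> (b + \<phi> t) = col))"
    using mono_pattern_exists[OF finite_coord_space order_refl, where r=r and d=d] by blast
  show ?thesis
  proof (intro exI[of _ N] allI impI)
    fix n and \<chi> :: "'a vec \<Rightarrow> 'c" and C
    assume n: "N \<le> n" and C: "finite C \<and> card C \<le> r \<and> \<chi> ` coord_space n \<subseteq> C"
    obtain e where e: "inj_on e C" "e ` C \<subseteq> {..<card C}"
      using finite_colour_code[OF conjunct1[OF C]] by blast
    have sub: "coord_space N \<subseteq> (coord_space n :: 'a vec set)" using n by (rule coord_space_mono)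
    have "(\<lambda>z. e (\<chi> z)) ` coord_space N \<subseteq> {..<r}"
    proof (rule image_subsetI)
      fix z :: "'a vec" assume "z \<in> coord_space N"
      then have "\<chi> z \<in> C" using sub C by blast
      then have "e (\<chi> z) < card C" using e(2) by blast
      then show "e (\<chi> z) \<in> {..<r}" using C by simp
    qed
    from N[OF this] obtain b \<phi> col where b: "b \<in> coord_space N" "emb d N \<phi>"
      "\<forall>t\<in>coord_space d. e (\<chi> (b + \<phi> t)) = col" by blast
    have b0: "e (\<chi> b) = col" using b(3) coord_0[of d] lin_0[OF emb_lin[OF b(2)]] by force
    have "\<chi> (b + \<phi> z) = \<chi> b" if z: "z \<in> coord_space d" for z
    proof -
      have "b + \<phi> z \<in> coord_space n" "b \<in> coord_space n"
        using b(1) emb_mem[OF b(2) z] sub by (auto intro: coord_add)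
      then have "\<chi> (b + \<phi> z) \<in> C" "\<chi> b \<in> C" using C by blast+
      then show ?thesis using b(3) b0 z by (intro inj_onD[OF e(1)]) auto
    qed
    then show "\<exists>b\<in>coord_space n. \<exists>\<phi>. emb d n \<phi> \<and> (\<forall>z\<in>coord_space d. \<chi> (b + \<phi> z) = \<chi> b)"
      using b sub emb_mono[OF b(2) order_refl n] by blast
  qed
qed

text \<open>
  Finitely many colourings are made constant on the same flat, by colouring with the tuple of
  their values.
\<close>

lemma mono_flat_family:
  assumes "finite I"
  shows "\<exists>N. \<forall>n\<ge>N. \<forall>(G :: 'i \<Rightarrow> 'a::{field,finite} vec \<Rightarrow> 'c) C.
     finite C \<and> card C \<le> r \<and> (\<forall>i\<in>I. G i ` coord_space n \<subseteq> C) \<longrightarrow>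
     (\<exists>b\<in>coord_space n. \<exists>\<phi>. emb d n \<phi> \<and> (\<forall>i\<in>I. \<forall>z\<in>coord_space d. G i (b + \<phi> z) = G i b))"
proof -
  obtain N where N: "\<forall>n\<ge>N. \<forall>(\<chi> :: 'a vec \<Rightarrow> 'i \<Rightarrow> 'c) D.
      finite D \<and> card D \<le> r ^ card I \<and> \<chi> ` coord_space n \<subseteq> D \<longrightarrow>
      (\<exists>b\<in>coord_space n. \<exists>\<phi>. emb d n \<phi> \<and> (\<forall>z\<in>coord_space d. \<chi> (b + \<phi> z) = \<chi> b))"
    using mono_flat_exists[where r="r ^ card I" and d=d and 'a='a and 'c="'i \<Rightarrow> 'c"] ..
  show ?thesis
  proof (intro exI[of _ N] allI impI, elim conjE)
    fix n and G :: "'i \<Rightarrow> 'a vec \<Rightarrow> 'c" and C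
    assume n: "N \<le> n" and C: "finite C" "card C \<le> r" "\<forall>i\<in>I. G i ` coord_space n \<subseteq> C"
    define \<chi> where "\<chi> z = restrict (\<lambda>i. G i z) I" for z
    have "finite (PiE I (\<lambda>_. C))" using assms C by (simp add: finite_PiE)
    moreover have "card (PiE I (\<lambda>_. C)) \<le> r ^ card I"
      using assms C by (simp add: card_PiE power_mono)
    moreover have "\<chi> ` coord_space n \<subseteq> PiE I (\<lambda>_. C)"
    proof (rule image_subsetI)
      fix z :: "'a vec" assume "z \<in> coord_space n"
      then have "\<forall>i\<in>I. G i z \<in> C" using C(3) by blast
      then show "\<chi> z \<in> PiE I (\<lambda>_. C)" by (auto simp: \<chi>_def)
    qed
    ultimately obtain b \<phi> where b: "b \<in> coord_space n" "emb d n \<phi>"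
      and eq: "\<And>z. z \<in> coord_space d \<Longrightarrow> \<chi> (b + \<phi> z) = \<chi> b"
      using N[rule_format, OF n, of "PiE I (\<lambda>_. C)" \<chi>] by blast
    have "G i (b + \<phi> z) = G i b" if "i \<in> I" "z \<in> coord_space d" for i z
      using fun_cong[OF eq[OF that(2)], of i] that(1) by (simp add: \<chi>_def)
    then show "\<exists>b\<in>coord_space n. \<exists>\<phi>. emb d n \<phi> \<and> (\<forall>i\<in>I. \<forall>z\<in>coord_space d. G i (b + \<phi> z) = G i b)"
      using b by blast
  qed
qed

section \<open>Functions on affine space with Boolean line sums\<close>

text \<open>
  The sum of \<open>g\<close> over each affine line in \<open>F\<^sup>m\<close> is \<open>0\<close> or \<open>1\<close>.
\<close>

definition boolean_on_lines :: "nat \<Rightarrow> ('a::{field,finite} vec \<Rightarrow> real) \<Rightarrow> bool" where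
  "boolean_on_lines m g \<longleftrightarrow>
    (\<forall>z\<in>coord_space m. \<forall>u\<in>coord_space m. u \<noteq> 0 \<longrightarrow> (\<Sum>t\<in>UNIV. g (z + t \<odot> u)) \<in> {0, 1})"

text \<open>
  The function \<open>g\<close> is constant with value \<open>v\<close> on the \<open>d\<close>-flat in \<open>F\<^sup>m\<close> through \<open>b\<close> with direction space
  \<open>\<phi> F\<^sup>d\<close>.
\<close>

definition const_flat ::
    "nat \<Rightarrow> ('a::field vec \<Rightarrow> real) \<Rightarrow> nat \<Rightarrow> 'a vec \<Rightarrow> ('a vec \<Rightarrow> 'a vec) \<Rightarrow> real \<Rightarrow> bool" where
  "const_flat m g d b \<phi> v \<longleftrightarrow> b \<in> coord_space m \<and> emb d m \<phi> \<and> (\<forall>z\<in>coord_space d. g (b + \<phi> z) = v)"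

lemma unit_vec_nonzero: "unit_vec i \<noteq> 0"
proof
  assume "unit_vec i = (0 :: 'a vec)"
  then have "unit_vec i i = (0 :: 'a)" by simp
  then show False by (simp add: unit_vec_def)
qed

lemma const_flat_value:
  fixes g :: "'a::{field,finite} vec \<Rightarrow> real"
  assumes "boolean_on_lines m g" "const_flat m g d b \<phi> v" "d \<ge> 1"
  shows "v = 0 \<or> v = 1 / real CARD('a)"
proof -
  have b: "b \<in> coord_space m" and \<phi>: "emb d m \<phi>" and v: "\<And>z. z \<in> coord_space d \<Longrightarrow> g (b + \<phi> z) = v"
    using assms(2) by (auto simp: const_flat_def)
  let ?e = "unit_vec 0 :: 'a vec"
  have e: "?e \<in> coord_space d" using assms(3) by (intro unit_vec_mem) auto
  have "\<phi> ?e \<noteq> 0" using emb_ker[OF \<phi> e] unit_vec_nonzero[of 0, where 'a='a] by blast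
  then have "(\<Sum>t\<in>UNIV. g (b + t \<odot> \<phi> ?e)) \<in> {0, 1}"
    using assms(1) b emb_mem[OF \<phi> e] unfolding boolean_on_lines_def by blast
  also have "(\<Sum>t\<in>UNIV. g (b + t \<odot> \<phi> ?e)) = (\<Sum>t\<in>(UNIV :: 'a set). v)"
    using v[OF coord_scale[OF e]] by (intro sum.cong) (simp_all add: lin_scale[OF emb_lin[OF \<phi>]])
  finally show ?thesis by (auto simp: field_simps)
qed

lemma sum_extreme_const:
  fixes f :: "'i \<Rightarrow> real"
  assumes "finite I" "\<And>i. i \<in> I \<Longrightarrow> f i = 0 \<or> f i = 1 / card I" "sum f I = 0 \<or> sum f I = 1" "i \<in> I" "j \<in> I"
  shows "f i = f j"
  using assms(3)
proof
  assume "sum f I = 0"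
  moreover have "0 \<le> f i" if "i \<in> I" for i using assms(2)[OF that] by auto
  ultimately have "\<forall>i\<in>I. f i = 0" using sum_nonneg_eq_0_iff[OF assms(1), of f] by simp
  then show ?thesis using assms by simp
next
  assume "sum f I = 1"
  moreover have "card I > 0" using assms card_gt_0_iff by blast
  ultimately have "(\<Sum>i\<in>I. 1 / card I - f i) = 0" by (simp add: sum_subtractf)
  moreover have "0 \<le> 1 / card I - f i" if "i \<in> I" for i using assms(2)[OF that] by auto
  ultimately have "\<forall>i\<in>I. 1 / card I - f i = 0"
    using sum_nonneg_eq_0_iff[OF assms(1), of "\<lambda>i. 1 / card I - f i"] by simp
  then have "1 / card I - f i = 0" "1 / card I - f j = 0" using assms(4,5) by blast+
  then show ?thesis by linarith
qed

text \<open>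
  On the affine span of two parallel flats, Ramsey yields smaller parallel flats, one for each
  point \<open>b1 + t \<odot> h\<close> of the line joining the base points, on all of which \<open>g\<close> is constant. Their \<open>q\<close>
  values are \<open>0\<close> or \<open>1/q\<close> and add up to \<open>0\<close> or \<open>1\<close>, so that they all agree.
\<close>

lemma parallel_flats_same_value:
  "\<exists>N\<ge>1. \<forall>m (g :: 'a::{field,finite} vec \<Rightarrow> real) C b1 b2 \<phi> v1 v2.
     boolean_on_lines m g \<longrightarrow> finite C \<longrightarrow> card C \<le> r \<longrightarrow> g ` coord_space m \<subseteq> C \<longrightarrow>
     const_flat m g N b1 \<phi> v1 \<longrightarrow> const_flat m g N b2 \<phi> v2 \<longrightarrow> v1 = v2"
proof -
  obtain N where N: "\<forall>n\<ge>N. \<forall>(G :: 'a \<Rightarrow> 'a vec \<Rightarrow> real) C.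
      finite C \<and> card C \<le> r \<and> (\<forall>i\<in>UNIV. G i ` coord_space n \<subseteq> C) \<longrightarrow>
      (\<exists>b\<in>coord_space n. \<exists>\<phi>. emb 1 n \<phi> \<and> (\<forall>i\<in>UNIV. \<forall>z\<in>coord_space 1. G i (b + \<phi> z) = G i b))"
    using mono_flat_family[of "UNIV :: 'a set", where 'a='a and 'c=real and r=r and d=1, OF finite] ..
  show ?thesis
  proof (intro exI[of _ "N + 1"] conjI allI impI, simp)
    fix m and g :: "'a vec \<Rightarrow> real" and C b1 b2 \<phi> v1 v2
    assume g: "boolean_on_lines m g" and C: "finite C" "card C \<le> r" "g ` coord_space m \<subseteq> C"
      and f1: "const_flat m g (N + 1) b1 \<phi> v1" and f2: "const_flat m g (N + 1) b2 \<phi> v2"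
    have b: "b1 \<in> coord_space m" "b2 \<in> coord_space m" and \<phi>: "emb (N + 1) m \<phi>"
      and v: "\<And>z. z \<in> coord_space (N + 1) \<Longrightarrow> g (b1 + \<phi> z) = v1"
             "\<And>z. z \<in> coord_space (N + 1) \<Longrightarrow> g (b2 + \<phi> z) = v2"
      using f1 f2 by (auto simp: const_flat_def)
    show "v1 = v2"
    proof (cases "b1 = b2")
      case True
      then show ?thesis using v coord_0 by metis
    next
      case False
      define h where "h = b2 - b1"
      have h: "h \<in> coord_space m" "h \<noteq> 0" using b False by (auto simp: h_def coord_diff)
      define G where "G t z = g ((b1 + t \<odot> h) + \<phi> z)" for t z
      have base: "b1 + t \<odot> h \<in> coord_space m" for t using b h by (intro coord_add coord_scale)
      have "G t ` coord_space (N + 1) \<subseteq> C" for t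
      proof (rule image_subsetI)
        fix z :: "'a vec" assume "z \<in> coord_space (N + 1)"
        then have "(b1 + t \<odot> h) + \<phi> z \<in> coord_space m" by (intro coord_add base emb_mem[OF \<phi>])
        then show "G t z \<in> C" using C(3) unfolding G_def by blast
      qed
      then obtain b \<psi> where b': "b \<in> coord_space (N + 1)" and \<psi>: "emb 1 (N + 1) \<psi>"
        and eq: "\<And>t z. z \<in> coord_space 1 \<Longrightarrow> G t (b + \<psi> z) = G t b"
        using N[rule_format, OF le_add1[of N 1], of C G] C by blast
      have flat: "const_flat m g 1 ((b1 + t \<odot> h) + \<phi> b) (\<lambda>z. \<phi> (\<psi> z)) (G t b)" for t
        unfolding const_flat_def
      proof (intro conjI ballI)
        show "(b1 + t \<odot> h) + \<phi> b \<in> coord_space m" by (intro coord_add base emb_mem[OF \<phi> b'])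
        show "emb 1 m (\<lambda>z. \<phi> (\<psi> z))" using \<psi> \<phi> by (rule emb_comp)
        show "g (b1 + t \<odot> h + \<phi> b + \<phi> (\<psi> z)) = G t b" if "z \<in> coord_space 1" for z
          using eq[OF that, of t] unfolding G_def lin_add[OF emb_lin[OF \<phi>]] by (simp add: add.assoc)
      qed
      have vals: "G t b = 0 \<or> G t b = 1 / CARD('a)" for t
        using const_flat_value[OF g flat] by simp
      have "(\<Sum>t\<in>UNIV. g ((b1 + \<phi> b) + t \<odot> h)) \<in> {0, 1}"
        using g h coord_add[OF b(1) emb_mem[OF \<phi> b']] unfolding boolean_on_lines_def by blast
      then have "(\<Sum>t\<in>UNIV. G t b) = 0 \<or> (\<Sum>t\<in>UNIV. G t b) = 1"
        by (simp add: G_def add_ac)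
      then have "G 0 b = G 1 b"
        using vals by (intro sum_extreme_const[of UNIV "\<lambda>t. G t b"]) auto
      then show ?thesis using v b' by (simp add: G_def h_def)
    qed
  qed
qed

text \<open>
  For two flats in general position, Ramsey in the first direction gives translates of a part of the
  first flat, attached to the vectors of the second one; by the parallel case they all carry the value
  of the first flat. A translate of a part of the second flat thus has the value of the first one, and
  the parallel case applies again.
\<close>

lemma const_flats_same_value:
  "\<exists>N\<ge>1. \<forall>m (g :: 'a::{field,finite} vec \<Rightarrow> real) C b1 b2 \<phi>1 \<phi>2 v1 v2.
     boolean_on_lines m g \<longrightarrow> finite C \<longrightarrow> card C \<le> r \<longrightarrow> g ` coord_space m \<subseteq> C \<longrightarrow>
     const_flat m g N b1 \<phi>1 v1 \<longrightarrow> const_flat m g N b2 \<phi>2 v2 \<longrightarrow> v1 = v2"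
proof -
  obtain N1 where N1': "N1 \<ge> 1 \<and> (\<forall>m (g :: 'a vec \<Rightarrow> real) C b1 b2 \<phi> v1 v2.
     boolean_on_lines m g \<longrightarrow> finite C \<longrightarrow> card C \<le> r \<longrightarrow> g ` coord_space m \<subseteq> C \<longrightarrow>
     const_flat m g N1 b1 \<phi> v1 \<longrightarrow> const_flat m g N1 b2 \<phi> v2 \<longrightarrow> v1 = v2)"
    using parallel_flats_same_value[where r=r and 'a='a] ..
  note N1 = conjunct2[OF N1', rule_format]
  obtain N2 where N2: "\<forall>n\<ge>N2. \<forall>(G :: 'a vec \<Rightarrow> 'a vec \<Rightarrow> real) C.
      finite C \<and> card C \<le> r \<and> (\<forall>i\<in>coord_space N1. G i ` coord_space n \<subseteq> C) \<longrightarrow>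
      (\<exists>b\<in>coord_space n. \<exists>\<phi>. emb N1 n \<phi> \<and>
        (\<forall>i\<in>coord_space N1. \<forall>z\<in>coord_space N1. G i (b + \<phi> z) = G i b))"
    using mono_flat_family[OF finite_coord_space[of N1], where 'a='a and 'c=real and r=r and d=N1] ..
  define N where "N = N1 + N2"
  show ?thesis
  proof (intro exI[of _ N] conjI allI impI, use N1' in \<open>simp add: N_def\<close>)
    fix m and g :: "'a vec \<Rightarrow> real" and C b1 b2 \<phi>1 \<phi>2 v1 v2
    assume g: "boolean_on_lines m g" and C: "finite C" "card C \<le> r" "g ` coord_space m \<subseteq> C"
      and f1: "const_flat m g N b1 \<phi>1 v1" and f2: "const_flat m g N b2 \<phi>2 v2"
    have b: "b1 \<in> coord_space m" "b2 \<in> coord_space m" and \<phi>: "emb N m \<phi>1" "emb N m \<phi>2"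
      and v: "\<And>z. z \<in> coord_space N \<Longrightarrow> g (b1 + \<phi>1 z) = v1"
             "\<And>z. z \<in> coord_space N \<Longrightarrow> g (b2 + \<phi>2 z) = v2"
      using f1 f2 by (auto simp: const_flat_def)
    have N1N: "coord_space N1 \<subseteq> (coord_space N :: 'a vec set)"
      by (rule coord_space_mono) (simp add: N_def)
    define G where "G y z = g ((b2 + \<phi>2 y) + \<phi>1 z)" for y z
    have base: "b2 + \<phi>2 y \<in> coord_space m" if "y \<in> coord_space N1" for y
      using b emb_mem[OF \<phi>(2)] that N1N by (blast intro: coord_add)
    have "G y ` coord_space N \<subseteq> C" if y: "y \<in> coord_space N1" for y
    proof (rule image_subsetI)
      fix z :: "'a vec" assume "z \<in> coord_space N"
      then have "(b2 + \<phi>2 y) + \<phi>1 z \<in> coord_space m" by (intro coord_add base y emb_mem[OF \<phi>(1)])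
      then show "G y z \<in> C" using C(3) unfolding G_def by blast
    qed
    then have "finite C \<and> card C \<le> r \<and> (\<forall>i\<in>coord_space N1. G i ` coord_space N \<subseteq> C)"
      using C(1,2) by simp
    from N2[rule_format, OF le_add2[of N2 N1, folded N_def] this]
    obtain b \<psi> where b': "b \<in> coord_space N" and \<psi>: "emb N1 N \<psi>"
      and eq: "\<And>y z. y \<in> coord_space N1 \<Longrightarrow> z \<in> coord_space N1 \<Longrightarrow> G y (b + \<psi> z) = G y b"
      by blast
    have flat: "const_flat m g N1 ((b2 + \<phi>2 y) + \<phi>1 b) (\<lambda>z. \<phi>1 (\<psi> z)) (G y b)"
      if y: "y \<in> coord_space N1" for y
      unfolding const_flat_def
    proof (intro conjI ballI)
      show "(b2 + \<phi>2 y) + \<phi>1 b \<in> coord_space m" by (intro coord_add base y emb_mem[OF \<phi>(1) b'])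
      show "emb N1 m (\<lambda>z. \<phi>1 (\<psi> z))" using \<psi> \<phi>(1) by (rule emb_comp)
      show "g (b2 + \<phi>2 y + \<phi>1 b + \<phi>1 (\<psi> z)) = G y b" if "z \<in> coord_space N1" for z
        using eq[OF y that] unfolding G_def lin_add[OF emb_lin[OF \<phi>(1)]] by (simp add: add.assoc)
    qed
    have flat1: "const_flat m g N1 (b1 + \<phi>1 b) (\<lambda>z. \<phi>1 (\<psi> z)) v1"
      unfolding const_flat_def
    proof (intro conjI ballI)
      show "b1 + \<phi>1 b \<in> coord_space m" by (intro coord_add b emb_mem[OF \<phi>(1) b'])
      show "emb N1 m (\<lambda>z. \<phi>1 (\<psi> z))" using \<psi> \<phi>(1) by (rule emb_comp)
      show "g (b1 + \<phi>1 b + \<phi>1 (\<psi> z)) = v1" if "z \<in> coord_space N1" for z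
        using v(1)[OF coord_add[OF b' emb_mem[OF \<psi> that]]]
        unfolding lin_add[OF emb_lin[OF \<phi>(1)]] by (simp add: add.assoc)
    qed
    have Gv1: "G y b = v1" if "y \<in> coord_space N1" for y
      using N1[OF g C flat[OF that] flat1] .
    have "const_flat m g N1 (b2 + \<phi>1 b) \<phi>2 v1"
      unfolding const_flat_def
    proof (intro conjI ballI)
      show "b2 + \<phi>1 b \<in> coord_space m" by (intro coord_add b emb_mem[OF \<phi>(1) b'])
      show "emb N1 m \<phi>2" using emb_mono[OF \<phi>(2), of N1 m] by (simp add: N_def)
      show "g (b2 + \<phi>1 b + \<phi>2 z) = v1" if "z \<in> coord_space N1" for z
        using Gv1[OF that] unfolding G_def by (simp add: add_ac)
    qed
    moreover have "const_flat m g N1 b2 \<phi>2 v2"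
      unfolding const_flat_def
      using b emb_mono[OF \<phi>(2), of N1 m] v(2) N1N by (auto simp: N_def)
    ultimately show "v1 = v2" by (rule N1[OF g C])
  qed
qed

text \<open>
  A function with Boolean line sums and few values, on a space of large dimension, is \<open>0\<close> or \<open>1/q\<close> everywhere
  except at one vector \<open>e\<close> at most, where its value is \<open>1\<close> or \<open>1/q - 1\<close>, respectively.
\<close>

lemma affine_classification:
  "\<exists>M. \<forall>m\<ge>M. \<forall>(g :: 'a::{field,finite} vec \<Rightarrow> real) C.
     boolean_on_lines m g \<and> finite C \<and> card C \<le> r \<and> g ` coord_space m \<subseteq> C \<longrightarrow>
     (\<exists>\<beta>\<in>{0, 1 / real CARD('a)}. \<exists>e. \<forall>z\<in>coord_space m.
        g z = \<beta> \<or> z = e \<and> g z = (if \<beta> = 0 then 1 else \<beta> - 1))"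
proof -
  let ?q = "real CARD('a)"
  have q2: "?q \<ge> 2" using card_field_ge_2[where 'a='a] by simp
  obtain N where N': "N \<ge> 1 \<and> (\<forall>m (g :: 'a vec \<Rightarrow> real) C b1 b2 \<phi>1 \<phi>2 v1 v2.
     boolean_on_lines m g \<longrightarrow> finite C \<longrightarrow> card C \<le> r \<longrightarrow> g ` coord_space m \<subseteq> C \<longrightarrow>
     const_flat m g N b1 \<phi>1 v1 \<longrightarrow> const_flat m g N b2 \<phi>2 v2 \<longrightarrow> v1 = v2)"
    using const_flats_same_value[where r=r and 'a='a] ..
  note N = conjunct2[OF N', rule_format]
  obtain M where M: "\<forall>n\<ge>M. \<forall>(G :: 'a \<Rightarrow> 'a vec \<Rightarrow> real) C.
      finite C \<and> card C \<le> r \<and> (\<forall>i\<in>UNIV. G i ` coord_space n \<subseteq> C) \<longrightarrow>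
      (\<exists>b\<in>coord_space n. \<exists>\<phi>. emb N n \<phi> \<and> (\<forall>i\<in>UNIV. \<forall>z\<in>coord_space N. G i (b + \<phi> z) = G i b))"
    using mono_flat_family[of "UNIV :: 'a set", where 'a='a and 'c=real and r=r and d=N, OF finite] ..
  show ?thesis
  proof (intro exI[of _ "Suc M"] allI impI, elim conjE)
    fix m and g :: "'a vec \<Rightarrow> real" and C
    assume m: "Suc M \<le> m" and g: "boolean_on_lines m g"
      and C: "finite C" "card C \<le> r" "g ` coord_space m \<subseteq> C"
    obtain n where n: "m = Suc n" "M \<le> n" using m by (cases m) auto
    have nm: "coord_space n \<subseteq> (coord_space m :: 'a vec set)"
      using n by (intro coord_space_mono) simp
    have en: "unit_vec n \<in> (coord_space m :: 'a vec set)"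
      using n by (intro unit_vec_mem) simp
    \<comment> \<open>For each \<open>a\<close> there is a line through \<open>a\<close> whose other vectors lie on constant flats. It arises from
      colouring the directions \<open>unit_vec n + z\<close>, an affine chart, by the values of \<open>g\<close> on the line
      through \<open>a\<close> in that direction.\<close>
    have near: "\<exists>b \<phi> v. const_flat m g N b \<phi> v \<and> (g a + (?q - 1) * v \<in> {0, 1})"
      if a: "a \<in> coord_space m" for a
    proof -
      define G where "G t z = g (a + t \<odot> (unit_vec n + z))" for t z
      have base: "a + t \<odot> (unit_vec n + z) \<in> coord_space m" if "z \<in> coord_space n" for t z
        using that nm a en by (blast intro: coord_add coord_scale)
      have "G t ` coord_space n \<subseteq> C" for t
        using base C(3) unfolding G_def by blast
      then obtain b \<phi> where b: "b \<in> coord_space n" and \<phi>: "emb N n \<phi>"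
        and eq: "\<And>t z. z \<in> coord_space N \<Longrightarrow> G t (b + \<phi> z) = G t b"
        using M[rule_format, OF n(2), of C G] C(1,2) by blast
      define u where "u = unit_vec n + b"
      have u: "u \<in> coord_space m" using b nm en by (auto simp: u_def intro: coord_add)
      have "u \<noteq> 0"
      proof
        assume "u = 0"
        then have "u n = 0" by simp
        then show False using b by (simp add: u_def unit_vec_def coord_space_def)
      qed
      then have line: "(\<Sum>t\<in>UNIV. g (a + t \<odot> u)) \<in> {0, 1}"
        using g a u unfolding boolean_on_lines_def by blast
      have flat: "const_flat m g N (a + t \<odot> u) (\<lambda>z. t \<odot> \<phi> z) (G t b)" if "t \<noteq> 0" for t
        unfolding const_flat_def
      proof (intro conjI ballI)
        show "a + t \<odot> u \<in> coord_space m" using a u by (intro coord_add coord_scale)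
        show "emb N m (\<lambda>z. t \<odot> \<phi> z)" using n that by (intro emb_scale emb_mono[OF \<phi>]) auto
        show "g (a + t \<odot> u + t \<odot> \<phi> z) = G t b" if "z \<in> coord_space N" for z
          using eq[OF that, of t] unfolding G_def u_def
          by (simp add: fvec.scale_right_distrib add_ac)
      qed
      define v where "v = G 1 b"
      have v: "G t b = v" if "t \<noteq> 0" for t
        using N[OF g C flat[OF that] flat[of 1]] by (simp add: v_def)
      have "(\<Sum>t\<in>UNIV. g (a + t \<odot> u)) = (\<Sum>t\<in>UNIV. G t b)"
        by (simp add: G_def u_def)
      also have "\<dots> = G 0 b + (\<Sum>t\<in>UNIV - {0}. G t b)"
        by (subst sum.remove[of UNIV 0]) auto
      also have "(\<Sum>t\<in>UNIV - {0}. G t b) = (\<Sum>t\<in>UNIV - {0 :: 'a}. v)"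
        using v by (intro sum.cong) auto
      also have "\<dots> = (?q - 1) * v"
        using q2 by (simp add: card_Diff_singleton of_nat_diff)
      also have "G 0 b = g a" by (simp add: G_def)
      finally have "(\<Sum>t\<in>UNIV. g (a + t \<odot> u)) = g a + (?q - 1) * v" .
      then show ?thesis using line flat[of 1] by (auto simp: v_def)
    qed
    obtain b0 \<phi>0 v where flat0: "const_flat m g N b0 \<phi>0 v"
      using near[OF coord_0] by blast
    have v: "v = 0 \<or> v = 1 / ?q" using const_flat_value[OF g flat0 conjunct1[OF N']] by simp
    have all: "g a + (?q - 1) * v \<in> {0, 1}" if "a \<in> coord_space m" for a
      using near[OF that] N[OF g C flat0] by metis
    define h where "h a = (if v = 0 then g a else v - g a)" for a
    have h01: "h a = 0 \<or> h a = 1" if "a \<in> coord_space m" for a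
      using all[OF that] v q2 by (auto simp: h_def field_simps)
    have hsum: "(\<Sum>t\<in>UNIV. h (a + t \<odot> u)) \<le> 1"
      if "a \<in> coord_space m" "u \<in> coord_space m" "u \<noteq> 0" for a u
    proof -
      have "(\<Sum>t\<in>UNIV. g (a + t \<odot> u)) \<in> {0, 1}"
        using g that unfolding boolean_on_lines_def by blast
      then show ?thesis using v q2 by (auto simp: h_def sum_subtractf)
    qed
    have uniq: "a = b" if ab: "a \<in> coord_space m" "b \<in> coord_space m" "h a = 1" "h b = 1" for a b
    proof (rule ccontr)
      assume "a \<noteq> b"
      have "(\<Sum>t\<in>{0, 1}. h (a + t \<odot> (b - a))) \<le> (\<Sum>t\<in>UNIV. h (a + t \<odot> (b - a)))"
      proof (rule sum_mono2)
        fix t :: 'a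
        show "0 \<le> h (a + t \<odot> (b - a))"
          using h01[of "a + t \<odot> (b - a)"] ab by (auto simp: coord_add coord_scale coord_diff)
      qed auto
      also have "\<dots> \<le> 1" using ab \<open>a \<noteq> b\<close> by (intro hsum coord_diff) auto
      finally show False using ab by simp
    qed
    show "\<exists>\<beta>\<in>{0, 1 / ?q}. \<exists>e. \<forall>z\<in>coord_space m.
        g z = \<beta> \<or> z = e \<and> g z = (if \<beta> = 0 then 1 else \<beta> - 1)"
    proof (rule bexI[of _ v])
      have pt: "g z = v \<or> h z = 1 \<and> g z = (if v = 0 then 1 else v - 1)" if "z \<in> coord_space m" for z
        using h01[OF that] by (auto simp: h_def)
      show "\<exists>e. \<forall>z\<in>coord_space m. g z = v \<or> z = e \<and> g z = (if v = 0 then 1 else v - 1)"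
      proof (cases "\<exists>e\<in>coord_space m. h e = 1")
        case True
        then obtain e where "e \<in> coord_space m" "h e = 1" by blast
        then show ?thesis using pt uniq by (intro exI[of _ e]) blast
      next
        case False
        then show ?thesis using pt by blast
      qed
    qed (use v in auto)
  qed
qed

section \<open>Weights\<close>

text \<open>
  A weight represents a function on points: it is constant on the nonzero multiples of a vector, and
  \<open>0\<close> at the zero vector, so that the zero vector does not disturb sums over subspaces.
\<close>

definition weight :: "('a::field vec \<Rightarrow> real) \<Rightarrow> bool" where
  "weight c \<longleftrightarrow> c 0 = 0 \<and> (\<forall>t v. t \<noteq> 0 \<longrightarrow> c (t \<odot> v) = c v)"

text \<open>
  The sum of the weights of the points of \<open>K\<close>, each point having \<open>q - 1\<close> nonzero vectors.
\<close>

definition wsum :: "('a::{field,finite} vec \<Rightarrow> real) \<Rightarrow> 'a vec set \<Rightarrow> real" where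
  "wsum c K = (\<Sum>v\<in>K. c v) / (real CARD('a) - 1)"

text \<open>
  The weight \<open>c\<close> defines a Boolean degree one function on the \<open>k\<close>-spaces in \<open>V\<close>.
\<close>

definition boolean_weight :: "nat \<Rightarrow> 'a::{field,finite} vec set \<Rightarrow> ('a vec \<Rightarrow> real) \<Rightarrow> bool" where
  "boolean_weight k V c \<longleftrightarrow> weight c \<and>
     (\<forall>K. fvec.subspace K \<and> K \<subseteq> V \<and> card K = CARD('a) ^ k \<longrightarrow> wsum c K \<in> {0, 1})"

text \<open>
  \<open>H\<close> is a subspace of codimension one in \<open>V\<close>, in terms of cardinalities.
\<close>

definition hyperplane :: "'a::{field,finite} vec set \<Rightarrow> 'a vec set \<Rightarrow> bool" where
  "hyperplane H V \<longleftrightarrow> fvec.subspace H \<and> H \<subseteq> V \<and> card V = CARD('a) * card H"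

text \<open>
  The indicator weight of the point spanned by \<open>a\<close>. The vector \<open>a = 0\<close> stands for no point: the
  indicator then vanishes.
\<close>

definition point_ind :: "'a::field vec \<Rightarrow> 'a vec \<Rightarrow> real" where
  "point_ind a v = (if v \<noteq> 0 \<and> v \<in> fvec.span {a} then 1 else 0)"

text \<open>
  The weight of the function \<open>1 - y\<^sub>r\<close>, with \<open>H\<close> the hyperplane orthogonal to \<open>r\<close>, minus the indicator of
  the point spanned by \<open>a\<close>.
\<close>

definition hyp_weight :: "nat \<Rightarrow> 'a::{field,finite} vec set \<Rightarrow> 'a vec \<Rightarrow> 'a vec \<Rightarrow> real" where
  "hyp_weight k H a v = (if v \<in> H then 0 else 1 / real CARD('a) ^ (k - 1)) - point_ind a v"

text \<open>
  For \<open>V = F\<^sup>n\<close>, the weights of the functions \<open>0\<close>, \<open>x\<^sub>p\<close>, \<open>1 - y\<^sub>r\<close> and \<open>1 - x\<^sub>p - y\<^sub>r\<close>, where \<open>a\<close>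
  spans \<open>p\<close>, or is \<open>0\<close> if \<open>x\<^sub>p\<close> does not occur. The other trivial functions
  are the complements of these.
\<close>

definition std_form :: "nat \<Rightarrow> 'a::{field,finite} vec set \<Rightarrow> ('a vec \<Rightarrow> real) \<Rightarrow> bool" where
  "std_form k V g \<longleftrightarrow> (\<exists>a\<in>V. g = point_ind a) \<or>
     (\<exists>H a. hyperplane H V \<and> a \<in> V \<and> (a = 0 \<or> a \<notin> H) \<and> g = hyp_weight k H a)"

text \<open>
  The weight agrees on \<open>V\<close> with one of the above.
\<close>

definition std_weight :: "nat \<Rightarrow> 'a::{field,finite} vec set \<Rightarrow> ('a vec \<Rightarrow> real) \<Rightarrow> bool" where
  "std_weight k V c \<longleftrightarrow> (\<exists>g. std_form k V g \<and> (\<forall>v\<in>V. c v = g v))"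

lemma point_ind_0 [simp]: "point_ind 0 v = 0"
  by (simp add: point_ind_def)

lemma point_ind_values: "point_ind a v = 0 \<or> point_ind a v = 1"
  by (simp add: point_ind_def)

lemma point_ind_eq_1: "point_ind a v = 1 \<longleftrightarrow> v \<noteq> 0 \<and> (\<exists>t. v = t \<odot> a)"
  by (auto simp: point_ind_def fvec.span_singleton)

lemma point_ind_subspace:
  assumes "fvec.subspace U" "a \<notin> U" "v \<in> U"
  shows "point_ind a v = 0"
proof (rule ccontr)
  assume "point_ind a v \<noteq> 0"
  then obtain t where t: "v = t \<odot> a" "v \<noteq> 0" using point_ind_values[of a v] point_ind_eq_1[of a v] by auto
  have "inverse t \<odot> v \<in> U" using assms by (intro fvec.subspace_scale)
  then show False using t assms(2) by auto
qed

lemma std_weight_pointI: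
  assumes "a \<in> V" "\<And>v. v \<in> V \<Longrightarrow> c v = point_ind a v"
  shows "std_weight k V c"
  using assms unfolding std_weight_def std_form_def by blast

lemma std_weight_hyperI:
  assumes "hyperplane H V" "a \<in> V" "a = 0 \<or> a \<notin> H" "\<And>v. v \<in> V \<Longrightarrow> c v = hyp_weight k H a v"
  shows "std_weight k V c"
  using assms unfolding std_weight_def std_form_def by blast

lemma std_weightE:
  assumes "std_weight k V c"
  obtains (point) a where "a \<in> V" "\<And>v. v \<in> V \<Longrightarrow> c v = point_ind a v"
  | (hyper) H a where "hyperplane H V" "a \<in> V" "a = 0 \<or> a \<notin> H"
      "\<And>v. v \<in> V \<Longrightarrow> c v = hyp_weight k H a v"
  using assms unfolding std_weight_def std_form_def by blast

lemma weight_0: "weight c \<Longrightarrow> c 0 = 0"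
  and weight_scale: "weight c \<Longrightarrow> t \<noteq> 0 \<Longrightarrow> c (t \<odot> v) = c v"
  by (auto simp: weight_def)

lemma wsum_adjoin:
  fixes A :: "'a::{field,finite} vec set"
  assumes A: "fvec.subspace A" "x \<notin> A" and c: "weight c"
  shows "wsum c (adjoin A x) = wsum c A + (\<Sum>w\<in>A. c (w + x))"
proof -
  have "(\<Sum>v\<in>adjoin A x. c v) = (\<Sum>t\<in>UNIV. \<Sum>w\<in>A. c (w + t \<odot> x))"
    by (rule sum_adjoin[OF A])
  also have "\<dots> = (\<Sum>w\<in>A. c w) + (\<Sum>t\<in>UNIV - {0}. \<Sum>w\<in>A. c (w + t \<odot> x))"
    by (subst sum.remove[of UNIV 0]) auto
  also have "(\<Sum>t\<in>UNIV - {0}. \<Sum>w\<in>A. c (w + t \<odot> x)) = (\<Sum>t\<in>UNIV - {0 :: 'a}. \<Sum>w\<in>A. c (w + x))"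
  proof (rule sum.cong[OF refl])
    fix t :: 'a assume "t \<in> UNIV - {0}"
    then have t: "t \<noteq> 0" by simp
    have "(\<Sum>w\<in>A. c (w + t \<odot> x)) = (\<Sum>w\<in>A. c (t \<odot> w + t \<odot> x))"
    proof (rule sum.reindex_bij_witness[of _ "\<lambda>w. t \<odot> w" "\<lambda>w. inverse t \<odot> w"])
    qed (use t fvec.subspace_scale[OF A(1)] in auto)
    also have "\<dots> = (\<Sum>w\<in>A. c (w + x))"
      by (intro sum.cong refl)
        (simp add: fvec.scale_right_distrib[symmetric] weight_scale[OF c t])
    finally show "(\<Sum>w\<in>A. c (w + t \<odot> x)) = (\<Sum>w\<in>A. c (w + x))" .
  qed
  also have "\<dots> = (real CARD('a) - 1) * (\<Sum>w\<in>A. c (w + x))"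
    using card_field_ge_2[where 'a='a] by (simp add: card_Diff_singleton of_nat_diff)
  finally show ?thesis
    using card_field_ge_2[where 'a='a] unfolding wsum_def by (simp add: field_simps)
qed

text \<open>
  The points of \<open>K\<close> outside \<open>A\<close>, when \<open>A\<close> has codimension two in \<open>K\<close>, listed along the \<open>q + 1\<close> points
  of the quotient line.
\<close>

lemma wsum_adjoin2:
  fixes A :: "'a::{field,finite} vec set"
  assumes A: "fvec.subspace A" "y \<notin> A" "x \<notin> adjoin A y" and c: "weight c"
  shows "wsum c (adjoin (adjoin A y) x) =
    wsum c A + (\<Sum>w\<in>A. c (w + y)) + (\<Sum>t\<in>UNIV. \<Sum>w\<in>A. c (w + t \<odot> y + x))"
  using wsum_adjoin[OF subspace_adjoin[OF A(1)] A(3) c] wsum_adjoin[OF A(1,2) c]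
    sum_adjoin[OF A(1,2), of "\<lambda>w. c (w + x)"] by simp

lemma subspace_zero_set: "fvec.subspace {0}"
  by (rule fvec.subspaceI) auto

lemma wsum_zero: "weight c \<Longrightarrow> wsum c {0} = 0"
  by (simp add: wsum_def weight_0)

lemma mem_adjoin_iff:
  assumes "fvec.subspace A"
  shows "v \<in> adjoin A x \<longleftrightarrow> (\<exists>t. v - t \<odot> x \<in> A)"
proof
  assume "v \<in> adjoin A x"
  then obtain w t where "w \<in> A" "v = w + t \<odot> x" by (auto simp: adjoin_def)
  then show "\<exists>t. v - t \<odot> x \<in> A" by (intro exI[of _ t]) simp
next
  assume "\<exists>t. v - t \<odot> x \<in> A"
  then obtain t where "v - t \<odot> x \<in> A" by blast
  from adjoinI[OF this, of t x] show "v \<in> adjoin A x" by simp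
qed

lemma hyperplane_adjoin:
  assumes H: "hyperplane H V" and V: "fvec.subspace V" "finite V" and x: "x \<in> V" "x \<notin> H"
  shows "adjoin H x = V"
proof (rule card_subset_eq[OF V(2)])
  show "adjoin H x \<subseteq> V" using H V x by (intro adjoin_subset) (auto simp: hyperplane_def)
  show "card (adjoin H x) = card V"
    using H x card_adjoin[of H x] by (simp add: hyperplane_def)
qed

lemma hyperplaneI:
  assumes "fvec.subspace H" "H \<subseteq> V" "x \<notin> H" "V \<subseteq> adjoin H x" "fvec.subspace V" "x \<in> V"
  shows "hyperplane H V"
proof -
  have "adjoin H x = V" using assms adjoin_subset by blast
  then show ?thesis using card_adjoin[OF assms(1,3)] assms(1,2) by (simp add: hyperplane_def)
qed

lemma hyperplane_Int:
  assumes H: "hyperplane H V" and V: "fvec.subspace V" "finite V"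
    and K: "fvec.subspace K" "K \<subseteq> V" "\<not> K \<subseteq> H"
  shows "hyperplane (K \<inter> H) K"
proof -
  obtain x where x: "x \<in> K" "x \<notin> H" using K by blast
  have HV: "fvec.subspace H" using H by (simp add: hyperplane_def)
  have "v \<in> adjoin (K \<inter> H) x" if v: "v \<in> K" for v
  proof -
    have "v \<in> adjoin H x" using hyperplane_adjoin[OF H V, of x] x K v by blast
    then obtain t where "v - t \<odot> x \<in> H" unfolding mem_adjoin_iff[OF HV] by blast
    moreover have "v - t \<odot> x \<in> K" using v x K by (intro fvec.subspace_diff fvec.subspace_scale)
    ultimately show ?thesis
      unfolding mem_adjoin_iff[OF fvec.subspace_inter[OF K(1) HV]] by blast
  qed
  then show ?thesis
    using x K HV by (intro hyperplaneI[of _ _ x] fvec.subspace_inter) auto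
qed

section \<open>Gluing cosets of a subspace on which the weight vanishes\<close>

text \<open>
  If a Boolean weight vanishes on \<open>U\<close> and is nearly constant on each coset of \<open>U\<close>, then it is standard. On
  \<open>x + U\<close> write \<open>c = bet + eps\<close>, with base value \<open>bet\<close> in \<open>{0, 1/q\<^sup>k\<^sup>-\<^sup>1}\<close> and an exception \<open>eps = 1\<close> or
  \<open>eps = - 1\<close> at one vector at most. A \<open>k\<close>-space meeting \<open>U\<close> in dimension \<open>k - 2\<close> yields a line in the
  quotient by \<open>U\<close>. Moving it within the cosets avoids the exceptions, so that \<open>q\<^sup>k\<^sup>-\<^sup>2 bet\<close> has line sums
  \<open>0\<close> and \<open>1\<close>; moving it with one exceptional vector kept fixed determines the sign of the exception. The
  zeros of \<open>bet\<close> form \<open>V\<close> or a hyperplane, and a \<open>k\<close>-space through two exceptional points is impossible.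
\<close>

lemma weight_gluing:
  fixes c :: "'a::{field,finite} vec \<Rightarrow> real"
  assumes V: "fvec.subspace V" "finite V" and k: "k \<ge> 2" and bw: "boolean_weight k V c"
    and U: "fvec.subspace U" "U \<subseteq> V" "\<And>u. u \<in> U \<Longrightarrow> c u = 0" "CARD('a) ^ k \<le> card U"
    and cosets: "\<And>x. x \<in> V \<Longrightarrow> x \<notin> U \<Longrightarrow> \<exists>\<beta>\<in>{0, 1 / real CARD('a) ^ (k - 1)}. \<exists>e. \<forall>u\<in>U.
       c (x + u) = \<beta> \<or> u = e \<and> c (x + u) = (if \<beta> = 0 then 1 else \<beta> - 1)"
  shows "std_weight k V c"
proof -
  define q where "q = real CARD('a)"
  have q2: "q \<ge> 2" using card_field_ge_2[where 'a='a] by (simp add: q_def)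
  define \<beta>1 where "\<beta>1 = 1 / q ^ (k - 1)"
  have c: "weight c" using bw by (simp add: boolean_weight_def)
  have qk: "q ^ (k - 2) * \<beta>1 = 1 / q" "q ^ (k - 2) > 0"
  proof -
    have "q ^ (k - 1) = q ^ (k - 2) * q" using k
      by (metis Suc_diff_Suc diff_diff_left less_le_trans one_add_one one_less_numeral_iff
          plus_1_eq_Suc power_Suc2 semiring_norm(76))
    then show "q ^ (k - 2) * \<beta>1 = 1 / q" "q ^ (k - 2) > 0" using q2 by (simp_all add: \<beta>1_def)
  qed
  have \<beta>1: "\<beta>1 > 0" "\<beta>1 \<le> 1 / 2"
  proof -
    have "q ^ 1 \<le> q ^ (k - 1)" using q2 k by (intro power_increasing) auto
    then have "2 \<le> q ^ (k - 1)" using q2 by simp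
    then show "\<beta>1 > 0" "\<beta>1 \<le> 1 / 2" by (auto simp: \<beta>1_def field_simps)
  qed
  have hw: "hyp_weight k H a v = (if v \<in> H then 0 else \<beta>1) - point_ind a v" for H a and v :: "'a vec"
    by (simp add: hyp_weight_def \<beta>1_def q_def)
  define bet where "bet x = (if c x = 1 then 0 else if c x = \<beta>1 - 1 then \<beta>1 else c x)" for x
  define eps where "eps x = c x - bet x" for x
  have coset: "\<exists>\<beta>\<in>{0, \<beta>1}. \<exists>e. \<forall>u\<in>U. bet (x + u) = \<beta> \<and>
      (eps (x + u) = 0 \<or> u = e \<and> eps (x + u) = (if \<beta> = 0 then 1 else - 1))"
    if x: "x \<in> V" "x \<notin> U" for x
  proof -
    obtain \<beta> e where \<beta>: "\<beta> \<in> {0, \<beta>1}" and *: "\<And>u. u \<in> U \<Longrightarrow>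
        c (x + u) = \<beta> \<or> u = e \<and> c (x + u) = (if \<beta> = 0 then 1 else \<beta> - 1)"
      using cosets[OF x] unfolding \<beta>1_def q_def by blast
    have "bet (x + u) = \<beta> \<and> (eps (x + u) = 0 \<or> u = e \<and> eps (x + u) = (if \<beta> = 0 then 1 else - 1))"
      if "u \<in> U" for u
      using *[OF that] \<beta> \<beta>1 by (auto simp: bet_def eps_def)
    then show ?thesis using \<beta> by blast
  qed
  have bet_add: "bet (x + u) = bet x" if xx: "x \<in> V" "x \<notin> U" "u \<in> U" for x u
  proof -
    obtain \<beta> where "\<And>u. u \<in> U \<Longrightarrow> bet (x + u) = \<beta>" using coset[OF xx(1,2)] by blast
    from this[OF xx(3)] this[OF fvec.subspace_0[OF U(1)]] show ?thesis by simp
  qed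
  have bet_val: "bet x = 0 \<or> bet x = \<beta>1" if xx: "x \<in> V" "x \<notin> U" for x
  proof -
    obtain \<beta> where \<beta>: "\<beta> \<in> {0, \<beta>1}" "\<And>u. u \<in> U \<Longrightarrow> bet (x + u) = \<beta>"
      using coset[OF xx] by blast
    from \<beta>(2)[OF fvec.subspace_0[OF U(1)]] \<beta>(1) show ?thesis by auto
  qed
  have eps_uniq: "u = u'" if xx: "x \<in> V" "x \<notin> U" "u \<in> U" "u' \<in> U" "eps (x + u) \<noteq> 0" "eps (x + u') \<noteq> 0" for x u u'
  proof -
    obtain e where "\<And>u. u \<in> U \<Longrightarrow> eps (x + u) = 0 \<or> u = e" using coset[OF xx(1,2)] by blast
    then show ?thesis using xx by metis
  qed
  have eps_val: "eps x = 0 \<or> eps x = (if bet x = 0 then 1 else - 1)" if x: "x \<in> V" "x \<notin> U" for x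
  proof -
    obtain \<beta> where "\<And>u. u \<in> U \<Longrightarrow> bet (x + u) = \<beta> \<and> (eps (x + u) = 0 \<or> eps (x + u) = (if \<beta> = 0 then 1 else - 1))"
      using coset[OF x] by metis
    from this[OF fvec.subspace_0[OF U(1)]] show ?thesis by simp
  qed
  have bet_scale: "bet (t \<odot> x) = bet x" and eps_scale: "eps (t \<odot> x) = eps x" if "t \<noteq> 0" for t x
    using weight_scale[OF c that] by (simp_all add: bet_def eps_def)
  obtain K where K: "fvec.subspace K" "K \<subseteq> U" "card K = CARD('a) ^ (k - 2)"
  proof -
    have "CARD('a) ^ (k - 2) \<le> CARD('a) ^ k" using card_field_ge_2[where 'a='a] by (intro power_increasing) auto
    then have "CARD('a) ^ (k - 2) \<le> card U" using U(4) by linarith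
    then show ?thesis using exists_subspace[OF U(1) finite_subset[OF U(2) V(2)]] that by blast
  qed
  have finU: "finite U" and finK: "finite K" using K U V finite_subset by metis+
  \<comment> \<open>\<open>B x y\<close> is the sum of the base value over the points of the quotient line through \<open>x\<close> and \<open>y\<close>, and \<open>K\<close>
    is the part of the \<open>k\<close>-spaces inside \<open>U\<close>.\<close>
  define B where "B x y = bet y + (\<Sum>t\<in>UNIV. bet (t \<odot> y + x))" for x y
  define indep where "indep x y \<longleftrightarrow> x \<in> V \<and> y \<in> V \<and> y \<notin> U \<and> x \<notin> adjoin U y" for x y
  have indepU: "x - t \<odot> y \<notin> U" if "indep x y" for x y t
    using that mem_adjoin_iff[OF U(1)] by (auto simp: indep_def)
  have indepD: "x \<in> V" "y \<in> V" "y \<notin> U" "x \<notin> U" "t \<odot> y + x \<in> V" "t \<odot> y + x \<notin> U"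
    "y + s \<odot> x \<in> V" "y + s \<odot> x \<notin> U" if "indep x y" for x y t s
  proof -
    show x: "x \<in> V" "y \<in> V" "y \<notin> U" using that by (auto simp: indep_def)
    show xU: "x \<notin> U" using that subset_adjoin[of U y] by (auto simp: indep_def)
    show "t \<odot> y + x \<in> V" "y + s \<odot> x \<in> V" using x V
      by (auto intro: fvec.subspace_add fvec.subspace_scale)
    show "t \<odot> y + x \<notin> U"
    proof
      assume "t \<odot> y + x \<in> U"
      then show False using indepU[OF that, of "- t"] by (simp add: add.commute)
    qed
    show "y + s \<odot> x \<notin> U"
    proof
      assume *: "y + s \<odot> x \<in> U"
      show False
      proof (cases "s = 0")
        case True
        then show False using * x by simp
      next
        case False
        have "inverse s \<odot> (y + s \<odot> x) \<in> U" using * by (rule fvec.subspace_scale[OF U(1)])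
        also have "inverse s \<odot> (y + s \<odot> x) = x - (- inverse s) \<odot> y"
          using False by (simp add: fvec.scale_right_distrib add.commute)
        finally show False using indepU[OF that] by blast
      qed
    qed
  qed
  have total: "q ^ (k - 2) * B x y + (\<Sum>w\<in>K. eps (w + y)) + (\<Sum>t\<in>UNIV. \<Sum>w\<in>K. eps (w + t \<odot> y + x)) \<in> {0, 1}"
    if xy: "indep x y" for x y
  proof -
    have adjKU: "adjoin K y \<subseteq> adjoin U y" using K(2) by (auto simp: adjoin_def)
    have yK: "y \<notin> K" and xK: "x \<notin> adjoin K y" using xy K(2) adjKU by (auto simp: indep_def)
    have KV: "adjoin (adjoin K y) x \<subseteq> V"
      using K U V indepD[OF xy] by (intro adjoin_subset) auto
    have "card (adjoin (adjoin K y) x) = CARD('a) * (CARD('a) * CARD('a) ^ (k - 2))"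
      by (simp add: card_adjoin[OF subspace_adjoin[OF K(1)] xK] card_adjoin[OF K(1) yK] K(3))
    also have "\<dots> = CARD('a) ^ k"
      using k by (metis le_add_diff_inverse mult.assoc power2_eq_square power_add)
    finally have "wsum c (adjoin (adjoin K y) x) \<in> {0, 1}"
      using bw KV subspace_adjoin[OF subspace_adjoin[OF K(1)]] unfolding boolean_weight_def by blast
    moreover have "wsum c K = 0" using U(3) K(2) by (simp add: wsum_def subset_iff)
    moreover have "(\<Sum>w\<in>K. c (w + y)) = q ^ (k - 2) * bet y + (\<Sum>w\<in>K. eps (w + y))"
    proof -
      have "(\<Sum>w\<in>K. c (w + y)) = (\<Sum>w\<in>K. bet y + eps (w + y))"
        using bet_add[OF indepD(2,3)[OF xy]] K(2)
        by (intro sum.cong refl) (auto simp: eps_def add.commute)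
      then show ?thesis by (simp add: sum.distrib K(3) q_def)
    qed
    moreover have "(\<Sum>t\<in>UNIV. \<Sum>w\<in>K. c (w + t \<odot> y + x)) =
        q ^ (k - 2) * (\<Sum>t\<in>UNIV. bet (t \<odot> y + x)) + (\<Sum>t\<in>UNIV. \<Sum>w\<in>K. eps (w + t \<odot> y + x))"
    proof -
      have "(\<Sum>w\<in>K. c (w + t \<odot> y + x)) = q ^ (k - 2) * bet (t \<odot> y + x) + (\<Sum>w\<in>K. eps (w + t \<odot> y + x))" for t
      proof -
        have "c (w + t \<odot> y + x) = bet (t \<odot> y + x) + eps (w + t \<odot> y + x)" if "w \<in> K" for w
          using bet_add[OF indepD(5,6)[OF xy], of w t] that K(2)
          by (auto simp: eps_def add_ac)
        then have "(\<Sum>w\<in>K. c (w + t \<odot> y + x)) = (\<Sum>w\<in>K. bet (t \<odot> y + x) + eps (w + t \<odot> y + x))"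
          by (intro sum.cong refl)
        then show ?thesis by (simp add: sum.distrib K(3) q_def)
      qed
      then show ?thesis by (simp add: sum.distrib sum_distrib_left)
    qed
    ultimately show ?thesis
      using wsum_adjoin2[OF K(1) yK xK c] by (simp add: B_def algebra_simps)
  qed
  have bad: "card {u\<in>U. \<exists>w\<in>K. eps (z + u + w) \<noteq> 0} \<le> card K" if z: "z \<in> V" "z \<notin> U" for z
  proof -
    obtain e where e: "\<And>u. u \<in> U \<Longrightarrow> eps (z + u) = 0 \<or> u = e" using coset[OF z] by blast
    have "{u\<in>U. \<exists>w\<in>K. eps (z + u + w) \<noteq> 0} \<subseteq> (\<lambda>w. e - w) ` K"
    proof clarify
      fix u w assume "u \<in> U" "w \<in> K" "eps (z + u + w) \<noteq> 0"
      then have "u + w = e" using e[of "u + w"] K(2) fvec.subspace_add[OF U(1)]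
        by (auto simp: add.assoc)
      then show "u \<in> (\<lambda>w. e - w) ` K" using \<open>w \<in> K\<close> by (intro image_eqI[of _ _ w]) auto
    qed
    then show ?thesis using surj_card_le[OF finK] by blast
  qed
  have cardK: "CARD('a) * card K < card U"
  proof -
    have "CARD('a) * card K = CARD('a) ^ Suc (k - 2)" using K(3) by simp
    also have "\<dots> < CARD('a) ^ k"
      using card_field_ge_2[where 'a='a] k by (intro power_strict_increasing) auto
    finally show ?thesis using U(4) by linarith
  qed
  \<comment> \<open>With \<open>x\<close> fixed, \<open>y\<close> is moved within its coset to \<open>y + u\<close> such that no exception remains over the
    points of the line other than \<open>x\<close>; each point excludes at most \<open>card K\<close> of the vectors \<open>u\<close>. Up to
    scaling, the points other than \<open>x\<close> are the vectors \<open>y + s \<odot> x\<close>.\<close>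
  have B_half: "q ^ (k - 2) * B x y + (\<Sum>w\<in>K. eps (w + x)) \<in> {0, 1}" if xy: "indep x y" for x y
  proof -
    define bd where "bd s = {u\<in>U. \<exists>w\<in>K. eps ((y + s \<odot> x) + u + w) \<noteq> 0}" for s
    have "card (\<Union>s\<in>UNIV. bd s) \<le> (\<Sum>s\<in>UNIV. card (bd s))" by (rule card_UN_le) simp
    also have "\<dots> \<le> (\<Sum>s\<in>(UNIV :: 'a set). card K)"
      using bad indepD(7,8)[OF xy] by (intro sum_mono) (auto simp: bd_def)
    also have "\<dots> < card U" using cardK by simp
    finally have "\<not> U \<subseteq> (\<Union>s\<in>UNIV. bd s)"
      using card_mono[of "\<Union>s\<in>UNIV. bd s" U] finU by (force simp: bd_def)
    then obtain u where u: "u \<in> U" and nbd: "u \<notin> (\<Union>s\<in>UNIV. bd s)" by blast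
    have good: "eps ((y + s \<odot> x) + u + w) = 0" if "w \<in> K" for s w
      using nbd u that unfolding bd_def by blast
    define y' where "y' = y + u"
    have "y' \<notin> U"
    proof
      assume "y' \<in> U"
      then have "y' - u \<in> U" using u by (rule fvec.subspace_diff[OF U(1)])
      then show False using indepD(3)[OF xy] by (simp add: y'_def)
    qed
    moreover have "x \<notin> adjoin U y'"
    proof
      assume "x \<in> adjoin U y'"
      then obtain t where "x - t \<odot> y' \<in> U" unfolding mem_adjoin_iff[OF U(1)] by blast
      then have "(x - t \<odot> y') + t \<odot> u \<in> U" using u
        by (intro fvec.subspace_add[OF U(1)] fvec.subspace_scale[OF U(1)])
      then have "x - t \<odot> y \<in> U" by (simp add: y'_def fvec.scale_right_distrib algebra_simps)
      then show False using indepU[OF xy] by blast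
    qed
    ultimately have xy': "indep x y'"
      using xy u U(2) fvec.subspace_add[OF V(1)] by (auto simp: indep_def y'_def)
    have BB: "B x y' = B x y"
    proof -
      have "bet (t \<odot> y' + x) = bet (t \<odot> y + x)" for t
        using bet_add[OF indepD(5,6)[OF xy], of "t \<odot> u" t] u fvec.subspace_scale[OF U(1)]
        by (simp add: y'_def fvec.scale_right_distrib add_ac)
      then show ?thesis using bet_add[OF indepD(2,3)[OF xy] u] by (simp add: B_def y'_def)
    qed
    have z1: "(\<Sum>w\<in>K. eps (w + y')) = 0"
      using good[of _ 0] by (intro sum.neutral) (simp add: y'_def add_ac)
    have z2: "(\<Sum>w\<in>K. eps (w + t \<odot> y' + x)) = 0" if t: "t \<noteq> 0" for t
    proof (rule sum.neutral, rule ballI)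
      fix w assume w: "w \<in> K"
      have "eps (t \<odot> ((y + inverse t \<odot> x) + u + inverse t \<odot> w)) = 0"
        using good[of "inverse t \<odot> w" "inverse t"] w fvec.subspace_scale[OF K(1)] eps_scale[OF t] by simp
      also have "t \<odot> ((y + inverse t \<odot> x) + u + inverse t \<odot> w) = w + t \<odot> y' + x"
        using t by (simp add: y'_def fvec.scale_right_distrib add_ac)
      finally show "eps (w + t \<odot> y' + x) = 0" .
    qed
    have "(\<Sum>t\<in>UNIV. \<Sum>w\<in>K. eps (w + t \<odot> y' + x)) = (\<Sum>w\<in>K. eps (w + x))"
      using z2 by (subst sum.remove[of UNIV 0]) auto
    then show ?thesis using total[OF xy'] BB z1 by simp
  qed
  have B01: "q ^ (k - 2) * B x y = 0 \<or> q ^ (k - 2) * B x y = 1" if xy: "indep x y" for x y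
  proof -
    have "1 * card K \<le> CARD('a) * card K"
      using card_field_ge_2[where 'a='a] by (intro mult_le_mono1) simp
    then have "card {u\<in>U. \<exists>w\<in>K. eps (x + u + w) \<noteq> 0} < card U"
      using bad[OF indepD(1,4)[OF xy]] cardK by linarith
    then have "\<not> U \<subseteq> {u\<in>U. \<exists>w\<in>K. eps (x + u + w) \<noteq> 0}"
      using card_mono[of "{u\<in>U. \<exists>w\<in>K. eps (x + u + w) \<noteq> 0}" U] finU by force
    then obtain u where u: "u \<in> U" and good: "\<And>w. w \<in> K \<Longrightarrow> eps (x + u + w) = 0" by blast
    have "x + u \<notin> adjoin U y"
    proof
      assume "x + u \<in> adjoin U y"
      then obtain t where "x + u - t \<odot> y \<in> U" unfolding mem_adjoin_iff[OF U(1)] by blast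
      then have "x + u - t \<odot> y - u \<in> U" using u by (rule fvec.subspace_diff[OF U(1)])
      then have "x - t \<odot> y \<in> U" by (simp add: algebra_simps)
      then show False using indepU[OF xy] by blast
    qed
    then have xy': "indep (x + u) y"
      using xy u U(2) fvec.subspace_add[OF V(1)] by (auto simp: indep_def)
    have "bet (t \<odot> y + (x + u)) = bet (t \<odot> y + x)" for t
      using bet_add[OF indepD(5,6)[OF xy] u, of t] by (simp add: add_ac)
    then have "B (x + u) y = B x y" by (simp add: B_def)
    moreover have "(\<Sum>w\<in>K. eps (w + (x + u))) = 0"
      using good by (intro sum.neutral) (simp add: add_ac)
    ultimately show ?thesis using B_half[OF xy'] by simp
  qed
  have B_eps: "q ^ (k - 2) * B x y + eps x \<in> {0, 1}" if xy: "indep x y" and ex: "eps x \<noteq> 0" for x y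
  proof -
    have "eps (w + x) = 0" if "w \<in> K - {0}" for w
    proof (rule ccontr)
      assume "eps (w + x) \<noteq> 0"
      then show False
        using eps_uniq[OF indepD(1,4)[OF xy], of w 0] K(2) fvec.subspace_0[OF U(1)] ex that
        by (auto simp: add.commute)
    qed
    then have "(\<Sum>w\<in>K. eps (w + x)) = (\<Sum>w\<in>{0}. eps (w + x))"
      using finK fvec.subspace_0[OF K(1)] by (intro sum.mono_neutral_right) auto
    then have "(\<Sum>w\<in>K. eps (w + x)) = eps x" by simp
    then show ?thesis using B_half[OF xy] by simp
  qed
  have dep: "y \<in> fvec.span {x}" if x: "x \<in> V" "x \<notin> U" "eps x \<noteq> 0" and y: "y \<in> adjoin U x" "y \<notin> U" "eps y \<noteq> 0" for x y
  proof -
    obtain t where t: "y - t \<odot> x \<in> U" using y(1) unfolding mem_adjoin_iff[OF U(1)] by blast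
    then have t0: "t \<noteq> 0" using y(2) by auto
    define u where "u = inverse t \<odot> (y - t \<odot> x)"
    have u: "u \<in> U" unfolding u_def using t by (rule fvec.subspace_scale[OF U(1)])
    have yu: "x + u = inverse t \<odot> y" using t0 by (simp add: u_def fvec.scale_right_diff_distrib)
    have "eps (x + u) = eps y" unfolding yu using t0 by (intro eps_scale) simp
    then have "u = 0"
      using eps_uniq[OF x(1,2) u, of 0] fvec.subspace_0[OF U(1)] x(3) y(3) by simp
    then have "t \<odot> x = t \<odot> (inverse t \<odot> y)" using yu by simp
    then have "y = t \<odot> x" using t0 by simp
    then show ?thesis by (auto simp: fvec.span_singleton)
  qed
  \<comment> \<open>Two exceptions of the same sign \<open>\<sigma>\<close> on one \<open>k\<close>-space, when no exception of the opposite sign exists.\<close>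
  have two: False
    if xy: "indep x y" and \<sigma>: "\<sigma> = 1 \<or> \<sigma> = - 1" and pos: "\<And>z. z \<in> V \<Longrightarrow> z \<notin> U \<Longrightarrow> \<sigma> * eps z \<ge> 0"
      and ex: "\<sigma> * eps x = 1" "\<sigma> * eps y = 1" and B0: "\<sigma> = 1 \<Longrightarrow> B x y = 0" for x y \<sigma>
  proof -
    have KU: "w \<in> U" if "w \<in> K" for w using that K(2) by blast
    have pos': "\<sigma> * eps (w + z) \<ge> 0" if "w \<in> K" "z \<in> V" "z \<notin> U" for w z
    proof (rule pos)
      show "w + z \<in> V" using that KU U(2) by (intro fvec.subspace_add[OF V(1)]) auto
      show "w + z \<notin> U" using that KU fvec.subspace_diff[OF U(1), of "w + z" w] by auto
    qed
    define S where "S z = (\<Sum>w\<in>K. \<sigma> * eps (w + z))" for z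
    have S0: "S z \<ge> \<sigma> * eps z" if "z \<in> V" "z \<notin> U" for z
      using member_le_sum[of 0 K "\<lambda>w. \<sigma> * eps (w + z)"] pos'[OF _ that] finK fvec.subspace_0[OF K(1)]
      by (simp add: S_def)
    have Spos: "S (t \<odot> y + x) \<ge> 0" for t
      unfolding S_def using pos' indepD(5,6)[OF xy] by (intro sum_nonneg) auto
    have "S (0 \<odot> y + x) \<le> (\<Sum>t\<in>UNIV. S (t \<odot> y + x))"
      using Spos by (intro member_le_sum) auto
    then have ge: "S y + (\<Sum>t\<in>UNIV. S (t \<odot> y + x)) \<ge> 2"
      using S0[OF indepD(1,4)[OF xy]] S0[OF indepD(2,3)[OF xy]] ex by simp
    have "\<sigma> * ((\<Sum>w\<in>K. eps (w + y)) + (\<Sum>t\<in>UNIV. \<Sum>w\<in>K. eps (w + t \<odot> y + x))) =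
        S y + (\<Sum>t\<in>UNIV. S (t \<odot> y + x))"
      by (simp add: S_def sum_distrib_left distrib_left add.assoc)
    then show False using total[OF xy] B01[OF xy] ge \<sigma> B0 q2 by auto
  qed
  have bet_nonneg: "bet x \<ge> 0" if "x \<in> V" "x \<notin> U" for x
    using bet_val[OF that] \<beta>1 by auto
  have std_eps: "eps v = \<tau> * point_ind a v"
    if a: "a \<in> V" "a \<notin> U" "eps a = \<tau>" "\<tau> \<noteq> 0" and v: "v \<in> V" "v \<notin> U"
      and uniq: "\<And>x y. x \<in> V \<Longrightarrow> x \<notin> U \<Longrightarrow> y \<in> V \<Longrightarrow> y \<notin> U \<Longrightarrow> eps x \<noteq> 0 \<Longrightarrow> eps y \<noteq> 0 \<Longrightarrow> y \<in> fvec.span {x}"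
    for a v \<tau>
  proof -
    have v0: "v \<noteq> 0" using v(2) fvec.subspace_0[OF U(1)] by auto
    show ?thesis
    proof (cases "v \<in> fvec.span {a}")
      case True
      then obtain t where "v = t \<odot> a" by (auto simp: fvec.span_singleton)
      moreover from this have "t \<noteq> 0" using v0 by auto
      ultimately show ?thesis using eps_scale[of t a] a v0 True by (simp add: point_ind_def)
    next
      case False
      then show ?thesis using uniq[OF a(1,2) v] a by (auto simp: point_ind_def)
    qed
  qed
  note point_U = point_ind_subspace[OF U(1)]
  show ?thesis
  proof (cases "\<forall>x\<in>V - U. bet x = 0")
    case True
    then have bet0: "bet x = 0" if "x \<in> V" "x \<notin> U" for x using that by blast
    have epspos: "eps x = 0 \<or> eps x = 1" if "x \<in> V" "x \<notin> U" for x
      using eps_val[OF that] bet0[OF that] by simp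
    have uniq: "y \<in> fvec.span {x}"
      if "x \<in> V" "x \<notin> U" "y \<in> V" "y \<notin> U" "eps x \<noteq> 0" "eps y \<noteq> 0" for x y
    proof (cases "y \<in> adjoin U x")
      case True
      then show ?thesis using dep that by blast
    next
      case False
      then have yx: "indep y x" using that by (auto simp: indep_def)
      have "B y x = 0"
        using bet0[OF indepD(5,6)[OF yx]] bet0[OF indepD(2,3)[OF yx]] by (simp add: B_def)
      then show ?thesis using two[OF yx, of 1] epspos that by fastforce
    qed
    show ?thesis
    proof (cases "\<exists>a\<in>V - U. eps a \<noteq> 0")
      case True
      then obtain a where a: "a \<in> V" "a \<notin> U" "eps a = 1" using epspos by blast
      have "c v = point_ind a v" if v: "v \<in> V" for v
      proof (cases "v \<in> U")
        case True
        then show ?thesis using point_U a U(3) by simp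
      next
        case False
        have "eps v = 1 * point_ind a v"
          by (rule std_eps[OF a]) (use v False uniq in auto)
        then show ?thesis using bet0[OF v False] by (simp add: eps_def)
      qed
      then show ?thesis by (rule std_weight_pointI[OF a(1)])
    next
      case False
      have "c v = point_ind 0 v" if v: "v \<in> V" for v
        using False bet0[OF v] U(3)[of v] v by (cases "v \<in> U") (auto simp: eps_def)
      then show ?thesis by (rule std_weight_pointI[OF fvec.subspace_0[OF V(1)]])
    qed
  next
    case False
    then obtain x1 where x1: "x1 \<in> V" "x1 \<notin> U" "bet x1 = \<beta>1" using bet_val by blast
    have B_ge: "B x y \<ge> bet y + bet (t \<odot> y + x)" if "indep x y" for x y t
    proof -
      have "bet (t \<odot> y + x) \<le> (\<Sum>t\<in>UNIV. bet (t \<odot> y + x))"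
        using bet_nonneg[OF indepD(5,6)[OF that]] by (intro member_le_sum) auto
      then show ?thesis by (simp add: B_def)
    qed
    \<comment> \<open>A positive exception forces the base value \<open>0\<close> on all quotient lines through it.\<close>
    have noplus: "bet x = \<beta>1" if x: "x \<in> V" "x \<notin> U" and ex: "eps x \<noteq> 0" for x
    proof (rule ccontr)
      assume "bet x \<noteq> \<beta>1"
      then have b0: "bet x = 0" using bet_val[OF x] by simp
      then have e1: "eps x = 1" using eps_val[OF x] ex by simp
      have "x \<notin> adjoin U x1"
      proof
        assume "x \<in> adjoin U x1"
        then obtain t where t: "x - t \<odot> x1 \<in> U" unfolding mem_adjoin_iff[OF U(1)] by blast
        then have t0: "t \<noteq> 0" using x(2) by auto
        have "t \<odot> x1 \<notin> U"
        proof
          assume "t \<odot> x1 \<in> U"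
          then have "inverse t \<odot> t \<odot> x1 \<in> U" by (rule fvec.subspace_scale[OF U(1)])
          then show False using t0 x1(2) by simp
        qed
        then have "bet (t \<odot> x1 + (x - t \<odot> x1)) = bet (t \<odot> x1)"
          using t x1(1) by (intro bet_add fvec.subspace_scale[OF V(1)])
        then show False using bet_scale[OF t0] b0 x1(3) \<beta>1 by simp
      qed
      then have xx: "indep x x1" using x x1 by (simp add: indep_def)
      have "B x x1 \<ge> \<beta>1" using B_ge[OF xx, of 0] b0 x1(3) by simp
      then have "q ^ (k - 2) * B x x1 > 0" using \<beta>1 qk(2) by simp
      then show False using B_eps[OF xx ex] e1 q2 by auto
    qed
    have epsneg: "eps x = 0 \<or> eps x = - 1" if "x \<in> V" "x \<notin> U" for x
      using eps_val[OF that] noplus[OF that] \<beta>1 by auto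
    have uniq: "y \<in> fvec.span {x}"
      if "x \<in> V" "x \<notin> U" "y \<in> V" "y \<notin> U" "eps x \<noteq> 0" "eps y \<noteq> 0" for x y
    proof (cases "y \<in> adjoin U x")
      case True
      then show ?thesis using dep that by blast
    next
      case False
      then have yx: "indep y x" using that by (auto simp: indep_def)
      have "- 1 * eps z \<ge> 0" if "z \<in> V" "z \<notin> U" for z using epsneg[OF that] by auto
      then have False using two[OF yx, of "- 1"] epsneg[OF that(1,2)] epsneg[OF that(3,4)] that(5,6) by auto
      then show ?thesis ..
    qed
    define H where "H = {v\<in>V. v \<in> U \<or> bet v = 0}"
    have UH: "U \<subseteq> H" using U(2) by (auto simp: H_def)
    have addH: "u + v \<in> H" if uv: "u \<in> H" "v \<in> H" for u v
    proof -
      have uvV: "u \<in> V" "v \<in> V" "u + v \<in> V" using uv V(1) by (auto simp: H_def intro: fvec.subspace_add)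
      consider "u \<in> U" | "v \<in> U" | "u \<notin> U" "v \<notin> U" by blast
      then have "u + v \<in> U \<or> bet (u + v) = 0"
      proof cases
        case 1
        then show ?thesis
          using uv(2) bet_add[of v u] fvec.subspace_add[OF U(1) 1, of v]
          unfolding H_def by (cases "v \<in> U") (simp_all add: add.commute)
      next
        case 2
        then show ?thesis
          using uv(1) bet_add[of u v] fvec.subspace_add[OF U(1) _ 2, of u]
          unfolding H_def by (cases "u \<in> U") simp_all
      next
        case 3
        then have b: "bet u = 0" "bet v = 0" using uv by (auto simp: H_def)
        show ?thesis
        proof (cases "u \<in> adjoin U v")
          case True
          then obtain t where t: "u - t \<odot> v \<in> U" unfolding mem_adjoin_iff[OF U(1)] by blast
          have e: "u + v = (t + 1) \<odot> v + (u - t \<odot> v)" by (simp add: fvec.scale_left_distrib)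
          show ?thesis
          proof (cases "(t + 1) \<odot> v \<in> U")
            case True
            then show ?thesis unfolding e using t fvec.subspace_add[OF U(1)] by blast
          next
            case False
            then have "t + 1 \<noteq> 0" using fvec.subspace_0[OF U(1)] by auto
            then show ?thesis
              unfolding e using bet_add[OF _ False t] uvV b bet_scale fvec.subspace_scale[OF V(1)] by simp
          qed
        next
          case False
          then have ind: "indep u v" using uvV 3 by (simp add: indep_def)
          have le: "bet (t \<odot> v + u) \<le> \<beta>1" for t
            using bet_val[OF indepD(5,6)[OF ind], of t] \<beta>1 by auto
          have "B u v = (\<Sum>t\<in>UNIV - {0}. bet (t \<odot> v + u))"
            unfolding B_def using b by (subst sum.remove[of UNIV 0]) auto
          also have "\<dots> \<le> (\<Sum>t\<in>UNIV - {0 :: 'a}. \<beta>1)" using le by (intro sum_mono)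
          also have "\<dots> = (q - 1) * \<beta>1"
            using card_field_ge_2[where 'a='a] by (simp add: card_Diff_singleton of_nat_diff q_def)
          finally have "q ^ (k - 2) * B u v \<le> q ^ (k - 2) * ((q - 1) * \<beta>1)"
            using qk(2) by (intro mult_left_mono) auto
          also have "\<dots> = (q - 1) * (q ^ (k - 2) * \<beta>1)" by (simp add: algebra_simps)
          also have "\<dots> < 1" using q2 unfolding qk(1) by (simp add: field_simps)
          finally have "B u v = 0" using B01[OF ind] q2 by auto
          then have "bet (1 \<odot> v + u) \<le> 0" using B_ge[OF ind, of 1] b by simp
          then show ?thesis using bet_nonneg[OF indepD(5,6)[OF ind], of 1] by (simp add: add.commute)
        qed
      qed
      then show ?thesis using uvV by (simp add: H_def)
    qed
    have scaleH: "t \<odot> v \<in> H" if "v \<in> H" for t v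
      using that bet_scale[of t v] fvec.subspace_scale[OF U(1)] fvec.subspace_scale[OF V(1)]
        fvec.subspace_0[OF U(1)] fvec.subspace_0[OF V(1)]
      by (cases "t = 0") (auto simp: H_def)
    have subH: "fvec.subspace H"
      using addH scaleH UH fvec.subspace_0[OF U(1)] by (intro fvec.subspaceI) auto
    have x1H: "x1 \<notin> H" using x1 \<beta>1 by (auto simp: H_def)
    have "v \<in> adjoin H x1" if v: "v \<in> V" for v
    proof (cases "v \<in> adjoin U x1")
      case True
      then show ?thesis using UH by (auto simp: adjoin_def)
    next
      case False
      then have ind: "indep v x1" using v x1 by (simp add: indep_def)
      have "\<exists>t. bet (t \<odot> x1 + v) = 0"
      proof (rule ccontr)
        assume "\<not> ?thesis"
        then have "bet (t \<odot> x1 + v) = \<beta>1" for t using bet_val[OF indepD(5,6)[OF ind], of t] by auto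
        then have "q ^ (k - 2) * B v x1 = (q + 1) * (q ^ (k - 2) * \<beta>1)"
          using x1(3) by (simp add: B_def q_def algebra_simps)
        also have "\<dots> > 1" using q2 unfolding qk(1) by (simp add: field_simps)
        finally show False using B01[OF ind] q2 by auto
      qed
      then obtain t where t: "bet (t \<odot> x1 + v) = 0" by blast
      then have "v - (- t) \<odot> x1 \<in> H" using indepD(5)[OF ind, of t] by (simp add: H_def add.commute)
      then show ?thesis unfolding mem_adjoin_iff[OF subH] by blast
    qed
    then have hyp: "hyperplane H V"
      using subH x1H V(1) x1(1) by (intro hyperplaneI[of _ _ x1]) (auto simp: H_def)
    have betH: "bet v = (if v \<in> H then 0 else \<beta>1)" if "v \<in> V" "v \<notin> U" for v
      using bet_val[OF that] that by (auto simp: H_def)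
    show ?thesis
    proof (cases "\<exists>a\<in>V - U. eps a \<noteq> 0")
      case True
      then obtain a where a: "a \<in> V" "a \<notin> U" "eps a = - 1" using epsneg by blast
      have aH: "a \<notin> H" using noplus[OF a(1,2)] a \<beta>1 by (auto simp: H_def)
      have "c v = hyp_weight k H a v" if v: "v \<in> V" for v
      proof (cases "v \<in> U")
        case True
        then show ?thesis using point_U a U(3) UH by (auto simp: hw)
      next
        case False
        have "eps v = - 1 * point_ind a v"
          by (rule std_eps[OF a]) (use v False uniq in auto)
        then show ?thesis using betH[OF v False] by (simp add: eps_def hw)
      qed
      then show ?thesis by (rule std_weight_hyperI[OF hyp a(1) disjI2[OF aH]])
    next
      case False
      have "c v = hyp_weight k H 0 v" if v: "v \<in> V" for v
        using False betH[OF v] U(3)[of v] v UH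
        by (cases "v \<in> U") (auto simp: eps_def hw)
      then show ?thesis using fvec.subspace_0[OF V(1)] by (intro std_weight_hyperI[OF hyp]) auto
    qed
  qed
qed

section \<open>Complements, and the step to the next dimension\<close>

text \<open>
  The reciprocal of the number of points of a \<open>k\<close>-space: the constant weight of the function \<open>1\<close>.
\<close>

definition density :: "'a::{field,finite} itself \<Rightarrow> nat \<Rightarrow> real" where
  "density _ k = (real CARD('a) - 1) / (real CARD('a) ^ k - 1)"

text \<open>
  If \<open>c\<close> is the weight of \<open>f\<close>, this is the weight of \<open>1 - f\<close>.
\<close>

definition compl_weight :: "nat \<Rightarrow> ('a::{field,finite} vec \<Rightarrow> real) \<Rightarrow> 'a vec \<Rightarrow> real" where
  "compl_weight k c v = (if v = 0 then 0 else density TYPE('a) k - c v)"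

text \<open>
  The weight is standard, up to passing to the complement.
\<close>

definition classified :: "nat \<Rightarrow> 'a::{field,finite} vec set \<Rightarrow> ('a vec \<Rightarrow> real) \<Rightarrow> bool" where
  "classified k V c \<longleftrightarrow> std_weight k V c \<or> std_weight k V (compl_weight k c)"

text \<open>
  All Boolean degree one functions on the \<open>k\<close>-spaces in \<open>V\<close> are trivial, in terms of weights.
\<close>

definition weight_trivial :: "nat \<Rightarrow> 'a::{field,finite} vec set \<Rightarrow> bool" where
  "weight_trivial k V \<longleftrightarrow> (\<forall>c. boolean_weight k V c \<longrightarrow> classified k V c)"

lemma density_bounds:
  assumes "k \<ge> 2"
  shows "0 < density TYPE('a::{field,finite}) k" "density TYPE('a) k < 1 / real CARD('a) ^ (k - 1)"
    "0 < 1 / real CARD('a) ^ (k - 1)" "1 / real CARD('a) ^ (k - 1) < 1"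
proof -
  define q where "q = real CARD('a)"
  have q2: "q \<ge> 2" using card_field_ge_2[where 'a='a] by (simp add: q_def)
  obtain j where j: "k = Suc j" "j \<ge> 1" using assms by (cases k) auto
  have "q ^ 1 \<le> q ^ j" using q2 j by (intro power_increasing) auto
  then have qj: "q ^ j \<ge> 2" using q2 by simp
  then have "q * q ^ j \<ge> 2 * 2" using q2 by (intro mult_mono) auto
  then have "0 < (q - 1) / (q ^ k - 1)" "(q - 1) / (q ^ k - 1) < 1 / q ^ (k - 1)"
    using q2 qj j by (simp_all add: field_simps)
  then show "0 < density TYPE('a) k" "density TYPE('a) k < 1 / real CARD('a) ^ (k - 1)"
    by (simp_all add: density_def q_def)
  show "0 < 1 / real CARD('a) ^ (k - 1)" "1 / real CARD('a) ^ (k - 1) < 1"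
    using qj j by (simp_all add: q_def)
qed

lemma weight_compl: "weight c \<Longrightarrow> weight (compl_weight k c)"
  by (auto simp: weight_def compl_weight_def)

lemma wsum_compl:
  fixes K :: "'a::{field,finite} vec set"
  assumes c: "weight c" and K: "fvec.subspace K" "card K = CARD('a) ^ k" and k: "k \<ge> 1"
  shows "wsum (compl_weight k c) K = 1 - wsum c K"
proof -
  have q2: "real CARD('a) \<ge> 2" using card_field_ge_2[where 'a='a] by simp
  have "real CARD('a) ^ 1 \<le> real CARD('a) ^ k" using q2 k by (intro power_increasing) auto
  then have qk: "real CARD('a) ^ k \<ge> 2" using q2 unfolding power_one_right by linarith
  have fin: "finite K" using K(2) q2 by (intro card_ge_0_finite) simp
  have 0: "0 \<in> K" using K(1) by (rule fvec.subspace_0)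
  have "(\<Sum>v\<in>K. compl_weight k c v) = (\<Sum>v\<in>K - {0}. compl_weight k c v)"
    using fin 0 by (simp add: sum.remove[of K 0] compl_weight_def)
  also have "\<dots> = (\<Sum>v\<in>K - {0}. density TYPE('a) k - c v)"
    by (intro sum.cong) (auto simp: compl_weight_def)
  also have "\<dots> = (real (card K) - 1) * density TYPE('a) k - (\<Sum>v\<in>K - {0}. c v)"
    using fin 0 K(2) qk by (simp add: sum_subtractf card_Diff_singleton of_nat_diff)
  also have "(real (card K) - 1) * density TYPE('a) k = real CARD('a) - 1"
    using qk by (simp add: density_def K(2))
  also have "(\<Sum>v\<in>K - {0}. c v) = (\<Sum>v\<in>K. c v)"
    using fin 0 by (simp add: sum.remove[of K 0] weight_0[OF c])
  finally show ?thesis using q2 by (simp add: wsum_def diff_divide_distrib)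
qed

lemma boolean_weight_compl:
  assumes "boolean_weight k V c" "k \<ge> 1"
  shows "boolean_weight k V (compl_weight k c)"
  using assms wsum_compl[of c _ k] weight_compl[of c k] unfolding boolean_weight_def by auto

lemma boolean_weight_mono: "boolean_weight k V c \<Longrightarrow> W \<subseteq> V \<Longrightarrow> boolean_weight k W c"
  unfolding boolean_weight_def by blast

lemma point_ind_coset:
  assumes U: "fvec.subspace U" and a: "a = 0 \<or> a \<notin> U"
  shows "\<exists>e. \<forall>u\<in>U. point_ind a (x + u) = 0 \<or> u = e \<and> point_ind a (x + u) = 1"
proof (cases "\<exists>e\<in>U. point_ind a (x + e) = 1")
  case True
  then obtain e t where e: "e \<in> U" "x + e \<noteq> 0" "x + e = t \<odot> a" by (auto simp: point_ind_eq_1)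
  have "u = e" if u: "u \<in> U" "point_ind a (x + u) = 1" for u
  proof -
    obtain s where s: "x + u = s \<odot> a" "x + u \<noteq> 0" using u(2) by (auto simp: point_ind_eq_1)
    then have aU: "a \<notin> U" using a by auto
    have "(s - t) \<odot> a = (x + u) - (x + e)" using s e by (simp add: fvec.scale_left_diff_distrib)
    then have st: "(s - t) \<odot> a = u - e" by simp
    have "s = t"
    proof (rule ccontr)
      assume "s \<noteq> t"
      have "inverse (s - t) \<odot> (u - e) \<in> U"
        using U u e by (intro fvec.subspace_scale fvec.subspace_diff)
      then show False using \<open>s \<noteq> t\<close> aU unfolding st[symmetric] by simp
    qed
    then show ?thesis using st by simp
  qed
  then show ?thesis using point_ind_values by metis
next
  case False
  then show ?thesis using point_ind_values by metis
qed

lemma hyperplane_avoiding: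
  assumes W: "fvec.subspace W" and a: "a \<in> W" "a \<noteq> 0"
  shows "\<exists>U. hyperplane U W \<and> a \<notin> U"
proof -
  obtain i where i: "a i \<noteq> 0" using a(2) by (auto simp: fun_eq_iff)
  define U where "U = {v\<in>W. v i = 0}"
  have U: "fvec.subspace U"
  proof (rule fvec.subspaceI)
    show "0 \<in> U" using fvec.subspace_0[OF W] by (simp add: U_def)
    show "u + v \<in> U" if "u \<in> U" "v \<in> U" for u v
      using that fvec.subspace_add[OF W, of u v] by (simp add: U_def)
    show "t \<odot> v \<in> U" if "v \<in> U" for t v
      using that fvec.subspace_scale[OF W, of v t] by (simp add: U_def) (simp add: vec_scale_def)
  qed
  have aU: "a \<notin> U" using i by (simp add: U_def)
  have "v \<in> adjoin U a" if v: "v \<in> W" for v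
  proof -
    have "v - (v i / a i) \<odot> a \<in> W" using W v a by (intro fvec.subspace_diff fvec.subspace_scale)
    then have "v - (v i / a i) \<odot> a \<in> U" using i by (simp add: U_def vec_scale_def)
    then show ?thesis unfolding mem_adjoin_iff[OF U] by blast
  qed
  then have "hyperplane U W" using U aU W a by (intro hyperplaneI[of _ _ a]) (auto simp: U_def)
  then show ?thesis using aU by blast
qed

lemma std_weight_zero_hyperplane:
  fixes W :: "'a::{field,finite} vec set"
  assumes W: "fvec.subspace W" "card W \<ge> 2" and c: "std_weight k W c"
  shows "\<exists>U. hyperplane U W \<and> (\<forall>u\<in>U. c u = 0)"
  using c
proof (cases rule: std_weightE)
  case (point a)
  note a = point
  have "\<exists>b\<in>W. b \<noteq> 0 \<and> (a \<noteq> 0 \<longrightarrow> b = a)"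
  proof (cases "a = 0")
    case True
    have "\<not> W \<subseteq> {0}" using W(2) card_mono[of "{0}" W] by force
    then show ?thesis using True by blast
  next
    case False
    then show ?thesis using a by blast
  qed
  then obtain b where b: "b \<in> W" "b \<noteq> 0" "a \<noteq> 0 \<longrightarrow> b = a" by blast
  then obtain U where U: "hyperplane U W" "b \<notin> U" using hyperplane_avoiding[OF W(1)] by blast
  have "c u = 0" if "u \<in> U" for u
    using a(2)[of u] that U b(3) point_ind_subspace[of U a u] by (cases "a = 0") (auto simp: hyperplane_def)
  then show ?thesis using U by blast
next
  case H: (hyper H a)
  have "c u = 0" if "u \<in> H" for u
    using H that point_ind_subspace[of H a u] by (auto simp: hyperplane_def hyp_weight_def)
  then show ?thesis using H(1) by blast
qed

text \<open>
  If a classified weight on \<open>X\<close> vanishes on a hyperplane \<open>U\<close> of \<open>X\<close>, then only the cases without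
  complement remain, and the other cosets of \<open>U\<close> satisfy the hypothesis of \<open>weight_gluing\<close>.
\<close>

lemma classified_coset:
  fixes X :: "'a::{field,finite} vec set"
  assumes k: "k \<ge> 2" and X: "finite X" and U: "hyperplane U X" "card U \<ge> 2" "\<And>u. u \<in> U \<Longrightarrow> c u = 0"
    and c: "classified k X c" and x: "\<And>u. u \<in> U \<Longrightarrow> x + u \<in> X" "x \<notin> U"
  shows "\<exists>\<beta>\<in>{0, 1 / real CARD('a) ^ (k - 1)}. \<exists>e. \<forall>u\<in>U.
       c (x + u) = \<beta> \<or> u = e \<and> c (x + u) = (if \<beta> = 0 then 1 else \<beta> - 1)"
proof -
  define \<beta>1 where "\<beta>1 = 1 / real CARD('a) ^ (k - 1)"
  note bnd = density_bounds[OF k, where 'a='a, folded \<beta>1_def]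
  have sU: "fvec.subspace U" and UX: "U \<subseteq> X" using U(1) by (auto simp: hyperplane_def)
  have "\<not> U \<subseteq> {0}" using U(2) card_mono[of "{0}" U] by force
  then obtain u0 where u0: "u0 \<in> U" "u0 \<noteq> 0" by blast
  have cu0: "c u0 = 0" "compl_weight k c u0 = density TYPE('a) k"
    using U(3)[OF u0(1)] u0(2) by (simp_all add: compl_weight_def)
  consider a where "a \<in> X" "\<And>v. v \<in> X \<Longrightarrow> c v = point_ind a v"
    | H a where "hyperplane H X" "a = 0 \<or> a \<notin> H"
      "\<And>v. v \<in> X \<Longrightarrow> c v = (if v \<in> H then 0 else \<beta>1) - point_ind a v"
    | a where "\<And>v. v \<in> X \<Longrightarrow> compl_weight k c v = point_ind a v"
    | H a where "\<And>v. v \<in> X \<Longrightarrow> compl_weight k c v = (if v \<in> H then 0 else \<beta>1) - point_ind a v"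
    using c unfolding classified_def hyp_weight_def \<beta>1_def by (elim disjE std_weightE[unfolded hyp_weight_def]) blast+
  then show ?thesis
  proof cases
    case (1 a)
    have a: "a = 0 \<or> a \<notin> U"
    proof (rule ccontr)
      assume *: "\<not> (a = 0 \<or> a \<notin> U)"
      have "a = 1 \<odot> a" by simp
      then have "point_ind a a = 1" using * unfolding point_ind_eq_1 by blast
      then show False using * 1(2)[OF 1(1)] U(3)[of a] by simp
    qed
    obtain e where "\<forall>u\<in>U. point_ind a (x + u) = 0 \<or> u = e \<and> point_ind a (x + u) = 1"
      using point_ind_coset[OF sU a] by blast
    then show ?thesis using 1(2) x(1) by (intro bexI[of _ 0] exI[of _ e]) auto
  next
    case (2 H a)
    have "U \<subseteq> H"
    proof
      fix u assume u: "u \<in> U"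
      then have "(if u \<in> H then 0 else \<beta>1) - point_ind a u = 0" using 2(3) U(3) UX by (metis subsetD)
      then show "u \<in> H" using bnd point_ind_values[of a u] by (auto split: if_splits)
    qed
    moreover have "card U = card H"
      using U(1) 2(1) card_field_ge_2[where 'a='a] by (simp add: hyperplane_def)
    moreover have "finite H" using 2(1) X finite_subset by (auto simp: hyperplane_def)
    ultimately have UH: "U = H" by (intro card_subset_eq)
    obtain e where e: "\<forall>u\<in>U. point_ind a (x + u) = 0 \<or> u = e \<and> point_ind a (x + u) = 1"
      using point_ind_coset[OF sU] 2(2) UH by blast
    have "c (x + u) = \<beta>1 - point_ind a (x + u)" if u: "u \<in> U" for u
    proof -
      have "x + u \<notin> H"
      proof
        assume "x + u \<in> H"
        then have "x + u - u \<in> U" using u UH by (intro fvec.subspace_diff[OF sU]) auto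
        then show False using x(2) by simp
      qed
      then show ?thesis using 2(3)[OF x(1)[OF u]] by simp
    qed
    then show ?thesis using e bnd unfolding \<beta>1_def[symmetric]
      by (intro bexI[of _ \<beta>1] exI[of _ e]) auto
  next
    case (3 a)
    then have "density TYPE('a) k = point_ind a u0" using cu0 u0 UX by (metis subsetD)
    then show ?thesis using bnd point_ind_values[of a u0] by auto
  next
    case (4 H a)
    then have "density TYPE('a) k = (if u0 \<in> H then 0 else \<beta>1) - point_ind a u0"
      using cu0 u0 UX by (metis subsetD)
    then show ?thesis using bnd point_ind_values[of a u0] by (auto split: if_splits)
  qed
qed

text \<open>
  The classification on one hyperplane \<open>W\<close> of \<open>V\<close> provides a subspace \<open>U\<close> of codimension two on which \<open>c\<close>
  vanishes, up to complement. The subspaces spanned by \<open>U\<close> and a further vector are again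
  hyperplanes of \<open>V\<close>, and the classification on them describes the cosets of \<open>U\<close>.
\<close>

lemma weight_trivial_Suc:
  fixes V :: "'a::{field,finite} vec set"
  assumes k: "k \<ge> 2" "k + 1 \<le> n" and V: "fvec.subspace V" "finite V" "card V = CARD('a) ^ (n + 1)"
    and IH: "\<And>W. fvec.subspace W \<Longrightarrow> W \<subseteq> V \<Longrightarrow> card W = CARD('a) ^ n \<Longrightarrow> weight_trivial k W"
  shows "weight_trivial k V"
proof -
  have q2: "CARD('a) \<ge> 2" by (rule card_field_ge_2)
  obtain W where W: "fvec.subspace W" "W \<subseteq> V" "card W = CARD('a) ^ n"
    using exists_subspace[OF V(1,2), of n] V(3) by auto
  have "CARD('a) ^ 1 \<le> CARD('a) ^ n" using q2 k by (intro power_increasing) auto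
  then have W2: "card W \<ge> 2" using W(3) q2 by simp
  have main: "std_weight k V c" if c: "boolean_weight k V c" and s: "std_weight k W c" for c
  proof -
    obtain U where U: "hyperplane U W" "\<And>u. u \<in> U \<Longrightarrow> c u = 0"
      using std_weight_zero_hyperplane[OF W(1) W2 s] by blast
    have sU: "fvec.subspace U" and UW: "U \<subseteq> W" and cU: "CARD('a) * card U = CARD('a) ^ n"
      using U(1) W(3) by (auto simp: hyperplane_def)
    obtain n' where n': "n = Suc n'" "k \<le> n'" using k by (cases n) auto
    have cU': "card U = CARD('a) ^ n'" using cU n' q2 by simp
    have kU: "CARD('a) ^ k \<le> card U" unfolding cU' using n' q2 by (intro power_increasing) auto
    have "CARD('a) ^ 1 \<le> CARD('a) ^ k" using q2 k by (intro power_increasing) auto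
    then have U2: "card U \<ge> 2" using kU q2 by simp
    show ?thesis
    proof (rule weight_gluing[OF V(1,2) k(1) c sU _ U(2) kU])
      show "U \<subseteq> V" using UW W by blast
      fix x assume x: "x \<in> V" "x \<notin> U"
      have XV: "adjoin U x \<subseteq> V" using V UW W x by (intro adjoin_subset) auto
      have cX: "card (adjoin U x) = CARD('a) ^ n" using card_adjoin[OF sU x(2)] cU by simp
      have sX: "fvec.subspace (adjoin U x)" using sU by (rule subspace_adjoin)
      have "classified k (adjoin U x) c"
        using IH[OF sX XV cX] boolean_weight_mono[OF c XV] unfolding weight_trivial_def by blast
      moreover have "hyperplane U (adjoin U x)"
        using sU subset_adjoin[of U x] card_adjoin[OF sU x(2)] by (simp add: hyperplane_def)
      moreover have "x + u \<in> adjoin U x" if "u \<in> U" for u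
        using adjoinI[OF that, of 1 x] by (simp add: add.commute)
      ultimately show "\<exists>\<beta>\<in>{0, 1 / real CARD('a) ^ (k - 1)}. \<exists>e. \<forall>u\<in>U.
          c (x + u) = \<beta> \<or> u = e \<and> c (x + u) = (if \<beta> = 0 then 1 else \<beta> - 1)"
        using k(1) U2 U(2) x(2) finite_subset[OF XV V(2)] by (intro classified_coset[of k "adjoin U x"])
    qed
  qed
  show ?thesis unfolding weight_trivial_def
  proof (intro allI impI)
    fix c assume c: "boolean_weight k V c"
    have "classified k W c"
      using IH[OF W] boolean_weight_mono[OF c W(2)] unfolding weight_trivial_def by blast
    then show "classified k V c"
      using main[OF c] main[OF boolean_weight_compl[OF c]] k unfolding classified_def by auto
  qed
qed

section \<open>Transport to isomorphic subspaces\<close>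

lemma emb_onto_subspace:
  fixes W :: "'a::{field,finite} vec set"
  assumes "fvec.subspace W" "W \<subseteq> coord_space N" "card W = CARD('a) ^ m"
  shows "\<exists>\<phi>. emb m N \<phi> \<and> \<phi> ` coord_space m = W"
  using assms
proof (induction m arbitrary: W)
  case 0
  then have "card W = 1" by simp
  then have W: "W = {0}" using fvec.subspace_0[OF 0(1)] by (auto simp: card_1_singleton_iff)
  have "emb 0 N (\<lambda>z. z)" by (rule emb_mono[OF emb_id]) auto
  then show ?case using W by (intro exI[of _ "\<lambda>z. z"]) (simp only: coord_space_0 image_ident)
next
  case (Suc m)
  have fin: "finite W" using Suc.prems finite_sub_coord by blast
  obtain W' where W': "fvec.subspace W'" "W' \<subseteq> W" "card W' = CARD('a) ^ m"
    using exists_subspace[OF Suc.prems(1) fin, of m] Suc.prems(3) card_field_ge_2[where 'a='a] by auto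
  then have hyp: "hyperplane W' W" using Suc.prems(3) by (simp add: hyperplane_def)
  have "W' \<noteq> W" using W'(3) Suc.prems(3) card_field_ge_2[where 'a='a] by auto
  then obtain x where x: "x \<in> W" "x \<notin> W'" using W'(2) by blast
  have Wext: "W = adjoin W' x" using hyperplane_adjoin[OF hyp Suc.prems(1) fin x] by simp
  obtain \<phi> where \<phi>: "emb m N \<phi>" "\<phi> ` coord_space m = W'"
    using Suc.IH[OF W'(1) _ W'(3)] W' Suc.prems by blast
  define tr where "tr v = (\<lambda>i. if i < m then v i else (0 :: 'a))" for v
  define \<psi> where "\<psi> v = \<phi> (tr v) + v m \<odot> x" for v
  have trm: "tr v \<in> coord_space m" for v by (simp add: tr_def coord_space_def)
  have "lin tr" by (intro linI) (auto simp: tr_def vec_scale_def)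
  then have l1: "lin (\<lambda>v. \<phi> (tr v))" using emb_lin[OF \<phi>(1)] by (rule lin_comp)
  have l2: "lin (\<lambda>v. v m \<odot> x)"
    by (intro linI) (auto simp: vec_scale_def algebra_simps)
  have lin: "lin \<psi>" unfolding \<psi>_def using l1 l2 by (rule lin_plus)
  have xN: "x \<in> coord_space N" using x Suc.prems by blast
  have "\<psi> z \<in> coord_space N" for z
    unfolding \<psi>_def using emb_mem[OF \<phi>(1) trm] xN by (intro coord_add coord_scale)
  moreover have "z = 0" if z: "z \<in> coord_space (Suc m)" "\<psi> z = 0" for z
  proof -
    have tz: "\<phi> (tr z) \<in> W'" using \<phi>(2) trm by blast
    have eq: "\<phi> (tr z) + z m \<odot> x = 0" using z(2) by (simp add: \<psi>_def)
    have zm: "z m = 0"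
    proof (rule ccontr)
      assume "z m \<noteq> 0"
      have "z m \<odot> x = - \<phi> (tr z)" using eq by (simp add: eq_neg_iff_add_eq_0 add.commute)
      then have "z m \<odot> x \<in> W'" using fvec.subspace_neg[OF W'(1) tz] by simp
      then have "inverse (z m) \<odot> z m \<odot> x \<in> W'" by (rule fvec.subspace_scale[OF W'(1)])
      then show False using \<open>z m \<noteq> 0\<close> x(2) by simp
    qed
    then have "\<phi> (tr z) = 0" using eq by simp
    then have tz0: "tr z = 0" using emb_ker[OF \<phi>(1) trm] by simp
    show "z = 0"
    proof
      fix i
      show "z i = 0 i"
        using fun_cong[OF tz0, of i] zm z(1) by (cases "i < m"; cases "i = m") (auto simp: tr_def coord_space_def)
    qed
  qed
  ultimately have emb: "emb (Suc m) N \<psi>" using lin by (simp add: emb_def)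
  have "\<psi> ` coord_space (Suc m) \<subseteq> W"
  proof (rule image_subsetI)
    fix z
    have "\<phi> (tr z) \<in> W'" using \<phi>(2) trm by blast
    then show "\<psi> z \<in> W" unfolding Wext \<psi>_def by (rule adjoinI)
  qed
  moreover have "card (\<psi> ` coord_space (Suc m)) = card W"
    using card_image[OF emb_inj_on[OF emb]] Suc.prems(3) by (simp add: card_coord_space)
  ultimately have "\<psi> ` coord_space (Suc m) = W" using fin by (intro card_subset_eq)
  then show ?case using emb by blast
qed

lemma subspace_image_lin:
  assumes "lin \<phi>" "fvec.subspace K"
  shows "fvec.subspace (\<phi> ` K)"
proof (rule fvec.subspaceI)
  show "0 \<in> \<phi> ` K" using fvec.subspace_0[OF assms(2)] lin_0[OF assms(1)] by force
next
  fix u v assume "u \<in> \<phi> ` K" "v \<in> \<phi> ` K"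
  then obtain x y where "x \<in> K" "y \<in> K" "u = \<phi> x" "v = \<phi> y" by blast
  then have "u + v = \<phi> (x + y)" "x + y \<in> K"
    using lin_add[OF assms(1), of x y] fvec.subspace_add[OF assms(2), of x y] by simp_all
  then show "u + v \<in> \<phi> ` K" by blast
next
  fix t u assume "u \<in> \<phi> ` K"
  then obtain x where "x \<in> K" "u = \<phi> x" by blast
  then have "t \<odot> u = \<phi> (t \<odot> x)" "t \<odot> x \<in> K"
    using lin_scale[OF assms(1), of t x] fvec.subspace_scale[OF assms(2), of x t] by simp_all
  then show "t \<odot> u \<in> \<phi> ` K" by blast
qed

lemma weight_trivial_transport:
  fixes W :: "'a::{field,finite} vec set"
  assumes triv: "weight_trivial k (coord_space m :: 'a vec set)"
    and W: "fvec.subspace W" "W \<subseteq> coord_space N" "card W = CARD('a) ^ m"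
  shows "weight_trivial k W"
proof -
  obtain \<phi> where \<phi>: "emb m N \<phi>" and img: "\<phi> ` coord_space m = W"
    using emb_onto_subspace[OF W] by blast
  have inj: "inj_on \<phi> (coord_space m)" and lin: "lin \<phi>" using emb_inj_on[OF \<phi>] emb_lin[OF \<phi>] by auto
  have point_eq: "point_ind (\<phi> a) (\<phi> v) = point_ind a v" if "a \<in> coord_space m" "v \<in> coord_space m" for a v
  proof -
    have "(\<phi> v = t \<odot> \<phi> a) = (v = t \<odot> a)" for t
      using inj_onD[OF inj, of v "t \<odot> a"] that coord_scale[OF that(1), of t] lin_scale[OF lin, of t a] by auto
    then have "point_ind (\<phi> a) (\<phi> v) = 1 \<longleftrightarrow> point_ind a v = 1"
      using emb_ker[OF \<phi> that(2)] unfolding point_ind_eq_1 by simp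
    then show ?thesis using point_ind_values[of a v] point_ind_values[of "\<phi> a" "\<phi> v"] by auto
  qed
  have std: "std_weight k W c" if "std_weight k (coord_space m) (\<lambda>v. c (\<phi> v))" for c
    using that
  proof (cases rule: std_weightE)
    case (point a)
    then show ?thesis using point_eq img by (intro std_weight_pointI[of "\<phi> a"]) auto
  next
    case (hyper H a)
    note H = hyper(1) and a = hyper(2)
    have Hm: "H \<subseteq> coord_space m" "fvec.subspace H" using H by (auto simp: hyperplane_def)
    have mem: "\<phi> v \<in> \<phi> ` H \<longleftrightarrow> v \<in> H" if "v \<in> coord_space m" for v
      using inj that Hm(1) by (rule inj_on_image_mem_iff)
    have "card (\<phi> ` H) = card H" using inj_on_subset[OF inj Hm(1)] by (rule card_image)
    then have "hyperplane (\<phi> ` H) W"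
      using H subspace_image_lin[OF lin Hm(2)] Hm(1) card_image[OF inj]
      unfolding img[symmetric] by (auto simp: hyperplane_def)
    moreover have "\<phi> a \<in> W" using a img by blast
    moreover have "\<phi> a = 0 \<or> \<phi> a \<notin> \<phi> ` H" using hyper(3) mem[OF a] lin_0[OF lin] by auto
    moreover have "c v = hyp_weight k (\<phi> ` H) (\<phi> a) v" if v: "v \<in> W" for v
    proof -
      obtain z where z: "z \<in> coord_space m" "v = \<phi> z" using v img by blast
      show ?thesis using hyper(4)[OF z(1)] point_eq[OF a z(1)] mem[OF z(1)] by (simp add: z(2) hyp_weight_def)
    qed
    ultimately show ?thesis by (rule std_weight_hyperI)
  qed
  show ?thesis unfolding weight_trivial_def
  proof (intro allI impI)
    fix c assume c: "boolean_weight k W c"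
    define d where "d v = c (\<phi> v)" for v
    have wc: "weight c" using c by (simp add: boolean_weight_def)
    have "weight d"
      using wc lin_0[OF lin] lin_scale[OF lin] unfolding weight_def d_def by simp
    moreover have "wsum d K \<in> {0, 1}"
      if K: "fvec.subspace K" "K \<subseteq> coord_space m" "card K = CARD('a) ^ k" for K
    proof -
      have injK: "inj_on \<phi> K" using inj K(2) by (rule inj_on_subset)
      have "wsum c (\<phi> ` K) \<in> {0, 1}"
        using c subspace_image_lin[OF lin K(1)] K(2,3) card_image[OF injK]
        unfolding boolean_weight_def img[symmetric] by (metis image_mono)
      moreover have "wsum c (\<phi> ` K) = wsum d K"
        by (simp add: wsum_def d_def sum.reindex[OF injK])
      ultimately show ?thesis by simp
    qed
    ultimately have "boolean_weight k (coord_space m) d" unfolding boolean_weight_def by blast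
    then have "classified k (coord_space m) d" using triv unfolding weight_trivial_def by blast
    moreover have "std_weight k (coord_space m) (\<lambda>v. compl_weight k c (\<phi> v))"
      if "std_weight k (coord_space m) (compl_weight k d)"
    proof -
      have "compl_weight k d v = compl_weight k c (\<phi> v)" if "v \<in> coord_space m" for v
        using emb_ker[OF \<phi> that] by (simp add: compl_weight_def d_def)
      then show ?thesis using that unfolding std_weight_def by simp
    qed
    ultimately show "classified k W c"
      using std[of c] std[of "compl_weight k c"] unfolding classified_def d_def by blast
  qed
qed

section \<open>Lines in spaces of large dimension\<close>

lemma boolean_weight_line:
  fixes c :: "'a::{field,finite} vec \<Rightarrow> real"
  assumes c: "boolean_weight 2 V c" and V: "fvec.subspace V" and xy: "x \<in> V" "y \<in> V" "y \<noteq> 0"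
    and indep: "\<And>t. x \<noteq> t \<odot> y"
  shows "c y + (\<Sum>t\<in>UNIV. c (x + t \<odot> y)) \<in> {0, 1}"
proof -
  have wc: "weight c" using c by (simp add: boolean_weight_def)
  have y0: "y \<notin> {0}" using xy by simp
  have x0: "x \<notin> adjoin {0} y" using indep by (auto simp: adjoin_def)
  have sub: "fvec.subspace (adjoin (adjoin {0} y) x)" by (intro subspace_adjoin subspace_zero_set)
  have "adjoin (adjoin {0} y) x \<subseteq> V"
    using V xy fvec.subspace_0[OF V] by (intro adjoin_subset) auto
  moreover have "card (adjoin (adjoin {0} y) x) = CARD('a) ^ 2"
    by (simp add: card_adjoin[OF subspace_adjoin[OF subspace_zero_set] x0] card_adjoin[OF subspace_zero_set y0]
        power2_eq_square)
  ultimately have "wsum c (adjoin (adjoin {0} y) x) \<in> {0, 1}"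
    using c sub unfolding boolean_weight_def by blast
  then show ?thesis
    using wsum_adjoin2[OF subspace_zero_set y0 x0 wc] by (simp add: wsum_zero[OF wc] add.commute)
qed

lemma sum_01_is_nat:
  fixes f :: "'i \<Rightarrow> real"
  assumes "finite I" "\<And>i. i \<in> I \<Longrightarrow> f i \<in> {0, 1}"
  shows "\<exists>j\<le>card I. sum f I = real j"
proof -
  have "sum f I = (\<Sum>i\<in>I. if f i = 1 then 1 else 0)"
    using assms(2) by (intro sum.cong) auto
  also have "\<dots> = real (card {i\<in>I. f i = 1})"
    using assms(1) by (simp add: sum.inter_filter[symmetric])
  finally have "sum f I = real (card {i\<in>I. f i = 1})" .
  then show ?thesis using assms(1) by (intro exI[of _ "card {i\<in>I. f i = 1}"]) (auto intro: card_mono)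
qed

text \<open>
  A finite set containing all values at nonzero vectors of the Boolean weights on lines in spaces of
  dimension at least three. What matters is that it depends on the field only.
\<close>

definition weight_values :: "'a::{field,finite} itself \<Rightarrow> real set" where
  "weight_values _ = (\<lambda>(i, j, b). (real i - (real j - real CARD('a) * real b) / (real CARD('a) + 1)) / real CARD('a))
     ` ({..CARD('a)} \<times> {..CARD('a) * (CARD('a) + 1)} \<times> {..1})"

lemma finite_weight_values: "finite (weight_values TYPE('a::{field,finite}))"
  by (simp add: weight_values_def)

text \<open>
  In the affine plane \<open>u + \<langle>v, w\<rangle>\<close>, with sum of weights \<open>SA\<close>, the sum of the line sums in direction \<open>z\<close> is
  \<open>q * c z + SA\<close>, an integer between \<open>0\<close> and \<open>q\<close>. Adding this over the \<open>q + 1\<close> directions, whose weights add up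
  to the line sum of \<open>\<langle>v, w\<rangle>\<close>, determines \<open>SA\<close> and then \<open>c w\<close>.
\<close>

lemma boolean_weight_values:
  fixes c :: "'a::{field,finite} vec \<Rightarrow> real"
  assumes c: "boolean_weight 2 V c" and V: "fvec.subspace V" "finite V" "CARD('a) ^ 3 \<le> card V"
    and w: "w \<in> V" "w \<noteq> 0"
  shows "c w \<in> weight_values TYPE('a)"
proof -
  define q where "q = real CARD('a)"
  have q2: "q \<ge> 2" "CARD('a) \<ge> 2" using card_field_ge_2[where 'a='a] by (simp_all add: q_def)
  define A where "A = adjoin {0} w"
  have A: "fvec.subspace A" "A \<subseteq> V" "card A = CARD('a)"
    using w fvec.subspace_0[OF V(1)] card_adjoin[OF subspace_zero_set, of w]
      adjoin_subset[OF V(1), of "{0}" w] subspace_adjoin[OF subspace_zero_set, of w]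
    by (simp_all add: A_def)
  have "CARD('a) ^ 1 < CARD('a) ^ 3" "CARD('a) ^ 2 < CARD('a) ^ 3"
    using q2 by (intro power_strict_increasing; simp)+
  then have small: "CARD('a) < card V" "CARD('a) * CARD('a) < card V"
    using V(3) by (auto simp: power2_eq_square)
  have "\<not> V \<subseteq> A" using small(1) A(3) card_mono[of A V] A(2) V(2) finite_subset by fastforce
  then obtain v where v: "v \<in> V" "v \<notin> A" by blast
  define P where "P = adjoin A v"
  have P: "fvec.subspace P" "P \<subseteq> V" "card P = CARD('a) * CARD('a)"
    using A(3) card_adjoin[OF A(1) v(2)] adjoin_subset[OF V(1) A(2) v(1)] subspace_adjoin[OF A(1), of v]
    by (simp_all add: P_def)
  have "\<not> V \<subseteq> P" using small(2) P(3) card_mono[of P V] P(2) V(2) finite_subset by fastforce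
  then obtain u where u: "u \<in> V" "u \<notin> P" by blast
  have wP: "w \<in> P" "v \<in> P"
  proof -
    have "w \<in> A" unfolding A_def by (rule adjoin_self) simp
    then show "w \<in> P" using subset_adjoin[of A v] unfolding P_def by blast
    show "v \<in> P" unfolding P_def using A(1) by (intro adjoin_self fvec.subspace_0)
  qed
  have nP: "u + z \<notin> P" if "z \<in> P" for z
  proof
    assume "u + z \<in> P"
    then have "u + z - z \<in> P" using that by (rule fvec.subspace_diff[OF P(1)])
    then show False using u by simp
  qed
  have vw: "v \<noteq> t \<odot> w" for t
  proof
    assume "v = t \<odot> w"
    then have "v = 0 + t \<odot> w" by simp
    then show False using v(2) adjoinI[of 0 "{0}" t w] by (simp add: A_def)
  qed
  have combP: "s \<odot> v + t \<odot> w \<in> P" for s t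
    using wP P(1) by (intro fvec.subspace_add fvec.subspace_scale)
  have PV: "z \<in> V" if "z \<in> P" for z using that P(2) by blast
  have uV: "u + z \<in> V" if "z \<in> P" for z using u(1) PV[OF that] V(1) by (intro fvec.subspace_add)
  define SA where "SA = (\<Sum>s\<in>UNIV. \<Sum>t\<in>UNIV. c (u + s \<odot> v + t \<odot> w))"
  have line: "c y + (\<Sum>t\<in>UNIV. c (u + z + t \<odot> y)) \<in> {0, 1}" if "z \<in> P" "y \<in> P" "y \<noteq> 0" for z y
  proof (rule boolean_weight_line[OF c V(1) uV[OF that(1)] PV[OF that(2)] that(3)])
    show "u + z \<noteq> t \<odot> y" for t
      using nP[OF that(1)] fvec.subspace_scale[OF P(1) that(2), of t] by auto
  qed
  obtain i where i: "i \<le> CARD('a)" "q * c w + SA = real i"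
  proof -
    have L: "c w + (\<Sum>t\<in>UNIV. c (u + s \<odot> v + t \<odot> w)) \<in> {0, 1}" for s
      using wP w(2) P(1) by (intro line fvec.subspace_scale) auto
    have "\<exists>i\<le>CARD('a). (\<Sum>s\<in>UNIV. c w + (\<Sum>t\<in>UNIV. c (u + s \<odot> v + t \<odot> w))) = real i"
      by (rule sum_01_is_nat[OF finite_class.finite_UNIV L])
    moreover have "(\<Sum>s\<in>UNIV. c w + (\<Sum>t\<in>UNIV. c (u + s \<odot> v + t \<odot> w))) = q * c w + SA"
      by (simp add: sum.distrib SA_def q_def)
    ultimately show ?thesis using that by metis
  qed
  have dir: "\<exists>j\<le>CARD('a). q * c (v + r \<odot> w) + SA = real j" for r
  proof -
    have "v + r \<odot> w \<noteq> 0"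
    proof
      assume "v + r \<odot> w = 0"
      then have "v = (- r) \<odot> w" by (simp add: eq_neg_iff_add_eq_0)
      then show False using vw by blast
    qed
    then have L: "c (v + r \<odot> w) + (\<Sum>t\<in>UNIV. c (u + s \<odot> w + t \<odot> (v + r \<odot> w))) \<in> {0, 1}" for s
      using wP P(1) combP[of 1 r] by (intro line fvec.subspace_scale) auto
    have j: "\<exists>j\<le>CARD('a).
        (\<Sum>s\<in>UNIV. c (v + r \<odot> w) + (\<Sum>t\<in>UNIV. c (u + s \<odot> w + t \<odot> (v + r \<odot> w)))) = real j"
      by (rule sum_01_is_nat[OF finite_class.finite_UNIV L])
    have "(\<Sum>s\<in>UNIV. \<Sum>t\<in>UNIV. c (u + s \<odot> w + t \<odot> (v + r \<odot> w)))
        = (\<Sum>t\<in>UNIV. \<Sum>s\<in>UNIV. c (u + s \<odot> w + t \<odot> (v + r \<odot> w)))"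
      by (rule sum.swap)
    also have "\<dots> = SA" unfolding SA_def
    proof (rule sum.cong[OF refl])
      fix t :: 'a
      have "u + s \<odot> w + t \<odot> (v + r \<odot> w) = u + t \<odot> v + (s + t * r) \<odot> w" for s
        by (simp add: fvec.scale_right_distrib fvec.scale_left_distrib add_ac)
      then have "(\<Sum>s\<in>UNIV. c (u + s \<odot> w + t \<odot> (v + r \<odot> w)))
        = (\<Sum>s\<in>UNIV. c (u + t \<odot> v + (s + t * r) \<odot> w))" by (simp only:)
      also have "\<dots> = (\<Sum>s\<in>UNIV. c (u + t \<odot> v + s \<odot> w))"
        by (rule sum.reindex_bij_witness[of _ "\<lambda>s. s - t * r" "\<lambda>s. s + t * r"]) auto
      finally show "(\<Sum>s\<in>UNIV. c (u + s \<odot> w + t \<odot> (v + r \<odot> w))) = (\<Sum>s\<in>UNIV. c (u + t \<odot> v + s \<odot> w))" .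
    qed
    finally show ?thesis using j by (simp add: sum.distrib q_def)
  qed
  then obtain j where j: "\<And>r. j r \<le> CARD('a)" "\<And>r. q * c (v + r \<odot> w) + SA = real (j r)" by metis
  define J where "J = i + (\<Sum>r\<in>UNIV. j r)"
  have J: "J \<le> CARD('a) * (CARD('a) + 1)"
    using i(1) sum_bounded_above[of "UNIV :: 'a set" j "CARD('a)"] j(1) by (simp add: J_def)
  have "c w + (\<Sum>t\<in>UNIV. c (v + t \<odot> w)) \<in> {0, 1}"
    by (rule boolean_weight_line[OF c V(1) v(1) w vw])
  then obtain b :: nat where b: "b \<le> 1" "c w + (\<Sum>t\<in>UNIV. c (v + t \<odot> w)) = real b"
    by (metis insert_iff of_nat_0 of_nat_1 order_refl singletonD zero_le_one)
  have "(\<Sum>r\<in>UNIV. q * c (v + r \<odot> w) + SA) = (\<Sum>r\<in>UNIV. real (j r))" using j(2) by simp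
  then have "real J = (q * c w + SA) + (q * (\<Sum>r\<in>UNIV. c (v + r \<odot> w)) + q * SA)"
    using i(2) by (simp add: J_def sum.distrib sum_distrib_left q_def)
  also have "\<dots> = q * (c w + (\<Sum>r\<in>UNIV. c (v + r \<odot> w))) + (q + 1) * SA" by (simp add: algebra_simps)
  finally have "SA = (real J - q * real b) / (q + 1)" using q2 b(2) by (simp add: field_simps)
  moreover have "c w = (real i - SA) / q" using i(2) q2 by (simp add: field_simps)
  ultimately have "c w = (\<lambda>(i, j, b). (real i - (real j - q * real b) / (q + 1)) / q) (i, J, b)" by simp
  then show ?thesis
    unfolding weight_values_def q_def[symmetric] using i(1) J b(1) by (intro image_eqI) auto
qed

text \<open>
  The chart \<open>z \<mapsto> unit_vec n + z\<close> embeds affine space into the set of points, so that Ramsey yields a flat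
  \<open>x + \<phi> F\<^sup>d\<close> with \<open>x\<close> outside \<open>\<phi> F\<^sup>d\<close> on which \<open>g\<close> is constant.
\<close>

lemma constant_affine_chart:
  "\<exists>N. \<forall>m\<ge>N. \<forall>g :: 'a::{field,finite} vec \<Rightarrow> real.
     (\<forall>z\<in>coord_space m. z \<noteq> 0 \<longrightarrow> g z \<in> weight_values TYPE('a)) \<longrightarrow>
     (\<exists>x\<in>coord_space m. \<exists>\<phi>. emb d m \<phi> \<and>
       (\<forall>z\<in>coord_space d. \<forall>t. x \<noteq> t \<odot> \<phi> z) \<and> (\<forall>z\<in>coord_space d. g (x + \<phi> z) = g x))"
proof -
  obtain N where N: "\<forall>n\<ge>N. \<forall>(\<chi> :: 'a vec \<Rightarrow> real) C.
     finite C \<and> card C \<le> card (weight_values TYPE('a)) \<and> \<chi> ` coord_space n \<subseteq> C \<longrightarrow>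
     (\<exists>b\<in>coord_space n. \<exists>\<phi>. emb d n \<phi> \<and> (\<forall>z\<in>coord_space d. \<chi> (b + \<phi> z) = \<chi> b))"
    using mono_flat_exists[where d=d and r="card (weight_values TYPE('a))" and 'a='a and 'c=real] ..
  show ?thesis
  proof (intro exI[of _ "Suc N"] allI impI)
    fix m and g :: "'a vec \<Rightarrow> real"
    assume m: "Suc N \<le> m" and g: "\<forall>z\<in>coord_space m. z \<noteq> 0 \<longrightarrow> g z \<in> weight_values TYPE('a)"
    obtain n where n: "m = Suc n" "N \<le> n" using m by (cases m) auto
    let ?e = "unit_vec n :: 'a vec"
    have nm: "coord_space n \<subseteq> (coord_space m :: 'a vec set)" using n by (intro coord_space_mono) simp
    have e: "?e \<in> coord_space m" using n by (intro unit_vec_mem) simp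
    have notn: "?e + z \<notin> coord_space n" if "z \<in> coord_space n" for z
      using that unit_vec_notin[of n] coord_diff[of "?e + z" n z] by auto
    have "(\<lambda>z. g (?e + z)) ` coord_space n \<subseteq> weight_values TYPE('a)"
    proof (rule image_subsetI)
      fix z :: "'a vec" assume z: "z \<in> coord_space n"
      then have "?e + z \<in> coord_space m" using e nm by (blast intro: coord_add)
      moreover have "?e + z \<noteq> 0" using notn[OF z] coord_0[of n] by metis
      ultimately show "g (?e + z) \<in> weight_values TYPE('a)" using g by blast
    qed
    then obtain b \<phi> where b: "b \<in> coord_space n" and \<phi>: "emb d n \<phi>"
      and eq: "\<And>z. z \<in> coord_space d \<Longrightarrow> g (?e + (b + \<phi> z)) = g (?e + b)"
      using N[rule_format, OF n(2), of "weight_values TYPE('a)" "\<lambda>z. g (?e + z)"] finite_weight_values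
      by blast
    have "?e + b \<in> coord_space m" using e b nm by (blast intro: coord_add)
    moreover have "emb d m \<phi>" using n by (intro emb_mono[OF \<phi>]) auto
    moreover have "?e + b \<noteq> t \<odot> \<phi> z" if "z \<in> coord_space d" for z t
      using notn[OF b] coord_scale[OF emb_mem[OF \<phi> that], of t] by metis
    moreover have "g (?e + b + \<phi> z) = g (?e + b)" if "z \<in> coord_space d" for z
      using eq[OF that] by (simp add: add.assoc)
    ultimately show "\<exists>x\<in>coord_space m. \<exists>\<phi>. emb d m \<phi> \<and>
       (\<forall>z\<in>coord_space d. \<forall>t. x \<noteq> t \<odot> \<phi> z) \<and> (\<forall>z\<in>coord_space d. g (x + \<phi> z) = g x)"
      by blast
  qed
qed

lemma emb_shift: "emb d (n + d) (shift n :: 'a::field vec \<Rightarrow> 'a vec)"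
proof -
  have "lin (\<lambda>_::'a vec. 0 :: 'a vec)" by (intro linI) auto
  from emb_add_shift[OF this coord_0 emb_id] have "emb d (n + d) (\<lambda>z :: 'a vec. 0 + shift n z)" .
  then show ?thesis by simp
qed

text \<open>
  If a Boolean weight takes only the values \<open>0\<close> and \<open>1\<close> on a subspace, then the value \<open>1\<close> occurs at one
  point at most, and one of two complementary subspaces avoids this point.
\<close>

lemma zero_subspace_of_01:
  fixes h :: "'a::{field,finite} vec \<Rightarrow> real"
  assumes h: "boolean_weight 2 (coord_space n) h" and \<phi>: "emb (d + d) n \<phi>"
    and h01: "\<And>z. z \<in> coord_space (d + d) \<Longrightarrow> h (\<phi> z) = 0 \<or> h (\<phi> z) = 1"
  shows "\<exists>\<psi>. emb d n \<psi> \<and> (\<forall>z\<in>coord_space d. h (\<psi> z) = 0)"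
proof (cases "\<forall>z\<in>coord_space d. h (\<phi> z) = 0")
  case True
  then show ?thesis using emb_mono[OF \<phi>, of d n] by (intro exI[of _ \<phi>]) simp
next
  case False
  have sub: "coord_space d \<subseteq> (coord_space (d + d) :: 'a vec set)" by (rule coord_space_mono) simp
  obtain x where x: "x \<in> coord_space d" "h (\<phi> x) \<noteq> 0" using False by blast
  have wh: "weight h" using h by (simp add: boolean_weight_def)
  have xd: "x \<in> coord_space (d + d)" and hx: "h (\<phi> x) = 1" using x sub h01 by blast+
  note lin = emb_lin[OF \<phi>]
  have x0: "\<phi> x \<noteq> 0" using hx weight_0[OF wh] by auto
  have "h (\<phi> (shift d z)) = 0" if z: "z \<in> coord_space d" for z
  proof (rule ccontr)
    assume "h (\<phi> (shift d z)) \<noteq> 0"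
    have sz: "shift d z \<in> coord_space (d + d)" using shift_mem[OF z] .
    then have hz: "h (\<phi> (shift d z)) = 1" using h01 \<open>h (\<phi> (shift d z)) \<noteq> 0\<close> by blast
    have ind: "\<phi> (shift d z) \<noteq> t \<odot> \<phi> x" for t
    proof
      assume "\<phi> (shift d z) = t \<odot> \<phi> x"
      then have "\<phi> (shift d z) = \<phi> (t \<odot> x)" using lin_scale[OF lin, of t x] by simp
      then have eq: "shift d z = t \<odot> x"
        using inj_onD[OF emb_inj_on[OF \<phi>]] sz coord_scale[OF xd] by blast
      have "(- t) \<odot> x + shift d z = 0" unfolding eq by simp
      then have "z = 0" using add_shift_eq_0[OF coord_scale[OF x(1)]] by blast
      then have "h (\<phi> (shift d z)) = 0"
        using lin_0[OF lin] weight_0[OF wh] lin_0[OF lin_shift[of d], where 'a='a] by simp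
      then show False using hz by simp
    qed
    have line: "h (\<phi> x) + (\<Sum>t\<in>UNIV. h (\<phi> (shift d z) + t \<odot> \<phi> x)) \<in> {0, 1}"
      using boolean_weight_line[OF h subspace_coord_space emb_mem[OF \<phi> sz] emb_mem[OF \<phi> xd] x0 ind] .
    have pos: "h (\<phi> (shift d z) + t \<odot> \<phi> x) \<ge> 0" for t
      using h01[OF coord_add[OF sz coord_scale[OF xd]], of t]
      by (auto simp: lin_add[OF lin] lin_scale[OF lin])
    have "h (\<phi> (shift d z) + 0 \<odot> \<phi> x) \<le> (\<Sum>t\<in>UNIV. h (\<phi> (shift d z) + t \<odot> \<phi> x))"
      using pos by (intro member_le_sum) auto
    then show False using line hx hz by auto
  qed
  then show ?thesis using emb_comp[OF emb_shift \<phi>] by blast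
qed

lemma density_2: "density TYPE('a::{field,finite}) 2 = 1 / (real CARD('a) + 1)"
proof -
  define q where "q = real CARD('a)"
  have "q \<ge> 2" using card_field_ge_2[where 'a='a] by (simp add: q_def)
  moreover have "q ^ 2 - 1 = (q - 1) * (q + 1)" by (simp add: power2_eq_square algebra_simps)
  ultimately have "(q - 1) / (q ^ 2 - 1) = 1 / (q + 1)" by simp
  then show ?thesis by (simp add: density_def q_def)
qed

text \<open>
  If \<open>c\<close> has the constant value \<open>v\<close> on a flat, then the lines joining the flat to its directions leave only
  the values \<open>- q * v\<close> and \<open>1 - q * v\<close> on the direction space. A constant flat inside this direction
  space restricts the values in the same way once more. The two restrictions leave a single value, or
  the values \<open>{0, 1}\<close> for \<open>c\<close> or for its complement.
\<close>

lemma zero_subspace_exists: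
  "\<exists>N. \<forall>n\<ge>N. \<forall>c :: 'a::{field,finite} vec \<Rightarrow> real. boolean_weight 2 (coord_space n) c \<longrightarrow>
     (\<exists>\<psi>. emb d n \<psi> \<and> ((\<forall>z\<in>coord_space d. c (\<psi> z) = 0) \<or>
        (\<forall>z\<in>coord_space d. compl_weight 2 c (\<psi> z) = 0)))"
proof -
  define q where "q = real CARD('a)"
  have q2: "q \<ge> 2" using card_field_ge_2[where 'a='a] by (simp add: q_def)
  define D where "D = Suc (Suc d) + Suc (Suc d)"
  obtain N2 where N2: "\<forall>m\<ge>N2. \<forall>g :: 'a vec \<Rightarrow> real.
     (\<forall>z\<in>coord_space m. z \<noteq> 0 \<longrightarrow> g z \<in> weight_values TYPE('a)) \<longrightarrow>
     (\<exists>x\<in>coord_space m. \<exists>\<phi>. emb D m \<phi> \<and>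
       (\<forall>z\<in>coord_space D. \<forall>t. x \<noteq> t \<odot> \<phi> z) \<and> (\<forall>z\<in>coord_space D. g (x + \<phi> z) = g x))"
    using constant_affine_chart[where d=D and 'a='a] ..
  obtain N1 where N1: "\<forall>m\<ge>N1. \<forall>g :: 'a vec \<Rightarrow> real.
     (\<forall>z\<in>coord_space m. z \<noteq> 0 \<longrightarrow> g z \<in> weight_values TYPE('a)) \<longrightarrow>
     (\<exists>x\<in>coord_space m. \<exists>\<phi>. emb N2 m \<phi> \<and>
       (\<forall>z\<in>coord_space N2. \<forall>t. x \<noteq> t \<odot> \<phi> z) \<and> (\<forall>z\<in>coord_space N2. g (x + \<phi> z) = g x))"
    using constant_affine_chart[where d=N2 and 'a='a] ..
  show ?thesis
  proof (intro exI[of _ "N1 + 3"] allI impI)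
    fix n and c :: "'a vec \<Rightarrow> real"
    assume n: "N1 + 3 \<le> n" and c: "boolean_weight 2 (coord_space n) c"
    have wc: "weight c" using c by (simp add: boolean_weight_def)
    have big: "CARD('a) ^ 3 \<le> card (coord_space n :: 'a vec set)"
      using n card_field_ge_2[where 'a='a] unfolding card_coord_space by (intro power_increasing) auto
    have vals: "c z \<in> weight_values TYPE('a)" if "z \<in> coord_space n" "z \<noteq> 0" for z
      by (rule boolean_weight_values[OF c subspace_coord_space finite_coord_space big that])
    have line: "c y + q * v \<in> {0, 1}"
      if "x \<in> coord_space n" "y \<in> coord_space n" "y \<noteq> 0" "\<And>t. x \<noteq> t \<odot> y" "\<And>t. c (x + t \<odot> y) = v"
      for x y v
      using boolean_weight_line[OF c subspace_coord_space that(1-4)] that(5) by (simp add: q_def)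
    obtain x1 \<phi>1 where x1: "x1 \<in> coord_space n" and \<phi>1: "emb N2 n \<phi>1"
      and ind1: "\<And>z t. z \<in> coord_space N2 \<Longrightarrow> x1 \<noteq> t \<odot> \<phi>1 z"
      and const1: "\<And>z. z \<in> coord_space N2 \<Longrightarrow> c (x1 + \<phi>1 z) = c x1"
      using N1[rule_format, of n c] n vals by (metis add_leD1)
    have vals1: "\<forall>z\<in>coord_space N2. z \<noteq> 0 \<longrightarrow> c (\<phi>1 z) \<in> weight_values TYPE('a)"
      using vals emb_mem[OF \<phi>1] emb_ker[OF \<phi>1] by blast
    from N2[rule_format, OF order_refl, of "\<lambda>z. c (\<phi>1 z)"] vals1
    obtain x2 \<phi>2 where x2: "x2 \<in> coord_space N2" and \<phi>2: "emb D N2 \<phi>2"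
      and ind2: "\<And>z t. z \<in> coord_space D \<Longrightarrow> x2 \<noteq> t \<odot> \<phi>2 z"
      and const2: "\<And>z. z \<in> coord_space D \<Longrightarrow> c (\<phi>1 (x2 + \<phi>2 z)) = c (\<phi>1 x2)"
      by blast
    \<comment> \<open>The first flat leaves the values \<open>a\<close> and \<open>a + 1\<close>, the second one \<open>b\<close> and \<open>b + 1\<close>; the value on the
      second flat is itself \<open>a\<close> or \<open>a + 1\<close>, which relates \<open>b\<close> to \<open>a\<close>.\<close>
    define a where "a = - q * c x1"
    define b where "b = - q * c (\<phi>1 x2)"
    have in1: "c (\<phi>1 z) = a \<or> c (\<phi>1 z) = a + 1" if z: "z \<in> coord_space N2" "z \<noteq> 0" for z
    proof -
      have "c (\<phi>1 z) + q * c x1 \<in> {0, 1}"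
      proof (rule line[OF x1 emb_mem[OF \<phi>1 z(1)]])
        show "\<phi>1 z \<noteq> 0" using emb_ker[OF \<phi>1 z(1)] z(2) by simp
        show "x1 \<noteq> t \<odot> \<phi>1 z" for t by (rule ind1[OF z(1)])
        show "c (x1 + t \<odot> \<phi>1 z) = c x1" for t
          using const1[OF coord_scale[OF z(1)], of t] by (simp add: lin_scale[OF emb_lin[OF \<phi>1]])
      qed
      then show ?thesis by (auto simp: a_def)
    qed
    define \<phi> where "\<phi> z = \<phi>1 (\<phi>2 z)" for z
    have \<phi>: "emb D n \<phi>" unfolding \<phi>_def using \<phi>2 \<phi>1 by (rule emb_comp)
    have in2: "c (\<phi> z) = b \<or> c (\<phi> z) = b + 1" if z: "z \<in> coord_space D" "z \<noteq> 0" for z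
    proof -
      note l1 = emb_lin[OF \<phi>1] and m2 = emb_mem[OF \<phi>2]
      have "c (\<phi> z) + q * c (\<phi>1 x2) \<in> {0, 1}"
      proof (rule line[OF emb_mem[OF \<phi>1 x2] emb_mem[OF \<phi> z(1)]])
        show "\<phi> z \<noteq> 0" using emb_ker[OF \<phi> z(1)] z(2) by simp
        show "\<phi>1 x2 \<noteq> t \<odot> \<phi> z" for t
        proof
          assume "\<phi>1 x2 = t \<odot> \<phi> z"
          then have "\<phi>1 x2 = \<phi>1 (t \<odot> \<phi>2 z)" using lin_scale[OF l1, of t "\<phi>2 z"] by (simp add: \<phi>_def)
          then have "x2 = t \<odot> \<phi>2 z"
            using inj_onD[OF emb_inj_on[OF \<phi>1] _ x2 coord_scale[OF m2[OF z(1)]]] by blast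
          then show False using ind2[OF z(1)] by blast
        qed
        show "c (\<phi>1 x2 + t \<odot> \<phi> z) = c (\<phi>1 x2)" for t
          using const2[OF coord_scale[OF z(1)], of t]
          by (simp add: lin_scale[OF emb_lin[OF \<phi>2]] lin_add[OF l1] lin_scale[OF l1] \<phi>_def)
      qed
      then show ?thesis by (auto simp: b_def)
    qed
    have in1': "c (\<phi> z) = a \<or> c (\<phi> z) = a + 1" if z: "z \<in> coord_space D" "z \<noteq> 0" for z
      unfolding \<phi>_def using in1[OF emb_mem[OF \<phi>2 z(1)]] emb_ker[OF \<phi>2 z(1)] z(2) by simp
    have x20: "x2 \<noteq> 0" using ind2[OF coord_0, of 0] by auto
    have b_eq: "b = - q * a \<or> b = - q * (a + 1)"
      using in1[OF x2 x20] by (auto simp: b_def)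
    have h_case: "(\<forall>z\<in>coord_space D. c (\<phi> z) = 0 \<or> c (\<phi> z) = 1) \<or>
        (\<forall>z\<in>coord_space D. compl_weight 2 c (\<phi> z) = 0 \<or> compl_weight 2 c (\<phi> z) = 1)"
    proof (cases "a = b")
      case True
      have \<phi>0: "\<phi> 0 = 0" by (rule lin_0[OF emb_lin[OF \<phi>]])
      from b_eq show ?thesis
      proof
        assume "b = - q * a"
        then have "(1 + q) * a = 0" using True by (simp add: algebra_simps)
        then have "a = 0" using q2 by simp
        then have "c (\<phi> z) = 0 \<or> c (\<phi> z) = 1" if "z \<in> coord_space D" for z
          using in1'[OF that] \<phi>0 weight_0[OF wc] by (cases "z = 0") auto
        then show ?thesis by blast
      next
        assume "b = - q * (a + 1)"
        then have "(1 + q) * (a + 1) = 1" using True by (simp add: algebra_simps)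
        then have a1: "a + 1 = density TYPE('a) 2"
          using q2 by (simp add: density_2 q_def[symmetric] field_simps)
        have "compl_weight 2 c (\<phi> z) = 0 \<or> compl_weight 2 c (\<phi> z) = 1" if "z \<in> coord_space D" for z
          using in1'[OF that] emb_ker[OF \<phi> that] a1 by (auto simp: compl_weight_def)
        then show ?thesis by blast
      qed
    next
      case False
      \<comment> \<open>Only one value remains. The lines of the subspace then have sum \<open>(q + 1) * v\<close>.\<close>
      define v where "v = (if a = b + 1 then a else a + 1)"
      have cv: "c (\<phi> z) = v" if "z \<in> coord_space D" "z \<noteq> 0" for z
        using in1'[OF that] in2[OF that] False by (auto simp: v_def)
      let ?x = "unit_vec 0 :: 'a vec" and ?y = "unit_vec 1 :: 'a vec"
      have mem: "?x \<in> coord_space D" "?y \<in> coord_space D" by (auto simp: D_def intro!: unit_vec_mem)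
      have nz: "?x + t \<odot> ?y \<noteq> 0" for t
      proof
        assume "?x + t \<odot> ?y = 0"
        then have "(?x + t \<odot> ?y) 0 = 0" by simp
        then show False by (simp add: unit_vec_def vec_scale_def)
      qed
      note l = emb_lin[OF \<phi>]
      have "c (\<phi> ?y) + q * v \<in> {0, 1}"
      proof (rule line[OF emb_mem[OF \<phi> mem(1)] emb_mem[OF \<phi> mem(2)]])
        show "\<phi> ?y \<noteq> 0" using emb_ker[OF \<phi> mem(2)] unit_vec_nonzero[of 1, where 'a='a] by simp
        show "\<phi> ?x \<noteq> t \<odot> \<phi> ?y" for t
        proof
          assume *: "\<phi> ?x = t \<odot> \<phi> ?y"
          have "\<phi> (?x + (- t) \<odot> ?y) = 0"
            unfolding lin_add[OF l] lin_scale[OF l] * by simp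
          then show False
            using emb_ker[OF \<phi> coord_add[OF mem(1) coord_scale[OF mem(2)]], of "- t"] nz[of "- t"] by blast
        qed
        show "c (\<phi> ?x + t \<odot> \<phi> ?y) = v" for t
          using cv[OF coord_add[OF mem(1) coord_scale[OF mem(2)]] nz, of t]
          by (simp add: lin_add[OF l] lin_scale[OF l])
      qed
      then have "v + q * v = 0 \<or> v + q * v = 1"
        using cv[OF mem(2)] unit_vec_nonzero[of 1, where 'a='a] by simp
      then have "(1 + q) * v = 0 \<or> (1 + q) * v = 1" by (simp add: algebra_simps)
      moreover have "v = 0" if "(1 + q) * v = 0" using that q2 by simp
      moreover have "v = density TYPE('a) 2" if "(1 + q) * v = 1"
        using that q2 by (simp add: density_2 q_def[symmetric] field_simps)
      ultimately have v: "v = 0 \<or> v = density TYPE('a) 2" by blast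
      have \<phi>0: "\<phi> 0 = 0" by (rule lin_0[OF l])
      from v show ?thesis
      proof
        assume "v = 0"
        then have "c (\<phi> z) = 0" if "z \<in> coord_space D" for z
          using cv[OF that] \<phi>0 weight_0[OF wc] by (cases "z = 0") auto
        then show ?thesis by blast
      next
        assume "v = density TYPE('a) 2"
        then have "compl_weight 2 c (\<phi> z) = 0" if "z \<in> coord_space D" for z
          using cv[OF that] \<phi>0 by (cases "z = 0") (auto simp: compl_weight_def)
        then show ?thesis by blast
      qed
    qed
    have D': "emb (Suc (Suc d) + Suc (Suc d)) n \<phi>" using \<phi> by (simp add: D_def)
    from h_case show "\<exists>\<psi>. emb d n \<psi> \<and> ((\<forall>z\<in>coord_space d. c (\<psi> z) = 0) \<or>
        (\<forall>z\<in>coord_space d. compl_weight 2 c (\<psi> z) = 0))"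
    proof
      assume "\<forall>z\<in>coord_space D. c (\<phi> z) = 0 \<or> c (\<phi> z) = 1"
      then obtain \<psi> where \<psi>: "emb (Suc (Suc d)) n \<psi>" "\<forall>z\<in>coord_space (Suc (Suc d)). c (\<psi> z) = 0"
        using zero_subspace_of_01[OF c D'] unfolding D_def by blast
      then show ?thesis using emb_mono[OF \<psi>(1), of d n] coord_space_mono[of d "Suc (Suc d)", where 'a='a]
        by (intro exI[of _ \<psi>]) auto
    next
      assume "\<forall>z\<in>coord_space D. compl_weight 2 c (\<phi> z) = 0 \<or> compl_weight 2 c (\<phi> z) = 1"
      then obtain \<psi> where \<psi>: "emb (Suc (Suc d)) n \<psi>" "\<forall>z\<in>coord_space (Suc (Suc d)). compl_weight 2 c (\<psi> z) = 0"
        using zero_subspace_of_01[OF boolean_weight_compl[OF c] D'] unfolding D_def by auto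
      then show ?thesis using emb_mono[OF \<psi>(1), of d n] coord_space_mono[of d "Suc (Suc d)", where 'a='a]
        by (intro exI[of _ \<psi>]) auto
    qed
  qed
qed

lemma weight_trivial_2:
  "\<exists>N. \<forall>n\<ge>N. weight_trivial 2 (coord_space n :: 'a::{field,finite} vec set)"
proof -
  let ?C = "insert 0 (weight_values TYPE('a))"
  obtain M where M: "\<forall>m\<ge>M. \<forall>(g :: 'a vec \<Rightarrow> real) C.
     boolean_on_lines m g \<and> finite C \<and> card C \<le> card ?C \<and> g ` coord_space m \<subseteq> C \<longrightarrow>
     (\<exists>\<beta>\<in>{0, 1 / real CARD('a)}. \<exists>e. \<forall>z\<in>coord_space m.
        g z = \<beta> \<or> z = e \<and> g z = (if \<beta> = 0 then 1 else \<beta> - 1))"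
    using affine_classification[where 'a='a and r="card ?C"] ..
  define d where "d = M + 2"
  obtain N where N: "\<forall>n\<ge>N. \<forall>c :: 'a vec \<Rightarrow> real. boolean_weight 2 (coord_space n) c \<longrightarrow>
     (\<exists>\<psi>. emb d n \<psi> \<and> ((\<forall>z\<in>coord_space d. c (\<psi> z) = 0) \<or>
        (\<forall>z\<in>coord_space d. compl_weight 2 c (\<psi> z) = 0)))"
    using zero_subspace_exists[where 'a='a and d=d] ..
  have std: "std_weight 2 (coord_space n) c"
    if n: "N + 3 \<le> n" and c: "boolean_weight 2 (coord_space n) c" and \<psi>: "emb d n \<psi>"
      and zero: "\<And>z. z \<in> coord_space d \<Longrightarrow> c (\<psi> z) = 0" for n \<psi> and c :: "'a vec \<Rightarrow> real"
  proof -
    have wc: "weight c" using c by (simp add: boolean_weight_def)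
    have big: "CARD('a) ^ 3 \<le> card (coord_space n :: 'a vec set)"
      using n card_field_ge_2[where 'a='a] unfolding card_coord_space by (intro power_increasing) auto
    have vals: "c z \<in> ?C" if "z \<in> coord_space n" for z
      using boolean_weight_values[OF c subspace_coord_space finite_coord_space big that] weight_0[OF wc]
      by (cases "z = 0") auto
    define U where "U = \<psi> ` coord_space d"
    have sU: "fvec.subspace U" unfolding U_def
      using emb_lin[OF \<psi>] subspace_coord_space by (rule subspace_image_lin)
    have Un: "U \<subseteq> coord_space n" unfolding U_def using emb_mem[OF \<psi>] by blast
    have cU: "card U = CARD('a) ^ d"
      unfolding U_def using card_image[OF emb_inj_on[OF \<psi>]] by (simp add: card_coord_space)
    show ?thesis
    proof (rule weight_gluing[OF subspace_coord_space finite_coord_space _ c sU Un])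
      show "c u = 0" if "u \<in> U" for u using that zero by (auto simp: U_def)
      show "CARD('a) ^ 2 \<le> card U"
        unfolding cU using card_field_ge_2[where 'a='a] by (intro power_increasing) (auto simp: d_def)
      fix x :: "'a vec" assume x: "x \<in> coord_space n" "x \<notin> U"
      define g where "g z = c (x + \<psi> z)" for z
      have xz: "x + \<psi> z \<in> coord_space n" if "z \<in> coord_space d" for z
        using x(1) emb_mem[OF \<psi> that] by (rule coord_add)
      have "boolean_on_lines d g" unfolding boolean_on_lines_def
      proof (intro ballI impI)
        fix z u :: "'a vec" assume z: "z \<in> coord_space d" and u: "u \<in> coord_space d" "u \<noteq> 0"
        note l = emb_lin[OF \<psi>]
        have "x + \<psi> z \<noteq> t \<odot> \<psi> u" for t
        proof
          assume "x + \<psi> z = t \<odot> \<psi> u"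
          then have "x = \<psi> (t \<odot> u - z)" unfolding lin_diff[OF l] lin_scale[OF l] by (simp add: algebra_simps)
          then show False using x(2) z u unfolding U_def by (blast intro: coord_diff coord_scale)
        qed
        moreover have "\<psi> u \<noteq> 0" using emb_ker[OF \<psi> u(1)] u(2) by simp
        ultimately have "c (\<psi> u) + (\<Sum>t\<in>UNIV. c (x + \<psi> z + t \<odot> \<psi> u)) \<in> {0, 1}"
          using boolean_weight_line[OF c subspace_coord_space xz[OF z] emb_mem[OF \<psi> u(1)]] by blast
        moreover have "c (x + \<psi> z + t \<odot> \<psi> u) = g (z + t \<odot> u)" for t
          unfolding g_def lin_add[OF l] lin_scale[OF l] by (simp add: add.assoc)
        ultimately show "(\<Sum>t\<in>UNIV. g (z + t \<odot> u)) \<in> {0, 1}" using zero[OF u(1)] by simp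
      qed
      moreover have "g ` coord_space d \<subseteq> ?C"
        unfolding g_def using vals xz by blast
      moreover have "M \<le> d" "finite ?C" by (simp_all add: d_def finite_weight_values)
      ultimately obtain \<beta> e where \<beta>: "\<beta> \<in> {0, 1 / real CARD('a)}"
        and e: "\<And>z. z \<in> coord_space d \<Longrightarrow> g z = \<beta> \<or> z = e \<and> g z = (if \<beta> = 0 then 1 else \<beta> - 1)"
        using M[rule_format, of d g ?C] by blast
      have "\<forall>u\<in>U. c (x + u) = \<beta> \<or> u = \<psi> e \<and> c (x + u) = (if \<beta> = 0 then 1 else \<beta> - 1)"
      proof
        fix u assume "u \<in> U"
        then obtain z where z: "z \<in> coord_space d" "u = \<psi> z" unfolding U_def by blast
        show "c (x + u) = \<beta> \<or> u = \<psi> e \<and> c (x + u) = (if \<beta> = 0 then 1 else \<beta> - 1)"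
          using e[OF z(1)] unfolding z(2) g_def by blast
      qed
      moreover have "\<beta> \<in> {0, 1 / real CARD('a) ^ (2 - 1)}" using \<beta> by simp
      ultimately show "\<exists>\<beta>\<in>{0, 1 / real CARD('a) ^ (2 - 1)}. \<exists>e. \<forall>u\<in>U.
          c (x + u) = \<beta> \<or> u = e \<and> c (x + u) = (if \<beta> = 0 then 1 else \<beta> - 1)" by blast
    qed simp
  qed
  show ?thesis
  proof (intro exI[of _ "N + 3"] allI impI)
    fix n assume n: "N + 3 \<le> n"
    show "weight_trivial 2 (coord_space n :: 'a vec set)"
      unfolding weight_trivial_def
    proof (intro allI impI)
      fix c :: "'a vec \<Rightarrow> real" assume c: "boolean_weight 2 (coord_space n) c"
      have "N \<le> n" using n by simp
      from N[rule_format, OF this c] obtain \<psi> where \<psi>: "emb d n \<psi>"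
        and zero: "(\<forall>z\<in>coord_space d. c (\<psi> z) = 0) \<or> (\<forall>z\<in>coord_space d. compl_weight 2 c (\<psi> z) = 0)"
        by blast
      from zero show "classified 2 (coord_space n) c"
        using std[OF n c \<psi>] std[OF n boolean_weight_compl[OF c] \<psi>] unfolding classified_def by auto
    qed
  qed
qed

section \<open>Weights and degree one functions\<close>

lemma span_single_adjoin: "fvec.span {v} = adjoin {0} v"
  using span_insert_adjoin[of v "{}"] by simp

lemma mem_span_self: "v \<in> fvec.span {v}"
  by (rule fvec.span_base) simp

lemma span_in_points:
  fixes v :: "'a::{field,finite} vec"
  assumes "v \<in> coord_space n" "v \<noteq> 0"
  shows "fvec.span {v} \<in> points n"
  unfolding Grassmann_iff_card
  using assms card_adjoin[OF subspace_zero_set, of v]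
    fvec.span_minimal[OF _ subspace_coord_space, of "{v}" n]
  by (simp add: span_single_adjoin[symmetric])

lemma points_span:
  fixes p :: "'a::{field,finite} vec set"
  assumes p: "p \<in> points n" and v: "v \<in> p" "v \<noteq> 0"
  shows "fvec.span {v} = p"
proof -
  have p': "fvec.subspace p" "p \<subseteq> coord_space n" "card p = CARD('a)"
    using p by (auto simp: Grassmann_iff_card)
  have "fvec.span {v} \<in> points n" using p' v by (intro span_in_points) auto
  then have "card (fvec.span {v}) = card p" using p' by (auto simp: Grassmann_iff_card)
  moreover have "fvec.span {v} \<subseteq> p" using p' v by (intro fvec.span_minimal) auto
  ultimately show ?thesis using finite_sub_coord[OF p'(2)] by (intro card_subset_eq) auto
qed

lemma points_obtain:
  fixes p :: "'a::{field,finite} vec set"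
  assumes "p \<in> points n"
  obtains v where "v \<in> coord_space n" "v \<noteq> 0" "p = fvec.span {v}"
proof -
  have p: "p \<subseteq> coord_space n" "card p = CARD('a)" using assms by (auto simp: Grassmann_iff_card)
  have "\<not> p \<subseteq> {0}"
    using p(2) card_mono[of "{0 :: 'a vec}" p] card_field_ge_2[where 'a='a] by force
  then obtain v where "v \<in> p" "v \<noteq> 0" by blast
  then show ?thesis using that[of v] points_span[OF assms] p(1) by blast
qed

lemma sum_over_points:
  fixes K :: "'a::{field,finite} vec set" and w :: "'a vec \<Rightarrow> real"
  assumes K: "fvec.subspace K" "K \<subseteq> coord_space n"
  shows "(\<Sum>p\<in>points n. (\<Sum>v\<in>p - {0}. w v) * x_fun p K) = (\<Sum>v\<in>K - {0}. w v)"
proof -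
  have finK: "finite K" using K(2) by (rule finite_sub_coord)
  have "(\<Sum>v\<in>K - {0}. w v) = (\<Sum>p\<in>points n. \<Sum>v\<in>{v\<in>K - {0}. fvec.span {v} = p}. w v)"
    using finK span_in_points[of _ n, where 'a='a] K(2)
    by (intro sum.group[symmetric]) (auto simp: finite_Grassmann)
  also have "\<dots> = (\<Sum>p\<in>points n. (\<Sum>v\<in>p - {0}. w v) * x_fun p K)"
  proof (rule sum.cong[OF refl])
    fix p :: "'a vec set" assume p: "p \<in> points n"
    obtain v0 where v0: "v0 \<noteq> 0" "p = fvec.span {v0}" using points_obtain[OF p] by blast
    show "(\<Sum>v\<in>{v\<in>K - {0}. fvec.span {v} = p}. w v) = (\<Sum>v\<in>p - {0}. w v) * x_fun p K"
    proof (cases "p \<subseteq> K")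
      case True
      have "{v\<in>K - {0}. fvec.span {v} = p} = p - {0}"
        using True points_span[OF p] mem_span_self by blast
      then show ?thesis using True by (simp add: x_fun_def)
    next
      case False
      have "fvec.span {v} \<subseteq> K" if "v \<in> K" for v using that K(1) by (intro fvec.span_minimal) auto
      then have none: "{v\<in>K - {0}. fvec.span {v} = p} = {}" using False by blast
      show ?thesis unfolding none using False by (simp add: x_fun_def)
    qed
  qed
  finally show ?thesis by simp
qed

lemma wsum_minus_zero:
  fixes K :: "'a::{field,finite} vec set"
  assumes "weight c" "finite K" "0 \<in> K"
  shows "wsum c K = (\<Sum>v\<in>K - {0}. c v / (real CARD('a) - 1))"
  using assms weight_0[OF assms(1)]
  by (simp add: wsum_def sum.remove[of K 0] sum_divide_distrib)

lemma degree_oneI: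
  fixes f :: "'a::{field,finite} vec set \<Rightarrow> real"
  assumes "\<And>K. K \<in> Grassmann n k \<Longrightarrow> f K = (\<Sum>v\<in>K - {0}. w v)"
  shows "degree_one n k f"
  unfolding degree_one_def
proof (intro exI[of _ "\<lambda>p. \<Sum>v\<in>p - {0}. w v"] ballI)
  fix K :: "'a vec set" assume K: "K \<in> Grassmann n k"
  then show "f K = (\<Sum>p\<in>points n. (\<Sum>v\<in>p - {0}. w v) * x_fun p K)"
    using assms[OF K] sum_over_points[of K n w] by (simp add: Grassmann_iff_card)
qed

lemma degree_one_weight:
  fixes f :: "'a::{field,finite} vec set \<Rightarrow> real"
  assumes "degree_one n k f"
  shows "\<exists>c. weight c \<and> (\<forall>K\<in>Grassmann n k. f K = wsum c K)"
proof -
  obtain c' where c': "\<And>K. K \<in> Grassmann n k \<Longrightarrow> f K = (\<Sum>p\<in>points n. c' p * x_fun p K)"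
    using assms unfolding degree_one_def by blast
  define c where "c v = (if v = 0 then 0 else c' (fvec.span {v}))" for v
  have q2: "CARD('a) \<ge> 2" by (rule card_field_ge_2)
  have wc: "weight c" unfolding weight_def
  proof (intro conjI allI impI)
    show "c 0 = 0" by (simp add: c_def)
    fix t :: 'a and v :: "'a vec" assume t: "t \<noteq> 0"
    have "v = inverse t \<odot> (t \<odot> v)" using t by simp
    then have "v \<in> fvec.span {t \<odot> v}" by (metis fvec.span_base fvec.span_scale insertI1)
    then have "fvec.span {v} \<subseteq> fvec.span {t \<odot> v}" by (intro fvec.span_minimal) auto
    moreover have "t \<odot> v \<in> fvec.span {v}" by (intro fvec.span_scale mem_span_self)
    then have "fvec.span {t \<odot> v} \<subseteq> fvec.span {v}" by (intro fvec.span_minimal) auto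
    ultimately show "c (t \<odot> v) = c v" using t by (simp add: c_def)
  qed
  moreover have "f K = wsum c K" if K: "K \<in> Grassmann n k" for K
  proof -
    have K': "fvec.subspace K" "K \<subseteq> coord_space n" using K by (auto simp: Grassmann_iff_card)
    have "(\<Sum>v\<in>p - {0}. c v / (real CARD('a) - 1)) = c' p" if p: "p \<in> points n" for p
    proof -
      have p': "finite p" "0 \<in> p" "card p = CARD('a)"
        using p finite_sub_coord[of p n] fvec.subspace_0[of p] by (auto simp: Grassmann_iff_card)
      have "(\<Sum>v\<in>p - {0}. c v / (real CARD('a) - 1)) = (\<Sum>v\<in>p - {0}. c' p / (real CARD('a) - 1))"
        using points_span[OF p] by (intro sum.cong) (auto simp: c_def)
      also have "\<dots> = c' p" using p' q2 by (simp add: card_Diff_singleton of_nat_diff)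
      finally show ?thesis .
    qed
    then have "f K = (\<Sum>p\<in>points n. (\<Sum>v\<in>p - {0}. c v / (real CARD('a) - 1)) * x_fun p K)"
      using c'[OF K] by simp
    also have "\<dots> = wsum c K"
      using sum_over_points[OF K'] wsum_minus_zero[OF wc finite_sub_coord[OF K'(2)] fvec.subspace_0[OF K'(1)]]
      by simp
    finally show ?thesis .
  qed
  ultimately show ?thesis by blast
qed

section \<open>The bilinear form and hyperplanes\<close>

lemma bilin_commute: "bilin n u v = bilin n v u"
  by (simp add: bilin_def mult.commute)

lemma bilin_add: "bilin n u (v + w) = bilin n u v + bilin n u w"
  by (simp add: bilin_def distrib_left sum.distrib)

lemma bilin_scale: "bilin n u (t \<odot> v) = t * bilin n u v"
  by (simp add: bilin_def vec_scale_def sum_distrib_left mult_ac)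

lemma bilin_zero: "bilin n u 0 = 0"
  by (simp add: bilin_def)

lemma bilin_diff: "bilin n u (v - w) = bilin n u v - bilin n u w"
  using bilin_add[of n u "v - w" w] by simp

lemma bilin_unit: "i < n \<Longrightarrow> bilin n u (unit_vec i) = u i"
  unfolding bilin_def unit_vec_def by (simp add: if_distrib sum.delta cong: if_cong)

lemma bilin_nondegenerate:
  assumes "u \<in> coord_space n" "u \<noteq> 0"
  shows "\<exists>v\<in>coord_space n. bilin n u v \<noteq> 0"
proof -
  obtain i where i: "u i \<noteq> 0" using assms(2) by (auto simp: fun_eq_iff)
  have "i < n"
  proof (rule ccontr)
    assume "\<not> i < n"
    then show False using assms(1) i by (simp add: coord_space_def)
  qed
  then show ?thesis using i unit_vec_mem[of i n] bilin_unit[of i n u] by (intro bexI[of _ "unit_vec i"]) auto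
qed

lemma kernel_hyperplane:
  assumes V: "fvec.subspace V" and x: "x \<in> V" "bilin n u x \<noteq> 0"
  shows "hyperplane {v\<in>V. bilin n u v = 0} V"
proof -
  let ?H = "{v\<in>V. bilin n u v = 0}"
  have H: "fvec.subspace ?H"
    using V by (intro fvec.subspaceI)
      (simp_all add: bilin_zero bilin_add bilin_scale fvec.subspace_0 fvec.subspace_add fvec.subspace_scale)
  have "v \<in> adjoin ?H x" if v: "v \<in> V" for v
  proof -
    have "v - (bilin n u v / bilin n u x) \<odot> x \<in> ?H"
      using V v x by (simp add: bilin_diff bilin_scale fvec.subspace_diff fvec.subspace_scale)
    then show ?thesis unfolding mem_adjoin_iff[OF H] by blast
  qed
  then show ?thesis using H V x by (intro hyperplaneI[of _ _ x]) auto
qed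

text \<open>
  A functional with kernel \<open>H\<close> is read off from the coordinates: for a fixed \<open>x\<close> outside \<open>H\<close>, the entry
  \<open>r i\<close> is the multiple of \<open>x\<close> by which \<open>unit_vec i\<close> differs from a vector of \<open>H\<close>.
\<close>

lemma hyperplane_bilin:
  fixes H :: "'a::{field,finite} vec set"
  assumes H: "hyperplane H (coord_space n)"
  obtains r where "r \<in> coord_space n" "r \<noteq> 0" "\<And>v. v \<in> coord_space n \<Longrightarrow> v \<in> H \<longleftrightarrow> bilin n r v = 0"
proof -
  have sH: "fvec.subspace H" and Hn: "H \<subseteq> coord_space n" using H by (auto simp: hyperplane_def)
  have "H \<noteq> coord_space n"
    using H card_field_ge_2[where 'a='a] by (auto simp: hyperplane_def card_coord_space)
  then obtain x where x: "x \<in> coord_space n" "x \<notin> H" using Hn by blast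
  have adjoin: "adjoin H x = coord_space n"
    by (rule hyperplane_adjoin[OF H subspace_coord_space finite_coord_space x])
  have "\<forall>i. \<exists>t. i < n \<longrightarrow> unit_vec i - t \<odot> x \<in> H"
    using unit_vec_mem adjoin mem_adjoin_iff[OF sH] by metis
  then obtain \<rho> where \<rho>: "\<And>i. i < n \<Longrightarrow> unit_vec i - \<rho> i \<odot> x \<in> H" by metis
  define r where "r = (\<lambda>i. if i < n then \<rho> i else 0)"
  have rn: "r \<in> coord_space n" by (simp add: r_def coord_space_def)
  have diff: "v - bilin n r v \<odot> x \<in> H" if v: "v \<in> coord_space n" for v
  proof -
    have "(\<Sum>i<n. v i \<odot> (unit_vec i - \<rho> i \<odot> x)) \<in> H"
      using \<rho> by (intro fvec.subspace_sum[OF sH] fvec.subspace_scale[OF sH]) auto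
    also have "(\<Sum>i<n. v i \<odot> (unit_vec i - \<rho> i \<odot> x)) =
        (\<Sum>i<n. v i \<odot> unit_vec i) - (\<Sum>i<n. (\<rho> i * v i) \<odot> x)"
      by (simp add: fvec.scale_right_diff_distrib sum_subtractf mult.commute)
    also have "(\<Sum>i<n. v i \<odot> unit_vec i) = v"
    proof
      fix j
      have "(\<Sum>i<n. v i \<odot> unit_vec i) j = (\<Sum>i<n. (v i \<odot> unit_vec i) j)"
        by (induction n) simp_all
      also have "\<dots> = (\<Sum>i<n. if j = i then v i else 0)"
        by (intro sum.cong) (auto simp: unit_vec_def vec_scale_def)
      also have "\<dots> = v j" using v by (auto simp: coord_space_def)
      finally show "(\<Sum>i<n. v i \<odot> unit_vec i) j = v j" .
    qed
    also have "(\<Sum>i<n. (\<rho> i * v i) \<odot> x) = bilin n r v \<odot> x"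
      by (simp add: fvec.scale_sum_left[symmetric] bilin_def r_def)
    finally show ?thesis .
  qed
  have iff: "v \<in> H \<longleftrightarrow> bilin n r v = 0" if v: "v \<in> coord_space n" for v
  proof
    assume "v \<in> H"
    then have "v - (v - bilin n r v \<odot> x) \<in> H" by (rule fvec.subspace_diff[OF sH _ diff[OF v]])
    then have m: "bilin n r v \<odot> x \<in> H" by simp
    show "bilin n r v = 0"
    proof (rule ccontr)
      assume "bilin n r v \<noteq> 0"
      moreover have "inverse (bilin n r v) \<odot> bilin n r v \<odot> x \<in> H" using m by (rule fvec.subspace_scale[OF sH])
      ultimately show False using x(2) by simp
    qed
  next
    assume "bilin n r v = 0"
    then show "v \<in> H" using diff[OF v] by simp
  qed
  have "r \<noteq> 0"
  proof
    assume "r = 0"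
    then have "bilin n r x = 0" by (simp add: bilin_def)
    then show False using iff x by blast
  qed
  then show ?thesis using that rn iff by blast
qed

lemma orthogonal_span:
  "orthogonal_spaces n (fvec.span {r}) K \<longleftrightarrow> (\<forall>v\<in>K. bilin n r v = 0)"
proof
  assume "orthogonal_spaces n (fvec.span {r}) K"
  then show "\<forall>v\<in>K. bilin n r v = 0" using mem_span_self by (auto simp: orthogonal_spaces_def)
next
  assume *: "\<forall>v\<in>K. bilin n r v = 0"
  show "orthogonal_spaces n (fvec.span {r}) K" unfolding orthogonal_spaces_def
  proof (intro ballI)
    fix u v assume "u \<in> fvec.span {r}" "v \<in> K"
    then obtain t where "u = t \<odot> r" by (auto simp: fvec.span_singleton)
    then show "bilin n u v = 0"
      using * \<open>v \<in> K\<close> bilin_scale[of n v t r] bilin_commute[of n u v] bilin_commute[of n r v] by simp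
  qed
qed

lemma orthogonal_commute: "orthogonal_spaces n U V \<longleftrightarrow> orthogonal_spaces n V U"
  unfolding orthogonal_spaces_def by (metis bilin_commute)

lemma orthogonal_span_span:
  "orthogonal_spaces n (fvec.span {a}) (fvec.span {r}) \<longleftrightarrow> bilin n r a = 0"
proof -
  have "orthogonal_spaces n (fvec.span {r}) (fvec.span {a}) \<longleftrightarrow> bilin n r a = 0"
  proof -
    have "(\<forall>v\<in>fvec.span {a}. bilin n r v = 0) \<longleftrightarrow> bilin n r a = 0"
      by (auto simp: fvec.span_singleton bilin_scale)
    then show ?thesis by (simp add: orthogonal_span)
  qed
  then show ?thesis by (simp add: orthogonal_commute)
qed

section \<open>Standard weights and trivial functions\<close>

lemma weight_point_ind: "weight (point_ind a)"
  unfolding weight_def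
proof (intro conjI allI impI)
  fix t :: 'a and v :: "'a vec" assume t: "t \<noteq> 0"
  have "v \<in> fvec.span {a}" if "t \<odot> v \<in> fvec.span {a}"
    using fvec.span_scale[OF that, of "inverse t"] t by simp
  then show "point_ind a (t \<odot> v) = point_ind a v"
    using t fvec.span_scale[of v "{a}" t] by (auto simp: point_ind_def)
qed (simp add: point_ind_def)

lemma weight_hyp_weight:
  assumes "fvec.subspace H"
  shows "weight (hyp_weight k H a)"
  unfolding weight_def
proof (intro conjI allI impI)
  show "hyp_weight k H a 0 = 0"
    using fvec.subspace_0[OF assms] weight_0[OF weight_point_ind[of a]] by (simp add: hyp_weight_def)
  fix t :: 'a and v :: "'a vec" assume t: "t \<noteq> 0"
  have "v \<in> H" if "t \<odot> v \<in> H"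
    using fvec.subspace_scale[OF assms that, of "inverse t"] t by simp
  then have "t \<odot> v \<in> H \<longleftrightarrow> v \<in> H" using fvec.subspace_scale[OF assms] by blast
  then show "hyp_weight k H a (t \<odot> v) = hyp_weight k H a v"
    using weight_scale[OF weight_point_ind t] by (simp add: hyp_weight_def)
qed

lemma std_form_weight: "std_form k (coord_space n) g \<Longrightarrow> weight g"
  by (auto simp: std_form_def hyperplane_def weight_point_ind weight_hyp_weight)

lemma wsum_point_ind:
  fixes K :: "'a::{field,finite} vec set"
  assumes K: "fvec.subspace K" "finite K" and a: "a \<noteq> 0"
  shows "wsum (point_ind a) K = x_fun (fvec.span {a}) K"
proof (cases "a \<in> K")
  case True
  then have sub: "fvec.span {a} \<subseteq> K" using K by (intro fvec.span_minimal) auto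
  have q2: "CARD('a) \<ge> 2" by (rule card_field_ge_2)
  have fin: "finite (fvec.span {a})" using sub K(2) by (rule finite_subset)
  have card: "card (fvec.span {a}) = CARD('a)"
    using card_adjoin[OF subspace_zero_set, of a] a by (simp add: span_single_adjoin)
  have "(\<Sum>v\<in>K. point_ind a v) = (\<Sum>v\<in>fvec.span {a} - {0}. 1)"
    using K(2) sub by (intro sum.mono_neutral_cong_right) (auto simp: point_ind_def)
  also have "\<dots> = real CARD('a) - 1"
    using fin card q2 fvec.span_zero[of "{a}"] by (simp add: card_Diff_singleton of_nat_diff)
  finally show ?thesis using q2 sub by (simp add: wsum_def x_fun_def)
next
  case False
  then have "\<not> fvec.span {a} \<subseteq> K" using mem_span_self by blast
  then show ?thesis using point_ind_subspace[OF K(1) False] by (simp add: wsum_def x_fun_def)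
qed

lemma wsum_hyp_weight:
  fixes K :: "'a::{field,finite} vec set"
  assumes H: "hyperplane H (coord_space n)" and K: "K \<in> Grassmann n k" and k: "k \<ge> 1"
  shows "wsum (hyp_weight k H a) K = (if K \<subseteq> H then 0 else 1) - wsum (point_ind a) K"
proof -
  have K': "fvec.subspace K" "K \<subseteq> coord_space n" "card K = CARD('a) ^ k"
    using K by (auto simp: Grassmann_iff_card)
  have fin: "finite K" using K'(2) by (rule finite_sub_coord)
  define q where "q = real CARD('a)"
  have q2: "q \<ge> 2" "CARD('a) \<ge> 2" using card_field_ge_2[where 'a='a] by (simp_all add: q_def)
  have "(\<Sum>v\<in>K. if v \<in> H then 0 else 1 / q ^ (k - 1)) = (if K \<subseteq> H then 0 else q - 1)"
  proof (cases "K \<subseteq> H")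
    case True
    then show ?thesis by (simp add: subset_iff)
  next
    case False
    have "hyperplane (K \<inter> H) K"
      by (rule hyperplane_Int[OF H subspace_coord_space finite_coord_space K'(1,2) False])
    then have "CARD('a) * card (K \<inter> H) = CARD('a) * CARD('a) ^ (k - 1)"
      using K'(3) k by (cases k) (simp_all add: hyperplane_def)
    then have cKH: "card (K \<inter> H) = CARD('a) ^ (k - 1)" using q2 by simp
    have "(\<Sum>v\<in>K. if v \<in> H then 0 else 1 / q ^ (k - 1)) = (\<Sum>v\<in>K - H. 1 / q ^ (k - 1))"
      using fin by (intro sum.mono_neutral_cong_right) auto
    also have "\<dots> = real (card (K - H)) / q ^ (k - 1)" by simp
    also have "card (K - H) = card K - card (K \<inter> H)" using fin by (simp add: card_Diff_subset_Int)
    also have "real (card K - card (K \<inter> H)) = q ^ k - q ^ (k - 1)"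
      using card_mono[OF fin, of "K \<inter> H"] K'(3) cKH by (simp add: of_nat_diff q_def)
    also have "q ^ k = q * q ^ (k - 1)" using k by (cases k) simp_all
    also have "(q * q ^ (k - 1) - q ^ (k - 1)) / q ^ (k - 1) = q - 1" using q2 by (simp add: field_simps)
    finally show ?thesis using False by simp
  qed
  then show ?thesis
    using q2 unfolding wsum_def hyp_weight_def q_def[symmetric]
    by (simp add: sum_subtractf diff_divide_distrib)
qed

lemma y_fun_hyperplane:
  assumes r: "\<And>v. v \<in> coord_space n \<Longrightarrow> v \<in> H \<longleftrightarrow> bilin n r v = 0" and K: "K \<subseteq> coord_space n"
  shows "y_fun n (fvec.span {r}) K = (if K \<subseteq> H then 1 else 0)"
  using r K unfolding y_fun_def orthogonal_span by (auto simp: subset_iff)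

lemma std_form_trivial:
  fixes f :: "'a::{field,finite} vec set \<Rightarrow> real"
  assumes g: "std_form k (coord_space n) g" and k: "k \<ge> 1"
    and f: "(\<forall>K\<in>Grassmann n k. f K = wsum g K) \<or> (\<forall>K\<in>Grassmann n k. f K = 1 - wsum g K)"
  shows "trivial_fun n k f"
proof -
  have Kfin: "fvec.subspace K" "finite K" "K \<subseteq> coord_space n" if "K \<in> Grassmann n k" for K :: "'a vec set"
    using that finite_sub_coord by (auto simp: Grassmann_iff_card)
  consider (point) a where "a \<in> coord_space n" "g = point_ind a"
    | (hyper) H a where "hyperplane H (coord_space n)" "a \<in> coord_space n" "a = 0 \<or> a \<notin> H"
        "g = hyp_weight k H a"
    using g unfolding std_form_def by blast
  then show ?thesis
  proof cases
    case (point a)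
    note a = point(1) and g = point(2)
    show ?thesis
    proof (cases "a = 0")
      case True
      then have "wsum g K = 0" for K by (simp add: g wsum_def)
      then have "eq_on_Grassmann n k f (\<lambda>V. 0) \<or> eq_on_Grassmann n k f (\<lambda>V. 1)"
        using f by (auto simp: eq_on_Grassmann_def)
      then show ?thesis unfolding trivial_fun_def by blast
    next
      case False
      have "wsum g K = x_fun (fvec.span {a}) K" if "K \<in> Grassmann n k" for K
        using wsum_point_ind[OF Kfin(1,2)[OF that] False] by (simp add: g)
      then have "eq_on_Grassmann n k f (\<lambda>V. x_fun (fvec.span {a}) V) \<or>
          eq_on_Grassmann n k f (\<lambda>V. 1 - x_fun (fvec.span {a}) V)"
        using f by (auto simp: eq_on_Grassmann_def)
      then show ?thesis unfolding trivial_fun_def using span_in_points[OF a False] by blast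
    qed
  next
    case (hyper H a)
    note H = hyper(1) and a = hyper(2,3) and g = hyper(4)
    obtain r where r: "r \<in> coord_space n" "r \<noteq> 0" "\<And>v. v \<in> coord_space n \<Longrightarrow> v \<in> H \<longleftrightarrow> bilin n r v = 0"
      using hyperplane_bilin[OF H] by blast
    have rp: "fvec.span {r} \<in> points n" by (rule span_in_points[OF r(1,2)])
    have val: "wsum g K = 1 - y_fun n (fvec.span {r}) K - wsum (point_ind a) K" if K: "K \<in> Grassmann n k" for K
      using wsum_hyp_weight[OF H K k, of a] y_fun_hyperplane[OF r(3) Kfin(3)[OF K]] by (simp add: g)
    show ?thesis
    proof (cases "a = 0")
      case True
      then have "wsum (point_ind a) K = 0" for K by (simp add: wsum_def)
      then have "eq_on_Grassmann n k f (\<lambda>V. 1 - y_fun n (fvec.span {r}) V) \<or>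
          eq_on_Grassmann n k f (\<lambda>V. y_fun n (fvec.span {r}) V)"
        using f val by (auto simp: eq_on_Grassmann_def)
      then show ?thesis unfolding trivial_fun_def using rp by blast
    next
      case False
      have "wsum (point_ind a) K = x_fun (fvec.span {a}) K" if "K \<in> Grassmann n k" for K
        by (rule wsum_point_ind[OF Kfin(1,2)[OF that] False])
      then have "eq_on_Grassmann n k f (\<lambda>V. 1 - x_fun (fvec.span {a}) V - y_fun n (fvec.span {r}) V) \<or>
          eq_on_Grassmann n k f (\<lambda>V. x_fun (fvec.span {a}) V + y_fun n (fvec.span {r}) V)"
        using f val by (auto simp: eq_on_Grassmann_def)
      moreover have "\<not> orthogonal_spaces n (fvec.span {a}) (fvec.span {r})"
        using r(3)[OF a(1)] a(2) False by (simp add: orthogonal_span_span)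
      ultimately show ?thesis
        unfolding trivial_fun_def using rp span_in_points[OF a(1) False] by blast
    qed
  qed
qed

lemma trivial_std_form:
  fixes f :: "'a::{field,finite} vec set \<Rightarrow> real"
  assumes f: "trivial_fun n k f" and k: "k \<ge> 1"
  shows "\<exists>g. std_form k (coord_space n) g \<and>
    ((\<forall>K\<in>Grassmann n k. f K = wsum g K) \<or> (\<forall>K\<in>Grassmann n k. f K = 1 - wsum g K))"
proof -
  have Kfin: "fvec.subspace K" "finite K" "K \<subseteq> coord_space n" if "K \<in> Grassmann n k" for K :: "'a vec set"
    using that finite_sub_coord by (auto simp: Grassmann_iff_card)
  have zero: "wsum (point_ind 0) K = 0" for K :: "'a vec set" by (simp add: wsum_def)
  have f0: "std_form k (coord_space n) (point_ind (0 :: 'a vec))" unfolding std_form_def using coord_0 by blast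
  have fx: "\<exists>g. std_form k (coord_space n) g \<and> (\<forall>K\<in>Grassmann n k. wsum g K = x_fun p K)"
    if "p \<in> points n" for p :: "'a vec set"
  proof -
    obtain a where a: "a \<in> coord_space n" "a \<noteq> 0" "p = fvec.span {a}" using points_obtain[OF \<open>p \<in> points n\<close>] .
    have "std_form k (coord_space n) (point_ind a)" unfolding std_form_def using a by blast
    then show ?thesis using wsum_point_ind[OF Kfin(1,2) a(2)] a(3) by blast
  qed
  have hyp: "\<exists>H. hyperplane H (coord_space n) \<and> (\<forall>v\<in>coord_space n. v \<in> H \<longleftrightarrow> bilin n r v = 0)"
    if "r \<in> coord_space n" "r \<noteq> 0" for r :: "'a vec"
  proof -
    obtain x where "x \<in> coord_space n" "bilin n r x \<noteq> 0"
      using bilin_nondegenerate[OF \<open>r \<in> coord_space n\<close> \<open>r \<noteq> 0\<close>] by blast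
    from kernel_hyperplane[OF subspace_coord_space this] show ?thesis by (intro exI conjI) auto
  qed
  have fy: "\<exists>g. std_form k (coord_space n) g \<and> (\<forall>K\<in>Grassmann n k. wsum g K = 1 - y_fun n s K)"
    if s: "s \<in> points n" for s :: "'a vec set"
  proof -
    obtain r where r: "r \<in> coord_space n" "r \<noteq> 0" "s = fvec.span {r}" using points_obtain[OF s] .
    obtain H where H: "hyperplane H (coord_space n)" "\<And>v. v \<in> coord_space n \<Longrightarrow> v \<in> H \<longleftrightarrow> bilin n r v = 0"
      using hyp[OF r(1,2)] by blast
    have "std_form k (coord_space n) (hyp_weight k H 0)" unfolding std_form_def using H(1) coord_0 by blast
    moreover have "wsum (hyp_weight k H 0) K = 1 - y_fun n s K" if K: "K \<in> Grassmann n k" for K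
      using wsum_hyp_weight[OF H(1) K k, of 0] y_fun_hyperplane[OF H(2) Kfin(3)[OF K]] zero
      by (simp add: r(3))
    ultimately show ?thesis by blast
  qed
  have fxy: "\<exists>g. std_form k (coord_space n) g \<and> (\<forall>K\<in>Grassmann n k. wsum g K = 1 - x_fun p K - y_fun n s K)"
    if p: "p \<in> points n" and s: "s \<in> points n" and np: "\<not> orthogonal_spaces n p s" for p s :: "'a vec set"
  proof -
    obtain a where a: "a \<in> coord_space n" "a \<noteq> 0" "p = fvec.span {a}" using points_obtain[OF p] .
    obtain r where r: "r \<in> coord_space n" "r \<noteq> 0" "s = fvec.span {r}" using points_obtain[OF s] .
    obtain H where H: "hyperplane H (coord_space n)" "\<And>v. v \<in> coord_space n \<Longrightarrow> v \<in> H \<longleftrightarrow> bilin n r v = 0"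
      using hyp[OF r(1,2)] by blast
    have "a \<notin> H" using H(2)[OF a(1)] np a(3) r(3) by (simp add: orthogonal_span_span)
    then have "std_form k (coord_space n) (hyp_weight k H a)" unfolding std_form_def using H(1) a(1) by blast
    moreover have "wsum (hyp_weight k H a) K = 1 - x_fun p K - y_fun n s K" if K: "K \<in> Grassmann n k" for K
      using wsum_hyp_weight[OF H(1) K k, of a] y_fun_hyperplane[OF H(2) Kfin(3)[OF K]]
        wsum_point_ind[OF Kfin(1,2)[OF K] a(2)]
      by (simp add: r(3) a(3))
    ultimately show ?thesis by blast
  qed
  have via: ?thesis if "\<exists>g. std_form k (coord_space n) g \<and> (\<forall>K\<in>Grassmann n k. wsum g K = h K)"
    and "(\<forall>K\<in>Grassmann n k. f K = h K) \<or> (\<forall>K\<in>Grassmann n k. f K = 1 - h K)" for h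
    using that by (elim exE conjE) (intro exI conjI, assumption, auto)
  have f0': "\<exists>g :: 'a vec \<Rightarrow> real. std_form k (coord_space n) g \<and> (\<forall>K\<in>Grassmann n k. wsum g K = 0)"
    using f0 zero by blast
  from f show ?thesis unfolding trivial_fun_def eq_on_Grassmann_def
  proof (elim disjE bexE conjE)
    show ?thesis if "\<forall>V\<in>Grassmann n k. f V = 0"
      by (rule via[OF f0']) (use that in simp)
    show ?thesis if "\<forall>V\<in>Grassmann n k. f V = 1"
      by (rule via[OF f0']) (use that in simp)
    fix p :: "'a vec set" assume p: "p \<in> points n"
    show ?thesis if "\<forall>V\<in>Grassmann n k. f V = x_fun p V"
      by (rule via[OF fx[OF p]]) (use that in simp)
    show ?thesis if "\<forall>V\<in>Grassmann n k. f V = 1 - x_fun p V"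
      by (rule via[OF fx[OF p]]) (use that in simp)
    show ?thesis if "\<forall>V\<in>Grassmann n k. f V = y_fun n p V"
      by (rule via[OF fy[OF p]]) (use that in simp)
    show ?thesis if "\<forall>V\<in>Grassmann n k. f V = 1 - y_fun n p V"
      by (rule via[OF fy[OF p]]) (use that in simp)
    fix r :: "'a vec set" assume r: "r \<in> points n" "\<not> orthogonal_spaces n p r"
    show ?thesis if "\<forall>V\<in>Grassmann n k. f V = x_fun p V + y_fun n r V"
      by (rule via[OF fxy[OF p r]]) (use that in simp)
    show ?thesis if "\<forall>V\<in>Grassmann n k. f V = 1 - x_fun p V - y_fun n r V"
      by (rule via[OF fxy[OF p r]]) (use that in simp)
  qed
qed

section \<open>Uniqueness of weights\<close>

text \<open>
  If all \<open>k\<close>-spaces in a space \<open>X\<close> of dimension \<open>k + 1\<close> have the same sum, then \<open>d\<close> is constant on the nonzero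
  vectors of \<open>X\<close>. For a \<open>(k - 1)\<close>-space \<open>A\<close> in \<open>X\<close>, the \<open>q + 1\<close> \<open>k\<close>-spaces between \<open>A\<close> and \<open>X\<close> cover the points
  outside \<open>A\<close> once, which determines the sum over \<open>A\<close>. The induction hypothesis then applies
  to every \<open>k\<close>-space in \<open>X\<close>, and any two vectors lie in one of these.
\<close>

lemma wsum_const_imp_const:
  fixes d :: "'a::{field,finite} vec \<Rightarrow> real"
  assumes d: "weight d" and "k \<ge> 1"
    and "fvec.subspace X" "finite X" "card X = CARD('a) ^ (k + 1)"
    and "\<And>K. fvec.subspace K \<Longrightarrow> K \<subseteq> X \<Longrightarrow> card K = CARD('a) ^ k \<Longrightarrow> wsum d K = \<sigma>"
    and "u \<in> X" "u \<noteq> 0" "v \<in> X" "v \<noteq> 0"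
  shows "d u = d v"
  using assms(2-)
proof (induction k arbitrary: X \<sigma> u v rule: nat_induct_at_least)
  case base
  have val: "d u = \<sigma>" if u: "u \<in> X" "u \<noteq> 0" for u
  proof -
    have "wsum d (adjoin {0} u) = \<sigma>"
      using base.prems(1) u card_adjoin[OF subspace_zero_set, of u] fvec.subspace_0[OF base.prems(1)]
      by (intro base.prems(4) subspace_adjoin subspace_zero_set adjoin_subset) auto
    then show ?thesis using wsum_adjoin[OF subspace_zero_set _ d, of u] u by (simp add: wsum_zero[OF d])
  qed
  show ?case unfolding val[OF base.prems(5,6)] val[OF base.prems(7,8)] ..
next
  case (Suc k)
  have q2: "CARD('a) \<ge> 2" by (rule card_field_ge_2)
  note X = Suc.prems(1-3)
  define \<sigma>' where "\<sigma>' = ((real CARD('a) + 1) * \<sigma> - wsum d X) / real CARD('a)"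
  have low: "wsum d A = \<sigma>'" if A: "fvec.subspace A" "A \<subseteq> X" "card A = CARD('a) ^ k" for A
  proof -
    have "CARD('a) ^ k < CARD('a) ^ (Suc k + 1)" "CARD('a) ^ (k + 1) < CARD('a) ^ (Suc k + 1)"
      using q2 by (intro power_strict_increasing; simp)+
    then have lt: "card A < card X" "CARD('a) * card A < card X" using A(3) X(3) by simp_all
    have "A \<noteq> X" using lt(1) by auto
    then obtain y where y: "y \<in> X" "y \<notin> A" using A(2) by blast
    define E where "E = adjoin A y"
    have E: "fvec.subspace E" "E \<subseteq> X" "card E = CARD('a) * card A"
      using subspace_adjoin[OF A(1), of y] adjoin_subset[OF X(1) A(2) y(1)] card_adjoin[OF A(1) y(2)]
      by (simp_all add: E_def)
    have "E \<noteq> X" using lt(2) E(3) by auto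
    then obtain x where x: "x \<in> X" "x \<notin> E" using E(2) by blast
    have "adjoin E x = X"
      using adjoin_subset[OF X(1) E(2) x(1)] card_adjoin[OF E(1) x(2)] E(3) A(3) X by (intro card_subset_eq) simp_all
    then have wX: "wsum d X = wsum d A + (\<Sum>w\<in>A. d (w + y)) + (\<Sum>t\<in>UNIV. \<Sum>w\<in>A. d (w + t \<odot> y + x))"
      using wsum_adjoin2[OF A(1) y(2) x(2)[unfolded E_def] d] unfolding E_def by simp
    have adjoin\<sigma>: "(\<Sum>w\<in>A. d (w + z)) = \<sigma> - wsum d A" if z: "z \<in> X" "z \<notin> A" for z
    proof -
      have "wsum d (adjoin A z) = \<sigma>"
        using subspace_adjoin[OF A(1), of z] adjoin_subset[OF X(1) A(2) z(1)] card_adjoin[OF A(1) z(2)] A(3)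
        by (intro Suc.prems(4)) simp_all
      then show ?thesis using wsum_adjoin[OF A(1) z(2) d] by simp
    qed
    have zA: "t \<odot> y + x \<in> X \<and> t \<odot> y + x \<notin> A" for t
    proof
      show "t \<odot> y + x \<in> X" using X(1) x(1) y(1) by (intro fvec.subspace_add fvec.subspace_scale)
      show "t \<odot> y + x \<notin> A"
      proof
        assume "t \<odot> y + x \<in> A"
        then have "(t \<odot> y + x) + (- t) \<odot> y \<in> E" unfolding E_def by (rule adjoinI)
        then show False using x(2) by simp
      qed
    qed
    have "(\<Sum>t\<in>UNIV. \<Sum>w\<in>A. d (w + t \<odot> y + x)) = (\<Sum>t\<in>(UNIV :: 'a set). \<sigma> - wsum d A)"
      using adjoin\<sigma>[OF conjunct1[OF zA] conjunct2[OF zA]] by (intro sum.cong refl) (simp add: add.assoc)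
    then have "wsum d X = \<sigma> + real CARD('a) * (\<sigma> - wsum d A)" using wX adjoin\<sigma>[OF y] by simp
    then show ?thesis using q2 by (simp add: \<sigma>'_def field_simps)
  qed
  define A where "A = adjoin {0} u"
  have A: "fvec.subspace A" "A \<subseteq> X" "card A = CARD('a) ^ 1" "u \<in> A"
    using subspace_adjoin[OF subspace_zero_set, of u] adjoin_subset[OF X(1), of "{0}" u]
      card_adjoin[OF subspace_zero_set, of u] fvec.subspace_0[OF X(1)] Suc.prems(5,6) adjoin_self[of "{0}" u]
    by (simp_all add: A_def)
  have ex: "\<exists>Y j. fvec.subspace Y \<and> Y \<subseteq> X \<and> u \<in> Y \<and> v \<in> Y \<and> card Y = CARD('a) ^ j \<and> j \<le> 2"
  proof (cases "v \<in> A")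
    case True
    then show ?thesis using A by (intro exI[of _ A] exI[of _ 1]) simp
  next
    case False
    have "card (adjoin A v) = CARD('a) ^ 2" using card_adjoin[OF A(1) False] A(3) by (simp add: power2_eq_square)
    moreover have "u \<in> adjoin A v" using subset_adjoin[of A v] A(4) by blast
    ultimately show ?thesis
      using subspace_adjoin[OF A(1), of v] adjoin_subset[OF X(1) A(2) Suc.prems(7)]
        adjoin_self[OF fvec.subspace_0[OF A(1)], of v]
      by (intro exI[of _ "adjoin A v"] exI[of _ 2]) simp
  qed
  then obtain Y j where Y: "fvec.subspace Y" "Y \<subseteq> X" "u \<in> Y" "v \<in> Y" "card Y = CARD('a) ^ j" "j \<le> 2" by blast
  have "j \<le> k + 1" using Y(6) Suc.hyps by simp
  moreover have "CARD('a) ^ (k + 1) \<le> card X" using X(3) q2 by simp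
  ultimately obtain X' where X': "fvec.subspace X'" "Y \<subseteq> X'" "X' \<subseteq> X" "card X' = CARD('a) ^ (k + 1)"
    using exists_intermediate_subspace[OF Y(1) X(1) Y(2) X(2) Y(5), of "k + 1"] by blast
  show ?case
    using X' Y finite_subset[OF X'(3) X(2)] Suc.prems(6,8)
    by (intro Suc.IH[of X' \<sigma>'] low) auto
qed

lemma weight_unique:
  fixes d :: "'a::{field,finite} vec \<Rightarrow> real"
  assumes d: "weight d" and k: "k \<ge> 1" and V: "fvec.subspace V" "finite V" "CARD('a) ^ (k + 1) \<le> card V"
    and zero: "\<And>K. fvec.subspace K \<Longrightarrow> K \<subseteq> V \<Longrightarrow> card K = CARD('a) ^ k \<Longrightarrow> wsum d K = 0"
    and v: "v \<in> V"
  shows "d v = 0"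
proof (cases "v = 0")
  case True
  then show ?thesis using weight_0[OF d] by simp
next
  case False
  have q2: "CARD('a) \<ge> 2" by (rule card_field_ge_2)
  have L: "fvec.subspace (adjoin {0} v)" "adjoin {0} v \<subseteq> V" "card (adjoin {0} v) = CARD('a) ^ 1"
    using subspace_adjoin[OF subspace_zero_set, of v] adjoin_subset[OF V(1), of "{0}" v]
      card_adjoin[OF subspace_zero_set, of v] fvec.subspace_0[OF V(1)] v False by simp_all
  have vL: "v \<in> adjoin {0} v" by (rule adjoin_self) simp
  obtain X where X: "fvec.subspace X" "adjoin {0} v \<subseteq> X" "X \<subseteq> V" "card X = CARD('a) ^ (k + 1)"
    using exists_intermediate_subspace[OF L(1) V(1) L(2) V(2) L(3), of "k + 1"] k V(3) by auto
  have finX: "finite X" using X(3) V(2) by (rule finite_subset)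
  obtain K where K: "fvec.subspace K" "adjoin {0} v \<subseteq> K" "K \<subseteq> X" "card K = CARD('a) ^ k"
    using exists_intermediate_subspace[OF L(1) X(1,2) finX L(3), of k] k X(4) q2 by auto
  have const: "d u = d v" if "u \<in> X" "u \<noteq> 0" for u
    using X(3) that False vL X(2) by (intro wsum_const_imp_const[OF d k X(1) finX X(4), of 0] zero) auto
  have finK: "finite K" using K(3) finX by (rule finite_subset)
  have "wsum d K = (\<Sum>u\<in>K - {0}. d u / (real CARD('a) - 1))"
    by (rule wsum_minus_zero[OF d finK fvec.subspace_0[OF K(1)]])
  also have "\<dots> = (\<Sum>u\<in>K - {0}. d v / (real CARD('a) - 1))"
    using const K(3) by (intro sum.cong) auto
  also have "\<dots> = real (card (K - {0})) * (d v / (real CARD('a) - 1))" by simp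
  finally have "real (card (K - {0})) * (d v / (real CARD('a) - 1)) = 0"
    using zero[of K] K X(3) by auto
  moreover have "v \<in> K - {0}" using K(2) vL False by blast
  then have "card (K - {0}) \<noteq> 0" using finK by auto
  ultimately show ?thesis using q2 by auto
qed

lemma weight_diff: "weight c \<Longrightarrow> weight g \<Longrightarrow> weight (\<lambda>v. c v - g v)"
  by (simp add: weight_def)

lemma wsum_diff: "wsum (\<lambda>v. c v - g v) K = wsum c K - wsum g K"
  by (simp add: wsum_def sum_subtractf diff_divide_distrib)

lemma wsum_cong: "(\<And>v. v \<in> K \<Longrightarrow> c v = g v) \<Longrightarrow> wsum c K = wsum g K"
  by (simp add: wsum_def)

lemma weight_trivial_imp_degree_one_trivial:
  assumes triv: "weight_trivial k (coord_space n :: 'a::{field,finite} vec set)" and k: "k \<ge> 1"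
  shows "degree_one_trivial TYPE('a) n k"
  unfolding degree_one_trivial_def
proof (intro allI impI, elim conjE)
  fix f :: "'a vec set \<Rightarrow> real"
  assume b: "boolean_fun n k f" and "degree_one n k f"
  then obtain c where c: "weight c" "\<And>K. K \<in> Grassmann n k \<Longrightarrow> f K = wsum c K"
    using degree_one_weight by blast
  have Gr: "K \<in> Grassmann n k \<longleftrightarrow> fvec.subspace K \<and> K \<subseteq> coord_space n \<and> card K = CARD('a) ^ k"
    for K :: "'a vec set" by (rule Grassmann_iff_card)
  have "boolean_weight k (coord_space n) c"
    unfolding boolean_weight_def using c b Gr unfolding boolean_fun_def by metis
  then have "classified k (coord_space n) c" using triv unfolding weight_trivial_def by blast
  then show "trivial_fun n k f" unfolding classified_def
  proof
    assume "std_weight k (coord_space n) c"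
    then obtain g where g: "std_form k (coord_space n) g" "\<And>v. v \<in> coord_space n \<Longrightarrow> c v = g v"
      unfolding std_weight_def by blast
    have "f K = wsum g K" if "K \<in> Grassmann n k" for K
      using c(2)[OF that] wsum_cong[of K c g] g(2) that Gr by auto
    then show ?thesis using std_form_trivial[OF g(1) k] by blast
  next
    assume "std_weight k (coord_space n) (compl_weight k c)"
    then obtain g where g: "std_form k (coord_space n) g" "\<And>v. v \<in> coord_space n \<Longrightarrow> compl_weight k c v = g v"
      unfolding std_weight_def by blast
    have "f K = 1 - wsum g K" if K: "K \<in> Grassmann n k" for K
    proof -
      have "wsum (compl_weight k c) K = 1 - wsum c K" using K Gr by (intro wsum_compl[OF c(1) _ _ k]) auto
      moreover have "wsum (compl_weight k c) K = wsum g K" using g(2) K Gr by (intro wsum_cong) blast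
      ultimately show ?thesis using c(2)[OF K] by simp
    qed
    then show ?thesis using std_form_trivial[OF g(1) k] by blast
  qed
qed

lemma degree_one_trivial_imp_weight_trivial:
  assumes dot: "degree_one_trivial TYPE('a::{field,finite}) n k" and k: "k \<ge> 1" "k + 1 \<le> n"
  shows "weight_trivial k (coord_space n :: 'a vec set)"
  unfolding weight_trivial_def
proof (intro allI impI)
  fix c :: "'a vec \<Rightarrow> real" assume c: "boolean_weight k (coord_space n) c"
  have wc: "weight c" using c by (simp add: boolean_weight_def)
  have Gr: "K \<in> Grassmann n k \<longleftrightarrow> fvec.subspace K \<and> K \<subseteq> coord_space n \<and> card K = CARD('a) ^ k"
    for K :: "'a vec set" by (rule Grassmann_iff_card)
  have "degree_one n k (wsum c)"
    using wsum_minus_zero[OF wc finite_sub_coord fvec.subspace_0] Gr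
    by (intro degree_oneI[of n k _ "\<lambda>v. c v / (real CARD('a) - 1)"]) blast
  moreover have "boolean_fun n k (wsum c)"
    using c Gr unfolding boolean_fun_def boolean_weight_def by blast
  ultimately have "trivial_fun n k (wsum c)" using dot unfolding degree_one_trivial_def by blast
  then obtain g where g: "std_form k (coord_space n) g"
    and eq: "(\<forall>K\<in>Grassmann n k. wsum c K = wsum g K) \<or> (\<forall>K\<in>Grassmann n k. wsum c K = 1 - wsum g K)"
    using trivial_std_form[OF _ k(1)] by blast
  note wg = std_form_weight[OF g]
  have big: "CARD('a) ^ (k + 1) \<le> card (coord_space n :: 'a vec set)"
    using k(2) card_field_ge_2[where 'a='a] unfolding card_coord_space by (intro power_increasing) auto
  have uniq: "c' v = g v" if c': "weight c'" and e: "\<And>K. K \<in> Grassmann n k \<Longrightarrow> wsum c' K = wsum g K"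
    and v: "v \<in> coord_space n" for c' v
  proof -
    have "(\<lambda>v. c' v - g v) v = 0"
    proof (rule weight_unique[OF weight_diff[OF c' wg] k(1) subspace_coord_space finite_coord_space big _ v])
      show "wsum (\<lambda>v. c' v - g v) K = 0"
        if "fvec.subspace K" "K \<subseteq> coord_space n" "card K = CARD('a) ^ k" for K
        using e[of K] that Gr by (simp add: wsum_diff)
    qed
    then show ?thesis by simp
  qed
  from eq show "classified k (coord_space n) c" unfolding classified_def std_weight_def
  proof
    assume "\<forall>K\<in>Grassmann n k. wsum c K = wsum g K"
    then have "\<forall>v\<in>coord_space n. c v = g v" using uniq[OF wc] by blast
    then show "(\<exists>g. std_form k (coord_space n) g \<and> (\<forall>v\<in>coord_space n. c v = g v)) \<or>
        (\<exists>g. std_form k (coord_space n) g \<and> (\<forall>v\<in>coord_space n. compl_weight k c v = g v))" using g by blast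
  next
    assume *: "\<forall>K\<in>Grassmann n k. wsum c K = 1 - wsum g K"
    have "wsum (compl_weight k c) K = wsum g K" if K: "K \<in> Grassmann n k" for K
      using wsum_compl[OF wc _ _ k(1), of K] K Gr * by simp
    then have "\<forall>v\<in>coord_space n. compl_weight k c v = g v" using uniq[OF weight_compl[OF wc]] by blast
    then show "(\<exists>g. std_form k (coord_space n) g \<and> (\<forall>v\<in>coord_space n. c v = g v)) \<or>
        (\<exists>g. std_form k (coord_space n) g \<and> (\<forall>v\<in>coord_space n. compl_weight k c v = g v))" using g by blast
  qed
qed

section \<open>Duality\<close>

text \<open>
  The orthogonal complement in \<open>F\<^sup>n\<close>.
\<close>

definition perp :: "nat \<Rightarrow> 'a::field vec set \<Rightarrow> 'a vec set" where
  "perp n K = {v\<in>coord_space n. \<forall>u\<in>K. bilin n u v = 0}"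

lemma subspace_perp: "fvec.subspace (perp n K)"
  by (rule fvec.subspaceI)
    (simp_all add: perp_def coord_0 coord_add coord_scale bilin_zero bilin_add bilin_scale)

lemma card_orthogonal_part:
  fixes K :: "'a::{field,finite} vec set"
  assumes K: "fvec.subspace K" "K \<subseteq> coord_space n" and w: "w \<in> coord_space n"
  shows "real CARD('a) * real (card {u\<in>K. bilin n u w = 0}) =
    (if w \<in> perp n K then real CARD('a) * real (card K) else real (card K))"
proof (cases "w \<in> perp n K")
  case True
  then have "{u\<in>K. bilin n u w = 0} = K" by (auto simp: perp_def)
  then show ?thesis using True by simp
next
  case False
  then obtain x where "x \<in> K" "bilin n w x \<noteq> 0" using w bilin_commute[of n w] by (auto simp: perp_def)
  from kernel_hyperplane[OF K(1) this] have "card K = CARD('a) * card {u\<in>K. bilin n u w = 0}"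
    by (simp add: hyperplane_def bilin_commute[of n w])
  then have "real (card K) = real CARD('a) * real (card {u\<in>K. bilin n u w = 0})"
    by (metis of_nat_mult)
  then show ?thesis using False by simp
qed

text \<open>
  Double counting of the orthogonal pairs in \<open>K \<times> F\<^sup>n\<close>: a vector is orthogonal to all of a subspace or to
  a hyperplane of it.
\<close>

lemma card_perp:
  fixes K :: "'a::{field,finite} vec set"
  assumes K: "fvec.subspace K" "K \<subseteq> coord_space n"
  shows "card (perp n K) * card K = CARD('a) ^ n"
proof -
  define q where "q = real CARD('a)"
  have q2: "q \<ge> 2" using card_field_ge_2[where 'a='a] by (simp add: q_def)
  let ?C = "coord_space n :: 'a vec set"
  have finC: "finite ?C" by (rule finite_coord_space)
  have finK: "finite K" using K(2) by (rule finite_sub_coord)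
  have perpC: "perp n K \<subseteq> ?C" by (auto simp: perp_def)
  have cC: "real (card ?C) = q ^ n" by (simp add: card_coord_space q_def)
  have perp0: "v \<in> perp n ?C \<longleftrightarrow> v = 0" if v: "v \<in> ?C" for v
  proof
    assume "v \<in> perp n ?C"
    then show "v = 0" using bilin_nondegenerate[OF v] bilin_commute[of n v] by (auto simp: perp_def)
  qed (simp add: perp_def bilin_zero coord_0)
  have "(\<Sum>w\<in>?C. card {u\<in>K. bilin n u w = 0}) = (\<Sum>u\<in>K. card {w\<in>?C. bilin n u w = 0})"
    using sum.swap[of "\<lambda>w u. if bilin n u w = 0 then 1 else 0 :: nat" K ?C] finC finK
    by (simp add: sum.If_cases Int_def)
  then have "(\<Sum>w\<in>?C. q * real (card {u\<in>K. bilin n u w = 0})) = (\<Sum>u\<in>K. q * real (card {w\<in>?C. bilin n u w = 0}))"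
    unfolding sum_distrib_left[symmetric] of_nat_sum[symmetric] by simp
  also have "(\<Sum>w\<in>?C. q * real (card {u\<in>K. bilin n u w = 0})) =
      (\<Sum>w\<in>?C. if w \<in> perp n K then q * real (card K) else real (card K))"
    unfolding q_def by (intro sum.cong refl card_orthogonal_part K)
  also have "\<dots> = (\<Sum>w\<in>?C. real (card K) + (if w \<in> perp n K then (q - 1) * real (card K) else 0))"
    by (intro sum.cong) (auto simp: algebra_simps)
  also have "\<dots> = q ^ n * real (card K) + real (card (perp n K)) * ((q - 1) * real (card K))"
    using finC perpC cC by (simp add: sum.distrib sum.If_cases Int_absorb1)
  also have "(\<Sum>u\<in>K. q * real (card {w\<in>?C. bilin n u w = 0})) = (\<Sum>u\<in>K. q ^ n + (if u = 0 then (q - 1) * q ^ n else 0))"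
  proof (rule sum.cong[OF refl])
    fix u assume "u \<in> K"
    then have u: "u \<in> ?C" using K(2) by blast
    have "{w\<in>?C. bilin n u w = 0} = {w\<in>?C. bilin n w u = 0}" by (simp add: bilin_commute)
    then have "q * real (card {w\<in>?C. bilin n u w = 0}) = (if u = 0 then q * q ^ n else q ^ n)"
      using card_orthogonal_part[OF subspace_coord_space order_refl u] perp0[OF u] cC by (simp add: q_def)
    then show "q * real (card {w\<in>?C. bilin n u w = 0}) = q ^ n + (if u = 0 then (q - 1) * q ^ n else 0)"
      by (simp add: algebra_simps)
  qed
  also have "\<dots> = real (card K) * q ^ n + (q - 1) * q ^ n"
    using finK fvec.subspace_0[OF K(1)] by (simp add: sum.distrib)
  finally have "(q - 1) * (real (card (perp n K)) * real (card K)) = (q - 1) * q ^ n"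
    by (simp add: algebra_simps)
  then have "real (card (perp n K) * card K) = real (CARD('a) ^ n)" using q2 by (simp add: q_def)
  then show ?thesis by (simp only: of_nat_eq_iff)
qed

lemma perp_Grassmann:
  fixes K :: "'a::{field,finite} vec set"
  assumes K: "K \<in> Grassmann n k" and k: "k \<le> n"
  shows "perp n K \<in> Grassmann n (n - k)" "perp n (perp n K) = K"
proof -
  have K': "fvec.subspace K" "K \<subseteq> coord_space n" "card K = CARD('a) ^ k"
    using K by (auto simp: Grassmann_iff_card)
  have pC: "perp n K \<subseteq> coord_space n" for K :: "'a vec set" by (auto simp: perp_def)
  have q: "CARD('a) > 0" by simp
  have "card (perp n K) * CARD('a) ^ k = CARD('a) ^ (n - k) * CARD('a) ^ k"
    using card_perp[OF K'(1,2)] K'(3) k by (simp add: power_add[symmetric])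
  then have cp: "card (perp n K) = CARD('a) ^ (n - k)" using q by simp
  then show "perp n K \<in> Grassmann n (n - k)"
    using subspace_perp[of n K] pC[of K] by (simp add: Grassmann_iff_card)
  have "card (perp n (perp n K)) * card (perp n K) = CARD('a) ^ n"
    by (rule card_perp[OF subspace_perp pC])
  then have "card (perp n (perp n K)) * CARD('a) ^ (n - k) = CARD('a) ^ k * CARD('a) ^ (n - k)"
    using cp k by (simp add: power_add[symmetric])
  then have "card (perp n (perp n K)) = card K" using q K'(3) by simp
  moreover have "K \<subseteq> perp n (perp n K)"
  proof
    fix x assume x: "x \<in> K"
    then have "bilin n u x = 0" if "u \<in> perp n K" for u
      using that bilin_commute[of n u x] by (simp add: perp_def)
    then show "x \<in> perp n (perp n K)" using x K'(2) by (auto simp: perp_def[of n "perp n K"])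
  qed
  ultimately show "perp n (perp n K) = K"
    using finite_sub_coord[OF pC] by (intro card_subset_eq[symmetric]) auto
qed

lemma x_fun_perp:
  assumes p: "p \<in> points n"
  shows "x_fun p (perp n M) = y_fun n p M"
proof -
  have "p \<subseteq> coord_space n" using p by (simp add: Grassmann_def)
  then have "p \<subseteq> perp n M \<longleftrightarrow> orthogonal_spaces n M p"
    by (auto simp: perp_def orthogonal_spaces_def subset_iff)
  then have "p \<subseteq> perp n M \<longleftrightarrow> orthogonal_spaces n p M"
    using orthogonal_commute[of n M p] by simp
  then show ?thesis by (simp add: x_fun_def y_fun_def)
qed

text \<open>
  The condition that \<open>v\<close> lies in the complement of \<open>K\<close> is a degree one function of \<open>K\<close>: the number of
  \<open>u\<close> in \<open>K\<close> orthogonal to \<open>v\<close> takes one of two values. The constants \<open>a\<close> and \<open>b\<close> solve the two linear equations that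
  turn these values into \<open>1\<close> and \<open>0\<close>.
\<close>

lemma degree_one_perp:
  fixes f :: "'a::{field,finite} vec set \<Rightarrow> real"
  assumes f: "degree_one n (n - k) f" and k: "1 \<le> k" "k \<le> n"
  shows "degree_one n k (\<lambda>K. f (perp n K))"
proof -
  obtain c where c: "weight c" "\<And>M. M \<in> Grassmann n (n - k) \<Longrightarrow> f M = wsum c M"
    using degree_one_weight[OF f] by blast
  define q where "q = real CARD('a)"
  have q2: "q \<ge> 2" using card_field_ge_2[where 'a='a] by (simp add: q_def)
  define a where "a = 1 / (q ^ k - q ^ (k - 1))"
  define b where "b = 1 / (q ^ k - 1) - a"
  let ?C = "coord_space n :: 'a vec set"
  define w where "w u = (\<Sum>v\<in>?C. c v / (q - 1) * (a * (if bilin n u v = 0 then 1 else 0) + b))" for u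
  have qk: "q ^ k = q * q ^ (k - 1)" "q ^ (k - 1) \<ge> 1" using k q2 by (cases k; simp add: one_le_power)+
  then have qpos: "q ^ k - q ^ (k - 1) > 0" "q ^ k - 1 > 0"
  proof -
    have "1 * q ^ (k - 1) < q * q ^ (k - 1)" using q2 qk(2) by (intro mult_strict_right_mono) linarith+
    then show "q ^ k - q ^ (k - 1) > 0" "q ^ k - 1 > 0" using qk by linarith+
  qed
  show ?thesis
  proof (rule degree_oneI)
    fix K :: "'a vec set" assume K: "K \<in> Grassmann n k"
    have K': "fvec.subspace K" "K \<subseteq> ?C" "card K = CARD('a) ^ k" using K by (auto simp: Grassmann_iff_card)
    have finK: "finite K" and K0: "0 \<in> K" using finite_sub_coord[OF K'(2)] fvec.subspace_0[OF K'(1)] .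
    have ind: "(\<Sum>u\<in>K - {0}. a * (if bilin n u v = 0 then 1 else 0) + b) = (if v \<in> perp n K then 1 else 0)"
      if v: "v \<in> ?C" for v
    proof -
      define m where "m = real (card {u\<in>K. bilin n u v = 0})"
      have m: "q * m = (if v \<in> perp n K then q * q ^ k else q ^ k)"
        using card_orthogonal_part[OF K'(1,2) v] K'(3) by (simp add: m_def q_def)
      have "(\<Sum>u\<in>K. a * (if bilin n u v = 0 then 1 else 0) + b) = a * m + q ^ k * b"
        using finK K'(3)
        by (simp add: sum.distrib sum_distrib_left[symmetric] sum.If_cases Int_def m_def q_def)
      moreover have "(\<Sum>u\<in>K. a * (if bilin n u v = 0 then 1 else 0) + b) =
          (a + b) + (\<Sum>u\<in>K - {0}. a * (if bilin n u v = 0 then 1 else 0) + b)"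
        using finK K0 bilin_zero[of n v] bilin_commute[of n 0 v] by (simp add: sum.remove[of K 0])
      ultimately have sum: "(\<Sum>u\<in>K - {0}. a * (if bilin n u v = 0 then 1 else 0) + b) =
          a * (m - 1) + b * (q ^ k - 1)" by (simp add: algebra_simps)
      have bq: "b * (q ^ k - 1) = 1 - a * (q ^ k - 1)"
        using qpos by (simp add: b_def left_diff_distrib)
      have "a * (m - 1) + b * (q ^ k - 1) = 1 - a * (q ^ k - m)" unfolding bq by (simp add: algebra_simps)
      also have "\<dots> = (if v \<in> perp n K then 1 else 0)"
      proof (cases "v \<in> perp n K")
        case True
        then have "m = q ^ k" using m q2 by simp
        then show ?thesis using True by simp
      next
        case False
        then have "m = q ^ (k - 1)" using m qk(1) q2 by simp
        then show ?thesis using False qpos by (simp add: a_def)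
      qed
      finally show ?thesis using sum by simp
    qed
    have "(\<Sum>u\<in>K - {0}. w u) =
        (\<Sum>v\<in>?C. \<Sum>u\<in>K - {0}. c v / (q - 1) * (a * (if bilin n u v = 0 then 1 else 0) + b))"
      unfolding w_def by (rule sum.swap)
    also have "\<dots> = (\<Sum>v\<in>?C. c v / (q - 1) * (if v \<in> perp n K then 1 else 0))"
      using ind by (intro sum.cong refl) (simp only: sum_distrib_left[symmetric])
    also have "\<dots> = (\<Sum>v\<in>perp n K. c v / (q - 1))"
      by (intro sum.mono_neutral_cong_right) (auto simp: perp_def finite_coord_space)
    also have "\<dots> = wsum c (perp n K)" by (simp add: wsum_def sum_divide_distrib q_def)
    also have "\<dots> = f (perp n K)" using c(2)[OF perp_Grassmann(1)[OF K k(2)]] by simp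
    finally show "f (perp n K) = (\<Sum>u\<in>K - {0}. w u)" by simp
  qed
qed

lemma degree_one_trivial_dual:
  assumes dot: "degree_one_trivial TYPE('a::{field,finite}) n k" and k: "1 \<le> k" "k \<le> n"
  shows "degree_one_trivial TYPE('a) n (n - k)"
  unfolding degree_one_trivial_def
proof (intro allI impI, elim conjE)
  fix f :: "'a vec set \<Rightarrow> real"
  assume b: "boolean_fun n (n - k) f" and d: "degree_one n (n - k) f"
  define g where "g K = f (perp n K)" for K
  have "boolean_fun n k g"
    using b perp_Grassmann(1)[OF _ k(2)] unfolding boolean_fun_def g_def by blast
  moreover have "degree_one n k g" unfolding g_def by (rule degree_one_perp[OF d k])
  ultimately have triv: "trivial_fun n k g" using dot unfolding degree_one_trivial_def by blast
  have M: "perp n M \<in> Grassmann n k" "f M = g (perp n M)" "perp n (perp n M) = M"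
    if "M \<in> Grassmann n (n - k)" for M :: "'a vec set"
    using perp_Grassmann[OF that] k by (simp_all add: g_def)
  have xy: "x_fun p (perp n M) = y_fun n p M" if "p \<in> points n" for p M :: "'a vec set"
    using that by (rule x_fun_perp)
  have yx: "y_fun n p (perp n M) = x_fun p M" if "p \<in> points n" "M \<in> Grassmann n (n - k)" for p M :: "'a vec set"
    using x_fun_perp[OF that(1), of "perp n M"] M(3)[OF that(2)] by simp
  have eq: "eq_on_Grassmann n (n - k) f h'"
    if "eq_on_Grassmann n k g h" "\<And>M. M \<in> Grassmann n (n - k) \<Longrightarrow> h (perp n M) = h' M" for h h'
    using that M unfolding eq_on_Grassmann_def by metis
  from triv show "trivial_fun n (n - k) f"
    unfolding trivial_fun_def[of n k g]
  proof (elim disjE bexE conjE)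
    assume "eq_on_Grassmann n k g (\<lambda>V. 0)"
    from eq[OF this, of "\<lambda>V. 0"] show ?thesis unfolding trivial_fun_def by simp
  next
    assume "eq_on_Grassmann n k g (\<lambda>V. 1)"
    from eq[OF this, of "\<lambda>V. 1"] show ?thesis unfolding trivial_fun_def by simp
  next
    fix p assume p: "p \<in> points n" and "eq_on_Grassmann n k g (\<lambda>V. x_fun p V)"
    from eq[OF this(2), of "\<lambda>V. y_fun n p V"] p show ?thesis
      unfolding trivial_fun_def using xy by blast
  next
    fix p assume p: "p \<in> points n" and "eq_on_Grassmann n k g (\<lambda>V. 1 - x_fun p V)"
    from eq[OF this(2), of "\<lambda>V. 1 - y_fun n p V"] p show ?thesis
      unfolding trivial_fun_def by (simp add: xy) blast
  next
    fix r assume r: "r \<in> points n" and "eq_on_Grassmann n k g (\<lambda>V. y_fun n r V)"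
    from eq[OF this(2), of "\<lambda>V. x_fun r V"] r show ?thesis
      unfolding trivial_fun_def by (simp add: yx) blast
  next
    fix r assume r: "r \<in> points n" and "eq_on_Grassmann n k g (\<lambda>V. 1 - y_fun n r V)"
    from eq[OF this(2), of "\<lambda>V. 1 - x_fun r V"] r show ?thesis
      unfolding trivial_fun_def by (simp add: yx) blast
  next
    fix p r assume pr: "p \<in> points n" "r \<in> points n" "\<not> orthogonal_spaces n p r"
      and e: "eq_on_Grassmann n k g (\<lambda>V. x_fun p V + y_fun n r V)" (is "eq_on_Grassmann _ _ _ ?h")
    have "eq_on_Grassmann n (n - k) f (\<lambda>V. x_fun r V + y_fun n p V)" (is "eq_on_Grassmann _ _ _ ?h'")
    proof (rule eq[OF e])
      fix M :: "'a vec set" assume "M \<in> Grassmann n (n - k)"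
      from xy[OF pr(1), of M] yx[OF pr(2) this] show "?h (perp n M) = ?h' M" by simp
    qed
    moreover have "\<not> orthogonal_spaces n r p" using pr(3) orthogonal_commute by blast
    ultimately show ?thesis unfolding trivial_fun_def using pr(1,2) by blast
  next
    fix p r assume pr: "p \<in> points n" "r \<in> points n" "\<not> orthogonal_spaces n p r"
      and e: "eq_on_Grassmann n k g (\<lambda>V. 1 - x_fun p V - y_fun n r V)" (is "eq_on_Grassmann _ _ _ ?h")
    have "eq_on_Grassmann n (n - k) f (\<lambda>V. 1 - x_fun r V - y_fun n p V)" (is "eq_on_Grassmann _ _ _ ?h'")
    proof (rule eq[OF e])
      fix M :: "'a vec set" assume "M \<in> Grassmann n (n - k)"
      from xy[OF pr(1), of M] yx[OF pr(2) this] show "?h (perp n M) = ?h' M" by simp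
    qed
    moreover have "\<not> orthogonal_spaces n r p" using pr(3) orthogonal_commute by blast
    ultimately show ?thesis unfolding trivial_fun_def using pr(1,2) by blast
  qed
qed

section \<open>Degree one triviality in large dimension\<close>

lemma weight_trivial_mono:
  assumes "weight_trivial k (coord_space m :: 'a::{field,finite} vec set)" "k \<ge> 2" "k + 1 \<le> m" "m \<le> n"
  shows "weight_trivial k (coord_space n :: 'a vec set)"
  using assms(4)
proof (induction n rule: dec_induct)
  case base
  show ?case by (rule assms(1))
next
  case (step n)
  show ?case
  proof (rule weight_trivial_Suc[of k n])
    show "card (coord_space (Suc n) :: 'a vec set) = CARD('a) ^ (n + 1)"
      by (simp add: card_coord_space)
    show "weight_trivial k W"
      if "fvec.subspace W" "W \<subseteq> coord_space (Suc n)" "card W = CARD('a) ^ n" for W :: "'a vec set"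
      by (rule weight_trivial_transport[OF step.IH that])
  qed (use assms step.hyps in \<open>auto simp: subspace_coord_space finite_coord_space\<close>)
qed

theorem theorem1p2:
  fixes q :: nat
  assumes "primepow q"
    and "CARD('a::{field,finite}) = q"
  shows "\<exists>N::nat. \<forall>n k::nat. n \<ge> N \<and> min k (n - k) \<ge> 2 \<longrightarrow> degree_one_trivial TYPE('a) n k"
proof -
  obtain N where N: "\<And>n. N \<le> n \<Longrightarrow> weight_trivial 2 (coord_space n :: 'a vec set)"
    using weight_trivial_2[where 'a='a] by blast
  have large: "degree_one_trivial TYPE('a) n j" if j: "2 \<le> j" "N \<le> j + 2" "j + 2 \<le> n" for n j
  proof -
    have "degree_one_trivial TYPE('a) (j + 2) 2"
      by (rule weight_trivial_imp_degree_one_trivial[OF N[OF j(2)]]) simp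
    then have "degree_one_trivial TYPE('a) (j + 2) (j + 2 - 2)" by (rule degree_one_trivial_dual) simp_all
    then have "weight_trivial j (coord_space (j + 2) :: 'a vec set)"
      using j(1) by (intro degree_one_trivial_imp_weight_trivial) simp_all
    then have "weight_trivial j (coord_space n :: 'a vec set)"
      using j by (rule_tac weight_trivial_mono[of j "j + 2"]) simp_all
    then show ?thesis using j(1) by (intro weight_trivial_imp_degree_one_trivial) simp_all
  qed
  show ?thesis
  proof (intro exI[of _ "2 * N"] allI impI, elim conjE)
    fix n k assume n: "2 * N \<le> n" and "2 \<le> min k (n - k)"
    then have k: "2 \<le> k" "2 \<le> n - k" by simp_all
    show "degree_one_trivial TYPE('a) n k"
    proof (cases "N \<le> k")
      case True
      then show ?thesis using k by (intro large) linarith+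
    next
      case False
      then have "degree_one_trivial TYPE('a) n (n - k)" using k n by (intro large) linarith+
      then have "degree_one_trivial TYPE('a) n (n - (n - k))" by (rule degree_one_trivial_dual) (use k in linarith)+
      moreover have "n - (n - k) = k" using k by linarith
      ultimately show ?thesis by simp
    qed
  qed
qed

end
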